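(* The quantum sample complexity of estimating the trace distance $\mathrm{T}(\rho,\sigma)=\frac12\operatorname{tr}|\rho-\sigma|$ between two unknown quantum states $\rho,\sigma$ of rank $r$ to within additive error $\varepsilon$ (with success probability at least $2/3$) is $O\!\left(\frac{r^2}{\varepsilon^4}\log^2\frac{1}{\varepsilon}\right)$.
   Context: Sample complexity is the minimum total number of independent copies of $\rho$ and $\sigma$ used by a quantum algorithm. *)

theory Defs
  imports Complex_Main "Jordan_Normal_Form.DL_Rank" "Jordan_Normal_Form.Schur_Decomposition"
begin

definition mat_trace :: "complex mat \<Rightarrow> complex" where
  "mat_trace A = (\<Sum>i<dim_row A. A $$ (i, i))"

definition psd_mat :: "complex mat \<Rightarrow> bool" where
  "psd_mat A \<longleftrightarrow> A \<in> carrier_mat (dim_row A) (dim_row A) \<and> A = mat_adjoint A \<and>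
     (\<forall>v \<in> carrier_vec (dim_row A). 0 \<le> Re (conjugate v \<bullet> (A *\<^sub>v v)))"

definition density_mat :: "nat \<Rightarrow> complex mat \<Rightarrow> bool" where
  "density_mat d \<rho> \<longleftrightarrow> \<rho> \<in> carrier_mat d d \<and> psd_mat \<rho> \<and> mat_trace \<rho> = 1"

definition mat_rank :: "nat \<Rightarrow> complex mat \<Rightarrow> nat" where
  "mat_rank d A = vec_space.rank d A"

definition abs_mat :: "complex mat \<Rightarrow> complex mat" where
  "abs_mat A = (THE B. psd_mat B \<and> B * B = mat_adjoint A * A)"

definition trace_dist :: "complex mat \<Rightarrow> complex mat \<Rightarrow> real" where
  "trace_dist \<rho> \<sigma> = Re (mat_trace (abs_mat (\<rho> - \<sigma>))) / 2"

definition tensor_mat :: "complex mat \<Rightarrow> complex mat \<Rightarrow> complex mat" where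
  "tensor_mat A B = mat (dim_row A * dim_row B) (dim_col A * dim_col B)
     (\<lambda>(i, j). A $$ (i div dim_row B, j div dim_col B) * B $$ (i mod dim_row B, j mod dim_col B))"

fun tensor_pow :: "complex mat \<Rightarrow> nat \<Rightarrow> complex mat" where
  "tensor_pow A 0 = 1\<^sub>m 1"
| "tensor_pow A (Suc k) = tensor_mat A (tensor_pow A k)"

definition povm :: "nat \<Rightarrow> nat \<Rightarrow> (nat \<Rightarrow> complex mat) \<Rightarrow> bool" where
  "povm D k M \<longleftrightarrow> (\<forall>i<k. M i \<in> carrier_mat D D \<and> psd_mat (M i)) \<and>
     (\<forall>a<D. \<forall>b<D. (\<Sum>i<k. M i $$ (a, b)) = (1\<^sub>m D) $$ (a, b))"

definition meas_prob :: "(nat \<Rightarrow> complex mat) \<Rightarrow> nat set \<Rightarrow> complex mat \<Rightarrow> real" where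
  "meas_prob M S \<tau> = (\<Sum>i\<in>S. Re (mat_trace (M i * \<tau>)))"

end

theory Submission
  imports Defs "HOL-Analysis.L2_Norm"
begin

text \<open>Split the copies into probes and programs. For a probe site \<open>p\<close>, let \<open>A p\<close> be the average of the
  swaps of \<open>p\<close> with all programs, with sign \<open>+\<close> for copies of \<open>\<rho>\<close> and \<open>-\<close> for copies of \<open>\<sigma>\<close>. On the
  product state, \<open>A p\<close> behaves like \<open>B = \<rho> - \<sigma>\<close> acting at \<open>p\<close>: the deviations coming from different
  programs are orthogonal, so the error in the \<open>L\<^sup>2\<close> norm of the state is of order \<open>1/sqrt n\<close>. If \<open>f\<close>
  is a combination of resolvents approximating the sign function up to scale \<open>\<delta> = \<epsilon>/(4 r)\<close>, then the
  resolvent identity turns this into \<open>f (A p) = f B + O(1/(\<delta> sqrt n))\<close>. The signed average of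
  \<open>f (A p)\<close> over the probes is a Hermitian observable, concentrated around \<open>tr (B * f B)\<close>, and this
  is within \<open>\<epsilon>\<close> of \<open>tr \<bar>B\<bar>\<close> because \<open>B\<close> has at most \<open>2 r\<close> nonzero eigenvalues. With \<open>n\<close> of order
  \<open>r\<^sup>2/\<epsilon>\<^sup>4\<close> the error is \<open>O(\<epsilon>)\<close>, and Chebyshev's inequality applies.\<close>

section \<open>Diagonalization of Hermitian matrices\<close>

text \<open>The obstacle: \<open>A p\<close> is built from swaps alone, without knowledge of the
  states, so it cannot be close to \<open>B\<close> in operator norm for all of them. The two agree
  only when applied to the product state, and perturbation bounds in operator norm are of no use.
  Every estimate is therefore stated for a matrix \<open>\<Psi>\<close> of Frobenius norm 1 such
  that \<open>\<Psi> * mat_adjoint \<Psi>\<close> is the state, with operators acting from the left.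
  Resolvents are the functions that survive this restriction. In S - R = -S (A - B) R the resolvent
  R of \<open>B\<close> stands next to \<open>\<Psi>\<close>; it acts on the probe site only and
  leaves all programs intact, so R \<open>\<Psi>\<close> is again a product and the swap estimate
  can be used once more, now with the smaller norm of R \<open>\<Psi>\<close>. S and R each cost
  1/|s|, and over the poles s = k \<delta> the weights 1/k^2 are summable, which is why the loss is
  only of order 1/\<delta>.\<close>

lemma adj_carrier [simp]: "A \<in> carrier_mat n m \<Longrightarrow> mat_adjoint A \<in> carrier_mat m n"
  unfolding mat_adjoint_def by auto

lemma adj_dim [simp]: "dim_row (mat_adjoint A) = dim_col A" "dim_col (mat_adjoint A) = dim_row A"
  unfolding mat_adjoint_def by auto

lemma adj_index [simp]:
  fixes A :: "complex mat"
  shows "i < dim_col A \<Longrightarrow> j < dim_row A \<Longrightarrow> mat_adjoint A $$ (i, j) = cnj (A $$ (j, i))"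
  unfolding mat_adjoint_def by (simp add: mat_of_rows_index conjugate_complex_def)

lemma mult_index:
  "A \<in> carrier_mat n m \<Longrightarrow> B \<in> carrier_mat m k \<Longrightarrow> i < n \<Longrightarrow> j < k \<Longrightarrow>
    (A * B) $$ (i, j) = (\<Sum>l<m. A $$ (i, l) * B $$ (l, j))"
  by (auto simp: scalar_prod_def atLeast0LessThan intro!: sum.cong)

lemma sq_mult_carrier [simp]:
  "A \<in> carrier_mat n n \<Longrightarrow> B \<in> carrier_mat n n \<Longrightarrow> A * B \<in> carrier_mat n n"
  by (rule mult_carrier_mat)

lemma sq_assoc:
  fixes A :: "complex mat"
  shows "A \<in> carrier_mat n n \<Longrightarrow> B \<in> carrier_mat n n \<Longrightarrow> C \<in> carrier_mat n n \<Longrightarrow>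
    A * B * C = A * (B * C)"
  by (rule assoc_mult_mat)

lemma adj_adj [simp]: "mat_adjoint (mat_adjoint A) = (A :: complex mat)"
  by (rule eq_matI) auto

lemma adj_mult:
  fixes A :: "complex mat"
  assumes "A \<in> carrier_mat n m" "B \<in> carrier_mat m k"
  shows "mat_adjoint (A * B) = mat_adjoint B * mat_adjoint A"
  using assms
  by (intro eq_matI) (auto simp: scalar_prod_def mult.commute intro!: sum.cong)

lemma adj_minus:
  fixes A :: "complex mat"
  assumes "A \<in> carrier_mat n m" "B \<in> carrier_mat n m"
  shows "mat_adjoint (A - B) = mat_adjoint A - mat_adjoint B"
  using assms by (intro eq_matI) auto

lemma adj_smult: "mat_adjoint (c \<cdot>\<^sub>m A) = cnj c \<cdot>\<^sub>m mat_adjoint (A :: complex mat)"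
  by (intro eq_matI) auto

lemma adj_one [simp]: "mat_adjoint (1\<^sub>m n) = (1\<^sub>m n :: complex mat)"
  by (intro eq_matI) auto

section \<open>Unitary matrices and the spectral theorem\<close>

definition unitary_mat :: "nat \<Rightarrow> complex mat \<Rightarrow> bool" where
  "unitary_mat n U \<longleftrightarrow> U \<in> carrier_mat n n \<and> mat_adjoint U * U = 1\<^sub>m n"

lemma unitary_right:
  "unitary_mat n U \<Longrightarrow> U * mat_adjoint U = 1\<^sub>m n"
  unfolding unitary_mat_def using mat_mult_left_right_inverse[of "mat_adjoint U" n U] by auto

lemma unitary_carrier: "unitary_mat n U \<Longrightarrow> U \<in> carrier_mat n n"
  unfolding unitary_mat_def by auto

lemma unitary_mult:
  assumes "unitary_mat n U" "unitary_mat n V"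
  shows "unitary_mat n (U * V)"
proof -
  have U: "U \<in> carrier_mat n n" and V: "V \<in> carrier_mat n n"
    using assms by (auto simp: unitary_mat_def)
  have "mat_adjoint (U * V) * (U * V) = mat_adjoint V * (mat_adjoint U * U) * V"
    using U V by (simp add: adj_mult[of _ n n _ n] sq_assoc[where n=n])
  then show ?thesis using assms U V by (auto simp: unitary_mat_def)
qed

text \<open>Functional calculus in a fixed eigenbasis: if \<open>A = diagonalized n U l\<close>,
  replacing \<open>l\<close> by \<open>\<lambda>i. h (l i)\<close> gives h(A), and products of
  functions of \<open>A\<close> become pointwise products. Values are complex so that resolvents are
  covered.\<close>

definition diagonalized :: "nat \<Rightarrow> complex mat \<Rightarrow> (nat \<Rightarrow> complex) \<Rightarrow> complex mat" where
  "diagonalized n U f = U * mat_diag n f * mat_adjoint U"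

lemma diagonalized_carrier [simp]: "U \<in> carrier_mat n n \<Longrightarrow> diagonalized n U f \<in> carrier_mat n n"
  unfolding diagonalized_def by (intro mult_carrier_mat[of _ _ n]) auto

lemma eigenvector_exists:
  fixes A :: "complex mat"
  assumes A: "A \<in> carrier_mat (Suc n) (Suc n)"
  obtains v e where "eigenvector A v e"
proof -
  obtain as where as: "char_poly A = (\<Prod>a\<leftarrow>as. [:- a, 1:])" "length as = Suc n"
    using char_poly_factorized[OF A] by blast
  then obtain a bs where "as = a # bs" by (cases as) auto
  then have "poly (char_poly A) a = 0" using as by simp
  then have "eigenvalue A a" using eigenvalue_root_char_poly[OF A] by simp
  then show ?thesis using that unfolding eigenvalue_def by blast
qed

text \<open>Gram-Schmidt leaves the first vector unchanged, so a basis that begins with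
  \<open>v\<close> keeps its direction. The resulting vectors are orthogonal but not normalized;
  dividing the columns by their lengths makes the matrix unitary.\<close>

lemma unitary_first_column:
  fixes v :: "complex vec"
  assumes v: "v \<in> carrier_vec n" "v \<noteq> 0\<^sub>v n"
  obtains W c where "unitary_mat n W" "\<And>x. x < n \<Longrightarrow> W $$ (x, 0) = c * v $ x"
proof -
  interpret cof_vec_space n "TYPE(complex)" .
  have n: "n \<noteq> 0" using v by (metis carrier_vecD eq_vecI less_nat_zero_code index_zero_vec(2))
  define b where "b = basis_completion v"
  define ws where "ws = gram_schmidt n b"
  from basis_completion[OF v, folded b_def]
  have dist_b: "distinct b" and indep: "\<not> lin_dep (set b)" and b: "set b \<subseteq> carrier_vec n"
    and hdb: "hd b = v" and len_b: "length b = n" by auto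
  from hdb len_b n obtain vs where bv: "b = v # vs" by (cases b) auto
  from gram_schmidt_result[OF b dist_b indep refl, folded ws_def]
  have ws: "set ws \<subseteq> carrier_vec n" "corthogonal ws" "length ws = n" by (auto simp: len_b)
  have hdws: "hd ws = v" unfolding ws_def using gram_schmidt_hd[OF v(1), of vs, folded bv] .
  have wsc: "i < n \<Longrightarrow> ws ! i \<in> carrier_vec n" for i using ws by auto
  define g where "g i j = (\<Sum>x<n. ws ! i $ x * cnj (ws ! j $ x))" for i j
  \<comment> \<open>\<open>corthogonal\<close> says both that distinct vectors are orthogonal and
    that no vector is null; the second half gives \<open>s i \<noteq> 0\<close>.\<close>
  have g: "(g i j = 0) = (i \<noteq> j)" if "i < n" "j < n" for i j
    using corthogonalD[OF ws(2), of i j] that ws(3) wsc[OF that(2)] wsc[OF that(1)]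
    by (auto simp: g_def scalar_prod_def atLeast0LessThan conjugate_complex_def)
  define s where "s i = sqrt (\<Sum>x<n. (cmod (ws ! i $ x))\<^sup>2)" for i
  have gs: "g i i = of_real ((s i)\<^sup>2)" for i
  proof -
    have "(s i)\<^sup>2 = (\<Sum>x<n. (cmod (ws ! i $ x))\<^sup>2)"
      unfolding s_def by (intro real_sqrt_pow2 sum_nonneg) simp
    then show ?thesis unfolding g_def of_real_sum[symmetric] by (simp only: of_real_sum complex_norm_square)
  qed
  have s0: "i < n \<Longrightarrow> s i \<noteq> 0" for i using g[of i i] gs[of i] by auto
  define W where "W = mat n n (\<lambda>(x, i). ws ! i $ x / of_real (s i))"
  have "mat_adjoint W * W = 1\<^sub>m n"
  proof (rule eq_matI)
    fix i j assume ij: "i < dim_row (1\<^sub>m n :: complex mat)" "j < dim_col (1\<^sub>m n :: complex mat)"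
    have "(mat_adjoint W * W) $$ (i, j) = (\<Sum>x<n. cnj (W $$ (x, i)) * W $$ (x, j))"
      using ij by (subst mult_index[of _ n n _ n]) (auto simp: W_def)
    also have "\<dots> = g j i / (of_real (s i) * of_real (s j))"
      unfolding g_def sum_divide_distrib using ij by (intro sum.cong) (auto simp: W_def)
    also have "\<dots> = 1\<^sub>m n $$ (i, j)"
      using ij g[of j i] gs[of i] s0[of i] by (auto simp: power2_eq_square)
    finally show "(mat_adjoint W * W) $$ (i, j) = 1\<^sub>m n $$ (i, j)" .
  qed (auto simp: W_def)
  then have "unitary_mat n W" by (auto simp: unitary_mat_def W_def)
  moreover have "W $$ (x, 0) = (1 / of_real (s 0)) * v $ x" if "x < n" for x
    using that n hdws ws(3) by (cases ws) (auto simp: W_def)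
  ultimately show ?thesis using that by blast
qed

lemma four_block_one: "four_block_mat (1\<^sub>m 1) (0\<^sub>m 1 n) (0\<^sub>m n 1) (1\<^sub>m n) = 1\<^sub>m (Suc n)"
  by (rule eq_matI) auto

text \<open>Deflation: once an eigenvector is the first basis vector, the first column of the
  conjugated matrix vanishes below the diagonal, and self-adjointness clears the first row as well.
  The induction hypothesis applies to the remaining block.\<close>

theorem hermitian_diagonalization:
  fixes A :: "complex mat"
  assumes "A \<in> carrier_mat n n" "mat_adjoint A = A"
  shows "\<exists>U (l :: nat \<Rightarrow> real). unitary_mat n U \<and> A = diagonalized n U (\<lambda>i. of_real (l i))"
  using assms
proof (induction n arbitrary: A)
  case 0
  then show ?case
    by (intro exI[of _ "1\<^sub>m 0"] exI[of _ "\<lambda>_. 0"]) (auto simp: unitary_mat_def diagonalized_def intro!: eq_matI)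
next
  case (Suc n A)
  let ?N = "Suc n"
  obtain v e where ev: "eigenvector A v e" using eigenvector_exists[OF Suc.prems(1)] .
  then have v: "v \<in> carrier_vec ?N" "v \<noteq> 0\<^sub>v ?N" "A *\<^sub>v v = e \<cdot>\<^sub>v v"
    using Suc.prems(1) unfolding eigenvector_def by auto
  obtain W c where W: "unitary_mat ?N W" and W0: "\<And>x. x < ?N \<Longrightarrow> W $$ (x, 0) = c * v $ x"
    using unitary_first_column[OF v(1,2)] by metis
  have Wc: "W \<in> carrier_mat ?N ?N" and WW: "mat_adjoint W * W = 1\<^sub>m ?N"
    using W by (auto simp: unitary_mat_def)
  have AW0: "(A * W) $$ (x, 0) = e * W $$ (x, 0)" if "x < ?N" for x
  proof -
    have "(A * W) $$ (x, 0) = (\<Sum>y<?N. A $$ (x, y) * W $$ (y, 0))"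
      using that Suc.prems(1) Wc by (subst mult_index[of _ ?N ?N _ ?N]) auto
    also have "\<dots> = c * (\<Sum>y<?N. A $$ (x, y) * v $ y)"
      unfolding sum_distrib_left by (intro sum.cong) (auto simp: W0)
    also have "(\<Sum>y<?N. A $$ (x, y) * v $ y) = (A *\<^sub>v v) $ x"
      using that Suc.prems(1) v(1) by (auto simp: scalar_prod_def atLeast0LessThan intro!: sum.cong)
    also have "\<dots> = e * v $ x" using v that by simp
    finally show ?thesis using W0[OF that] by simp
  qed
  define A' where "A' = mat_adjoint W * A * W"
  have A'c: "A' \<in> carrier_mat ?N ?N" unfolding A'_def using Wc Suc.prems(1) by auto
  have A'h: "mat_adjoint A' = A'"
    unfolding A'_def using Wc Suc.prems
    by (simp add: adj_mult[of _ ?N ?N _ ?N] sq_assoc[where n="?N"])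
  have A'0: "A' $$ (i, 0) = (if i = 0 then e else 0)" if "i < ?N" for i
  proof -
    have WA: "mat_adjoint W \<in> carrier_mat ?N ?N" "A * W \<in> carrier_mat ?N ?N"
      using Wc Suc.prems(1) by simp_all
    have "A' $$ (i, 0) = (mat_adjoint W * (A * W)) $$ (i, 0)"
      unfolding A'_def using sq_assoc[OF WA(1) Suc.prems(1) Wc] by (rule arg_cong)
    also have "\<dots> = (\<Sum>x<?N. mat_adjoint W $$ (i, x) * (A * W) $$ (x, 0))"
      by (rule mult_index[OF WA that zero_less_Suc])
    also have "\<dots> = e * (\<Sum>x<?N. mat_adjoint W $$ (i, x) * W $$ (x, 0))"
      unfolding sum_distrib_left by (intro sum.cong) (auto simp: AW0)
    also have "(\<Sum>x<?N. mat_adjoint W $$ (i, x) * W $$ (x, 0)) = (mat_adjoint W * W) $$ (i, 0)"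
      using that Wc by (subst mult_index[of _ ?N ?N _ ?N]) auto
    finally show ?thesis using that by (simp add: WW)
  qed
  have A'sym: "A' $$ (i, j) = cnj (A' $$ (j, i))" if "i < ?N" "j < ?N" for i j
    using arg_cong[OF A'h, of "\<lambda>M. M $$ (i, j)"] that A'c by auto
  \<comment> \<open>A diagonal entry of a self-adjoint matrix equals its own conjugate; this makes
    the eigenvalue real.\<close>
  have "e = of_real (Re e)" using A'sym[of 0 0] A'0[of 0] by (simp add: complex_eq_iff)
  then obtain e' where e: "e = complex_of_real e'" by blast
  have A'0': "A' $$ (0, i) = (if i = 0 then e else 0)" if "i < ?N" for i
    using A'sym[of 0 i] A'0[of i] that e by (cases "i = 0") (auto simp: A'0)
  define B where "B = mat n n (\<lambda>(i, j). A' $$ (Suc i, Suc j))"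
  have Bc: "B \<in> carrier_mat n n" by (simp add: B_def)
  have "mat_adjoint B = B"
    by (rule eq_matI) (auto simp: B_def A'sym[symmetric])
  with Suc.IH[OF Bc] obtain V l where V: "unitary_mat n V" and B: "B = diagonalized n V (\<lambda>i. of_real (l i))"
    by blast
  have Vc: "V \<in> carrier_mat n n" using V by (rule unitary_carrier)
  define E where "E = mat 1 1 (\<lambda>_. e)"
  define X where "X = four_block_mat (1\<^sub>m 1) (0\<^sub>m 1 n) (0\<^sub>m n 1) V"
  have Xa: "mat_adjoint X = four_block_mat (1\<^sub>m 1) (0\<^sub>m 1 n) (0\<^sub>m n 1) (mat_adjoint V)"
    unfolding X_def using Vc by (intro eq_matI) auto
  have Xc: "X \<in> carrier_mat ?N ?N" unfolding X_def using Vc by auto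
  have "mat_adjoint X * X = four_block_mat (1\<^sub>m 1) (0\<^sub>m 1 n) (0\<^sub>m n 1) (1\<^sub>m n)"
    unfolding Xa unfolding X_def using Vc V
    by (subst mult_four_block_mat[of _ 1 1 _ n _ n _ _ 1 _ n]) (auto simp: unitary_mat_def)
  also have "\<dots> = 1\<^sub>m ?N" by (rule four_block_one)
  finally have "mat_adjoint X * X = 1\<^sub>m ?N" .
  then have X: "unitary_mat ?N X" using Xc by (auto simp: unitary_mat_def)
  define l' where "l' i = (case i of 0 \<Rightarrow> e' | Suc k \<Rightarrow> l k)" for i
  have D: "mat_diag ?N (\<lambda>i. of_real (l' i)) = four_block_mat E (0\<^sub>m 1 n) (0\<^sub>m n 1) (mat_diag n (\<lambda>i. of_real (l i)))"
    using e by (intro eq_matI) (auto simp: mat_diag_def E_def l'_def split: nat.splits)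
  have "diagonalized ?N X (\<lambda>i. of_real (l' i)) = four_block_mat E (0\<^sub>m 1 n) (0\<^sub>m n 1) B"
    unfolding diagonalized_def D Xa B unfolding X_def using Vc
    by (subst mult_four_block_mat[of _ 1 1 _ n _ n _ _ 1 _ n]; (subst mult_four_block_mat[of _ 1 1 _ n _ n _ _ 1 _ n])?)
       (auto simp: E_def left_mult_zero_mat[OF mat_diag_dim] right_mult_zero_mat[OF mult_carrier_mat[OF _ mat_diag_dim]])
  also have "\<dots> = A'"
    by (rule eq_matI) (use A'c in \<open>auto simp: E_def B_def A'0 A'0' Suc_diff_Suc\<close>)
  finally have A'X: "diagonalized ?N X (\<lambda>i. of_real (l' i)) = A'" .
  have "A = W * A' * mat_adjoint W"
  proof -
    have "W * A' * mat_adjoint W = (W * mat_adjoint W) * A * (W * mat_adjoint W)"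
      unfolding A'_def using Wc Suc.prems(1)
      by (simp add: sq_assoc[where n="?N"])
    then show ?thesis using unitary_right[OF W] Suc.prems(1) by simp
  qed
  also have "\<dots> = diagonalized ?N (W * X) (\<lambda>i. of_real (l' i))"
    unfolding A'X[symmetric] diagonalized_def using Wc Xc mat_diag_dim[of ?N "\<lambda>i. complex_of_real (l' i)"]
    by (simp add: adj_mult[of _ ?N ?N _ ?N] sq_assoc[where n="?N"])
  finally show ?case using unitary_mult[OF W X] by blast
qed

section \<open>Frobenius norm\<close>

lemma mat_eqI:
  assumes "A \<in> carrier_mat n m" "B \<in> carrier_mat n m"
    and "\<And>i j. i < n \<Longrightarrow> j < m \<Longrightarrow> A $$ (i, j) = B $$ (i, j)"
  shows "A = B"
  using assms by (intro eq_matI) auto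

lemma adj_index': "A \<in> carrier_mat n m \<Longrightarrow> i < m \<Longrightarrow> j < n \<Longrightarrow> mat_adjoint A $$ (i, j) = cnj (A $$ (j, i))"
  by simp

lemma minus_index: "A \<in> carrier_mat n m \<Longrightarrow> B \<in> carrier_mat n m \<Longrightarrow> i < n \<Longrightarrow> j < m \<Longrightarrow>
  (A - B) $$ (i, j) = A $$ (i, j) - B $$ (i, j)"
  by simp

lemma diagonalized_dim [simp]: "dim_row (diagonalized n U f) = dim_row U" "dim_col (diagonalized n U f) = dim_row U"
  by (simp_all add: diagonalized_def)

text \<open>The Hilbert-Schmidt norm, written through \<open>L2_set\<close> over index pairs so that
  Minkowski's inequality is at hand. If \<open>\<Psi> * mat_adjoint \<Psi> = \<tau>\<close>, then
  \<open>\<Psi>\<close> acts as a purification of \<open>\<tau>\<close>, and the square of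
  \<open>frob (X * \<Psi>)\<close> is the expectation of \<open>mat_adjoint X * X\<close> in
  \<open>\<tau>\<close>.\<close>

definition frob :: "complex mat \<Rightarrow> real" where
  "frob M = L2_set (\<lambda>(i, j). cmod (M $$ (i, j))) ({..<dim_row M} \<times> {..<dim_col M})"

definition frob_inner :: "complex mat \<Rightarrow> complex mat \<Rightarrow> complex" where
  "frob_inner M N = (\<Sum>i<dim_row M. \<Sum>j<dim_col M. cnj (M $$ (i, j)) * N $$ (i, j))"

lemma frob_nonneg [simp]: "0 \<le> frob M"
  unfolding frob_def by (rule L2_set_nonneg)

lemma frob_sq: "(frob M)\<^sup>2 = (\<Sum>i<dim_row M. \<Sum>j<dim_col M. (cmod (M $$ (i, j)))\<^sup>2)"
proof -
  have "(frob M)\<^sup>2 = (\<Sum>p\<in>{..<dim_row M} \<times> {..<dim_col M}. (cmod (M $$ p))\<^sup>2)"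
    unfolding frob_def L2_set_def by (subst real_sqrt_pow2) (auto intro!: sum_nonneg sum.cong)
  then show ?thesis by (simp add: sum.cartesian_product case_prod_unfold)
qed

lemma frob_inner_self: "frob_inner M M = of_real ((frob M)\<^sup>2)"
  unfolding frob_inner_def frob_sq of_real_sum
  by (intro sum.cong refl) (simp only: complex_norm_square mult.commute)

lemma frob_inner_trace:
  assumes "M \<in> carrier_mat n m" "N \<in> carrier_mat n m"
  shows "frob_inner M N = mat_trace (mat_adjoint M * N)"
proof -
  have "mat_trace (mat_adjoint M * N) = (\<Sum>j<m. \<Sum>i<n. cnj (M $$ (i, j)) * N $$ (i, j))"
    unfolding mat_trace_def using assms
    by (auto simp: mult_index[of _ m n _ m] simp del: index_mult_mat(1) intro!: sum.cong)
  then show ?thesis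
    unfolding frob_inner_def using assms by (subst sum.swap) auto
qed

lemma mat_trace_comm:
  assumes "A \<in> carrier_mat n m" "B \<in> carrier_mat m n"
  shows "mat_trace (A * B) = mat_trace (B * A)"
proof -
  have "mat_trace (A * B) = (\<Sum>i<n. \<Sum>j<m. A $$ (i, j) * B $$ (j, i))"
    unfolding mat_trace_def using assms by (auto simp: mult_index[of _ n m _ n] simp del: index_mult_mat(1) intro!: sum.cong)
  also have "\<dots> = (\<Sum>j<m. \<Sum>i<n. B $$ (j, i) * A $$ (i, j))"
    by (subst sum.swap) (simp add: mult.commute)
  also have "\<dots> = mat_trace (B * A)"
    unfolding mat_trace_def using assms by (auto simp: mult_index[of _ m n _ m] simp del: index_mult_mat(1) intro!: sum.cong)
  finally show ?thesis .
qed

lemma frob_triangle: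
  assumes "M \<in> carrier_mat n m" "N \<in> carrier_mat n m"
  shows "frob (M + N) \<le> frob M + frob N"
proof -
  let ?S = "{..<n} \<times> {..<m}"
  have "frob (M + N) = L2_set (\<lambda>p. cmod (M $$ p + N $$ p)) ?S"
    unfolding frob_def using assms by (intro L2_set_cong) auto
  also have "\<dots> \<le> L2_set (\<lambda>p. cmod (M $$ p) + cmod (N $$ p)) ?S"
    by (intro L2_set_mono) (auto intro: norm_triangle_ineq)
  also have "\<dots> \<le> L2_set (\<lambda>p. cmod (M $$ p)) ?S + L2_set (\<lambda>p. cmod (N $$ p)) ?S"
    by (rule L2_set_triangle_ineq)
  also have "\<dots> = frob M + frob N" using assms by (auto simp: frob_def case_prod_unfold)
  finally show ?thesis .
qed

lemma frob_smult: "frob (c \<cdot>\<^sub>m M) = cmod c * frob M"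
proof -
  have "frob (c \<cdot>\<^sub>m M) = L2_set (\<lambda>p. cmod c * cmod (M $$ p)) ({..<dim_row M} \<times> {..<dim_col M})"
    unfolding frob_def by (intro L2_set_cong) (auto simp: norm_mult)
  then show ?thesis unfolding frob_def by (simp add: L2_set_right_distrib case_prod_unfold)
qed

lemma frob_zero [simp]: "frob (0\<^sub>m n m) = 0"
  unfolding frob_def L2_set_def by (auto intro!: sum.neutral)

lemma frob_unitary:
  assumes "unitary_mat n U" "M \<in> carrier_mat n m"
  shows "frob (U * M) = frob M"
proof -
  have U: "U \<in> carrier_mat n n" "mat_adjoint U * U = 1\<^sub>m n" using assms by (auto simp: unitary_mat_def)
  have "mat_adjoint (U * M) * (U * M) = mat_adjoint M * (mat_adjoint U * (U * M))"
    using U assms(2) by (simp add: adj_mult[of _ n n _ m] assoc_mult_mat[of _ m n _ n _ m])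
  also have "mat_adjoint U * (U * M) = M"
    using U assms(2) by (simp add: assoc_mult_mat[of _ n n _ n _ m, symmetric])
  finally have "frob_inner (U * M) (U * M) = frob_inner M M"
    using U(1) assms(2) by (simp add: frob_inner_trace[of _ n m])
  then have "(frob (U * M))\<^sup>2 = (frob M)\<^sup>2" unfolding frob_inner_self by (simp only: of_real_eq_iff)
  then show ?thesis by simp
qed

lemma unitary_adjoint: "unitary_mat n U \<Longrightarrow> unitary_mat n (mat_adjoint U)"
  using unitary_right[of n U] by (auto simp: unitary_mat_def)

lemma frob_diag:
  assumes "M \<in> carrier_mat n m" "\<And>i. i < n \<Longrightarrow> cmod (f i) \<le> c"
  shows "frob (mat_diag n f * M) \<le> c * frob M"
proof (cases "n = 0")
  case False
  then have c: "0 \<le> c" using assms(2)[of 0] norm_ge_zero[of "f 0"] by linarith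
  have "frob (mat_diag n f * M) = L2_set (\<lambda>p. cmod (f (fst p)) * cmod (M $$ p)) ({..<n} \<times> {..<m})"
    unfolding mat_diag_mult_left[OF assms(1)] frob_def by (intro L2_set_cong) (auto simp: norm_mult)
  also have "\<dots> \<le> L2_set (\<lambda>p. c * cmod (M $$ p)) ({..<n} \<times> {..<m})"
    by (intro L2_set_mono) (auto intro!: mult_right_mono assms(2))
  also have "\<dots> = c * frob M"
    using assms(1) c by (simp add: frob_def L2_set_right_distrib case_prod_unfold)
  finally show ?thesis .
qed (use assms in \<open>simp add: frob_def mat_diag_def\<close>)

lemma diagonalized_mult_assoc:
  assumes "U \<in> carrier_mat n n" "M \<in> carrier_mat n m"
  shows "diagonalized n U f * M = U * (mat_diag n f * (mat_adjoint U * M))"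
proof -
  have "mat_diag n f * mat_adjoint U \<in> carrier_mat n n"
    using assms by simp
  then show ?thesis unfolding diagonalized_def using assms
    by (simp add: assoc_mult_mat[of _ n n _ n _ n] assoc_mult_mat[of _ n n _ n _ m])
qed

text \<open>Unitaries preserve the norm and a diagonal factor rescales rows, so a function of a
  Hermitian matrix is bounded by its values on the spectrum.\<close>

lemma frob_diagonalized:
  assumes U: "unitary_mat n U" and M: "M \<in> carrier_mat n m" and f: "\<And>i. i < n \<Longrightarrow> cmod (f i) \<le> c"
  shows "frob (diagonalized n U f * M) \<le> c * frob M"
proof -
  note Uc = unitary_carrier[OF U]
  have UM: "mat_adjoint U * M \<in> carrier_mat n m" using Uc M by (auto intro: mult_carrier_mat)
  have "frob (diagonalized n U f * M) = frob (mat_diag n f * (mat_adjoint U * M))"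
    unfolding diagonalized_mult_assoc[OF Uc M]
    by (rule frob_unitary[OF U mult_carrier_mat[OF mat_diag_dim UM]])
  also have "\<dots> \<le> c * frob (mat_adjoint U * M)" by (rule frob_diag[OF UM f])
  also have "frob (mat_adjoint U * M) = frob M" by (rule frob_unitary[OF unitary_adjoint[OF U] M])
  finally show ?thesis .
qed

lemma diagonalized_mult:
  assumes U: "unitary_mat n U"
  shows "diagonalized n U f * diagonalized n U g = diagonalized n U (\<lambda>i. f i * g i)"
proof -
  have Uc: "U \<in> carrier_mat n n" "mat_adjoint U * U = 1\<^sub>m n" using U by (auto simp: unitary_mat_def)
  have "mat_adjoint U * diagonalized n U g = mat_diag n g * mat_adjoint U"
    unfolding diagonalized_def using Uc
    by (simp add: sq_assoc[of _ n, symmetric] left_mult_one_mat[of _ n n])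
  moreover have "mat_diag n f * (mat_diag n g * mat_adjoint U) = mat_diag n (\<lambda>i. f i * g i) * mat_adjoint U"
    using Uc by (simp add: sq_assoc[of _ n, symmetric])
  ultimately show ?thesis
    using Uc(1) unfolding diagonalized_mult_assoc[OF Uc(1) diagonalized_carrier[OF Uc(1)]]
    unfolding diagonalized_def by (simp add: sq_assoc[of _ n])
qed

lemma diagonalized_index:
  assumes "U \<in> carrier_mat n n" "x < n" "y < n"
  shows "diagonalized n U f $$ (x, y) = (\<Sum>j<n. U $$ (x, j) * f j * cnj (U $$ (y, j)))"
  unfolding diagonalized_def mat_diag_mult_right[OF assms(1)] using assms
  by (subst mult_index[of _ n n _ n]) (auto intro!: sum.cong)

lemma diagonalized_one: "unitary_mat n U \<Longrightarrow> diagonalized n U (\<lambda>_. 1) = 1\<^sub>m n"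
  using unitary_right[of n U] by (simp add: diagonalized_def unitary_mat_def right_mult_one_mat[of _ n n])

lemma diagonalized_adj:
  assumes "U \<in> carrier_mat n n"
  shows "mat_adjoint (diagonalized n U f) = diagonalized n U (\<lambda>i. cnj (f i))"
  using assms
  by (intro mat_eqI[of _ n n]) (auto simp: adj_index' diagonalized_index mult_ac intro!: sum.cong)

lemma diagonalized_trace:
  assumes U: "unitary_mat n U"
  shows "mat_trace (diagonalized n U f) = (\<Sum>i<n. f i)"
proof -
  have Uc: "U \<in> carrier_mat n n" "mat_adjoint U * U = 1\<^sub>m n" using U by (auto simp: unitary_mat_def)
  have "mat_trace (diagonalized n U f) = mat_trace (mat_adjoint U * (U * mat_diag n f))"
    unfolding diagonalized_def using Uc by (intro mat_trace_comm[of _ n n]) auto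
  also have "mat_adjoint U * (U * mat_diag n f) = mat_diag n f"
    using Uc by (simp add: sq_assoc[of _ n, symmetric] left_mult_one_mat[of _ n n])
  finally show ?thesis by (simp add: mat_trace_def mat_diag_def)
qed

text \<open>The size is an explicit argument because an empty family must still yield a zero matrix
  of the right dimensions.\<close>

definition mat_sum :: "nat \<Rightarrow> 'i set \<Rightarrow> ('i \<Rightarrow> complex mat) \<Rightarrow> complex mat" where
  "mat_sum n I F = mat n n (\<lambda>p. \<Sum>i\<in>I. F i $$ p)"

lemma mat_sum_carrier [simp]: "mat_sum n I F \<in> carrier_mat n n"
  by (simp add: mat_sum_def)

lemma mat_sum_index: "x < n \<Longrightarrow> y < n \<Longrightarrow> mat_sum n I F $$ (x, y) = (\<Sum>i\<in>I. F i $$ (x, y))"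
  by (simp add: mat_sum_def)

lemma mat_sum_dim [simp]: "dim_row (mat_sum n I F) = n" "dim_col (mat_sum n I F) = n"
  by (simp_all add: mat_sum_def)

lemma mat_sum_empty [simp]: "mat_sum n {} F = 0\<^sub>m n n"
  by (rule eq_matI) (auto simp: mat_sum_def)

lemma mat_sum_insert:
  "finite I \<Longrightarrow> i \<notin> I \<Longrightarrow> F i \<in> carrier_mat n n \<Longrightarrow> mat_sum n (insert i I) F = F i + mat_sum n I F"
  by (rule eq_matI) (auto simp: mat_sum_def)

lemma mat_sum_cong: "(\<And>i. i \<in> I \<Longrightarrow> F i = G i) \<Longrightarrow> mat_sum n I F = mat_sum n I G"
  unfolding mat_sum_def by simp

lemma mat_sum_mult:
  assumes "\<And>i. i \<in> I \<Longrightarrow> F i \<in> carrier_mat n n" "M \<in> carrier_mat n n"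
  shows "mat_sum n I F * M = mat_sum n I (\<lambda>i. F i * M)"
proof (rule eq_matI)
  fix x y assume "x < dim_row (mat_sum n I (\<lambda>i. F i * M))" "y < dim_col (mat_sum n I (\<lambda>i. F i * M))"
  then have xy: "x < n" "y < n" by auto
  have "(mat_sum n I F * M) $$ (x, y) = (\<Sum>z<n. \<Sum>i\<in>I. F i $$ (x, z) * M $$ (z, y))"
    using xy assms(2) by (subst mult_index[of _ n n _ n]) (auto simp: mat_sum_index sum_distrib_right)
  also have "\<dots> = (\<Sum>i\<in>I. (F i * M) $$ (x, y))"
    by (subst sum.swap) (use xy assms in \<open>auto simp: mult_index[of _ n n _ n] intro!: sum.cong\<close>)
  finally show "(mat_sum n I F * M) $$ (x, y) = mat_sum n I (\<lambda>i. F i * M) $$ (x, y)"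
    using xy by (simp add: mat_sum_index)
qed (use assms in auto)

lemma mat_sum_minus:
  assumes "\<And>i. i \<in> I \<Longrightarrow> F i \<in> carrier_mat n n" "\<And>i. i \<in> I \<Longrightarrow> G i \<in> carrier_mat n n"
  shows "mat_sum n I F - mat_sum n I G = mat_sum n I (\<lambda>i. F i - G i)"
  using assms by (intro mat_eqI[of _ n n] minus_carrier_mat mat_sum_carrier) (auto simp: mat_sum_index sum_subtractf[symmetric] minus_index[of _ n n] simp del: index_minus_mat intro!: sum.cong)

lemma mat_sum_adj:
  assumes "\<And>i. i \<in> I \<Longrightarrow> F i \<in> carrier_mat n n"
  shows "mat_adjoint (mat_sum n I F) = mat_sum n I (\<lambda>i. mat_adjoint (F i))"
  using assms by (intro mat_eqI[of _ n n]) (auto simp: mat_sum_index adj_index'[of _ n n] simp del: adj_index intro!: sum.cong)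

lemma frob_mat_sum:
  assumes "finite I" "\<And>i. i \<in> I \<Longrightarrow> F i \<in> carrier_mat n n"
  shows "frob (mat_sum n I F) \<le> (\<Sum>i\<in>I. frob (F i))"
  using assms
proof (induction I rule: finite_induct)
  case (insert i I)
  have "frob (mat_sum n (insert i I) F) \<le> frob (F i) + frob (mat_sum n I F)"
    using insert by (subst mat_sum_insert) (auto intro!: frob_triangle[of _ n n])
  then show ?case using insert by simp
qed simp

lemma frob_inner_sum_left:
  assumes "\<And>i. i \<in> I \<Longrightarrow> F i \<in> carrier_mat n n" "N \<in> carrier_mat n n"
  shows "frob_inner (mat_sum n I F) N = (\<Sum>i\<in>I. frob_inner (F i) N)"
proof -
  have "frob_inner (mat_sum n I F) N = (\<Sum>x<n. \<Sum>y<n. \<Sum>i\<in>I. cnj (F i $$ (x, y)) * N $$ (x, y))"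
    unfolding frob_inner_def by (simp add: mat_sum_index sum_distrib_right)
  also have "\<dots> = (\<Sum>x<n. \<Sum>i\<in>I. \<Sum>y<n. cnj (F i $$ (x, y)) * N $$ (x, y))"
    by (intro sum.cong refl sum.swap)
  also have "\<dots> = (\<Sum>i\<in>I. \<Sum>x<n. \<Sum>y<n. cnj (F i $$ (x, y)) * N $$ (x, y))"
    by (rule sum.swap)
  also have "\<dots> = (\<Sum>i\<in>I. frob_inner (F i) N)"
    using carrier_matD[OF assms(1)] by (intro sum.cong) (auto simp: frob_inner_def)
  finally show ?thesis .
qed

lemma frob_inner_cnj:
  assumes "M \<in> carrier_mat n m" "N \<in> carrier_mat n m"
  shows "frob_inner M N = cnj (frob_inner N M)"
  unfolding frob_inner_def using assms by (simp add: mult.commute)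

text \<open>Squares add instead of norms: n orthogonal terms of weight 1/n have total norm of order
  1/sqrt n. Both statistical estimates rest on this.\<close>

lemma frob_pythagoras:
  assumes I: "finite I" and F: "\<And>i. i \<in> I \<Longrightarrow> F i \<in> carrier_mat n n"
    and orth: "\<And>i j. i \<in> I \<Longrightarrow> j \<in> I \<Longrightarrow> i \<noteq> j \<Longrightarrow> frob_inner (F i) (F j) = 0"
  shows "(frob (mat_sum n I F))\<^sup>2 = (\<Sum>i\<in>I. (frob (F i))\<^sup>2)"
proof -
  have 1: "frob_inner (F i) (mat_sum n I F) = frob_inner (F i) (F i)" if "i \<in> I" for i
  proof -
    have "frob_inner (F i) (mat_sum n I F) = cnj (\<Sum>j\<in>I. frob_inner (F j) (F i))"
      using that F by (subst frob_inner_cnj[of _ n n]) (auto simp: frob_inner_sum_left)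
    also have "(\<Sum>j\<in>I. frob_inner (F j) (F i)) = (\<Sum>j\<in>I. if j = i then frob_inner (F i) (F i) else 0)"
      using orth that by (intro sum.cong) auto
    also have "\<dots> = frob_inner (F i) (F i)" using I that by simp
    finally show ?thesis unfolding frob_inner_self by simp
  qed
  have "complex_of_real ((frob (mat_sum n I F))\<^sup>2) = (\<Sum>i\<in>I. frob_inner (F i) (mat_sum n I F))"
    unfolding frob_inner_self[symmetric] using F by (intro frob_inner_sum_left) auto
  also have "\<dots> = of_real (\<Sum>i\<in>I. (frob (F i))\<^sup>2)"
    unfolding of_real_sum using 1 by (intro sum.cong) (simp_all only: frob_inner_self)
  finally show ?thesis by (simp only: of_real_eq_iff)
qed

lemma diagonalized_sum:
  assumes "U \<in> carrier_mat n n"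
  shows "diagonalized n U (\<lambda>j. \<Sum>k\<in>I. f k j) = mat_sum n I (\<lambda>k. diagonalized n U (f k))"
proof (rule eq_matI)
  fix x y assume "x < dim_row (mat_sum n I (\<lambda>k. diagonalized n U (f k)))"
    "y < dim_col (mat_sum n I (\<lambda>k. diagonalized n U (f k)))"
  then have xy: "x < n" "y < n" by auto
  show "diagonalized n U (\<lambda>j. \<Sum>k\<in>I. f k j) $$ (x, y) = mat_sum n I (\<lambda>k. diagonalized n U (f k)) $$ (x, y)"
    using xy assms by (simp add: diagonalized_index mat_sum_index sum_distrib_left sum_distrib_right)
      (rule sum.swap)
qed (use assms in auto)

lemma diagonalized_smult:
  assumes "U \<in> carrier_mat n n"
  shows "diagonalized n U (\<lambda>j. c * f j) = c \<cdot>\<^sub>m diagonalized n U f"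
  using assms diagonalized_carrier[OF assms, of f] diagonalized_carrier[OF assms, of "\<lambda>j. c * f j"]
  by (intro eq_matI) (auto simp: diagonalized_index sum_distrib_left mult_ac intro!: sum.cong)

lemma diagonalized_minus:
  assumes "U \<in> carrier_mat n n"
  shows "diagonalized n U (\<lambda>j. f j - g j) = diagonalized n U f - diagonalized n U g"
  using assms diagonalized_carrier[OF assms]
  by (intro eq_matI) (auto simp: diagonalized_index sum_subtractf[symmetric] algebra_simps intro!: sum.cong)

section \<open>A smoothed sign function\<close>

declare minus_carrier_mat [simp]

text \<open>A Riemann sum with step \<open>\<delta>\<close>, cut off at \<open>K * \<delta>\<close>,
  for 2/pi times the integral of x/(x^2 + t^2) over t > 0, which is the sign of x for x \<noteq> 0.
  The nodes start at k = 1, which keeps the poles at distance at least \<open>\<delta>\<close> from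
  the real axis.\<close>

definition smooth_sgn :: "real \<Rightarrow> nat \<Rightarrow> real \<Rightarrow> real" where
  "smooth_sgn \<delta> K x = 2 / pi * (\<Sum>k=1..K. \<delta> * x / (x\<^sup>2 + (real k * \<delta>)\<^sup>2))"

lemma smooth_sgn_uminus: "smooth_sgn \<delta> K (- x) = - smooth_sgn \<delta> K x"
  unfolding smooth_sgn_def by (simp add: sum_negf)

text \<open>Mean value theorem: the derivative 1/(1 + z^2) decreases on the positive axis, so it is
  bracketed by its values at the end points.\<close>

lemma arctan_increment:
  assumes "0 \<le> a" "a < b"
  shows "(b - a) / (1 + b\<^sup>2) \<le> arctan b - arctan a" "arctan b - arctan a \<le> (b - a) / (1 + a\<^sup>2)"
proof -
  obtain z where z: "a < z" "z < b" "arctan b - arctan a = (b - a) * inverse (1 + z\<^sup>2)"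
    using MVT2[OF \<open>a < b\<close>, of arctan "\<lambda>z. inverse (1 + z\<^sup>2)"] DERIV_arctan by blast
  have "a\<^sup>2 \<le> z\<^sup>2" "z\<^sup>2 \<le> b\<^sup>2" using z assms by (auto intro!: power_mono)
  moreover have "1 + a\<^sup>2 > 0" "1 + z\<^sup>2 > 0" by (simp_all add: add_pos_nonneg)
  ultimately show "(b - a) / (1 + b\<^sup>2) \<le> arctan b - arctan a" "arctan b - arctan a \<le> (b - a) / (1 + a\<^sup>2)"
    unfolding z(3) divide_inverse using assms
    by (auto intro!: mult_left_mono le_imp_inverse_le)
qed

lemma arctan_le_self: "0 < b \<Longrightarrow> arctan b \<le> b"
  using arctan_increment(2)[of 0 b] by simp

text \<open>Each summand is a rectangle for 1/(1 + t^2) at the node k \<delta>/x. By monotonicity it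
  is at most the arctan increment over the cell to its left and at least the one over the cell to
  its right; the lower bound therefore misses the first cell, which explains the term with
  \<delta>/x.\<close>

lemma smooth_sgn_pos_bounds:
  assumes "x > 0" "\<delta> > 0"
  shows "smooth_sgn \<delta> K x \<le> 2 / pi * arctan (real K * \<delta> / x)"
    and "2 / pi * (arctan (real (Suc K) * \<delta> / x) - arctan (\<delta> / x)) \<le> smooth_sgn \<delta> K x"
proof -
  define u where "u k = arctan (real k * \<delta> / x)" for k
  have t: "\<delta> * x / (x\<^sup>2 + (real k * \<delta>)\<^sup>2) = (\<delta> / x) / (1 + (real k * \<delta> / x)\<^sup>2)" for k
    using assms by (simp add: field_simps power2_eq_square)
  have d: "real (Suc k) * \<delta> / x - real k * \<delta> / x = \<delta> / x" for k
    using assms by (simp add: field_simps)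
  have lt: "real k * \<delta> / x < real (Suc k) * \<delta> / x" for k
    using assms by (simp add: divide_strict_right_mono)
  have up: "\<delta> * x / (x\<^sup>2 + (real (Suc k) * \<delta>)\<^sup>2) \<le> u (Suc k) - u k" for k
    unfolding t u_def using arctan_increment(1)[OF _ lt[of k]] assms unfolding d by simp
  have lo: "u (Suc k) - u k \<le> \<delta> * x / (x\<^sup>2 + (real k * \<delta>)\<^sup>2)" for k
    unfolding t u_def using arctan_increment(2)[OF _ lt[of k]] assms unfolding d by simp
  have 1: "(\<Sum>k=1..K. \<delta> * x / (x\<^sup>2 + (real k * \<delta>)\<^sup>2)) \<le> u K"
  proof (induction K)
    case (Suc K)
    then show ?case using up[of K] by simp
  qed (simp add: u_def)
  have 2: "u (Suc K) - u 1 \<le> (\<Sum>k=1..K. \<delta> * x / (x\<^sup>2 + (real k * \<delta>)\<^sup>2))"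
  proof (induction K)
    case (Suc K)
    then show ?case using lo[of "Suc K"] by simp
  qed simp
  show "smooth_sgn \<delta> K x \<le> 2 / pi * arctan (real K * \<delta> / x)"
    unfolding smooth_sgn_def u_def[symmetric] by (intro mult_left_mono 1) simp
  show "2 / pi * (arctan (real (Suc K) * \<delta> / x) - arctan (\<delta> / x)) \<le> smooth_sgn \<delta> K x"
    unfolding smooth_sgn_def using 2 by (intro mult_left_mono) (simp_all add: u_def)
qed

lemma smooth_sgn_nonneg: "x \<ge> 0 \<Longrightarrow> \<delta> > 0 \<Longrightarrow> 0 \<le> smooth_sgn \<delta> K x"
  unfolding smooth_sgn_def by (auto intro!: mult_nonneg_nonneg sum_nonneg divide_nonneg_nonneg)

lemma smooth_sgn_le_one_pos:
  assumes "x > 0" "\<delta> > 0"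
  shows "smooth_sgn \<delta> K x \<le> 1"
proof -
  have "2 / pi * arctan (real K * \<delta> / x) \<le> 2 / pi * (pi / 2)"
    using arctan_ubound[of "real K * \<delta> / x"] by (intro mult_left_mono) auto
  also have "2 / pi * (pi / 2) = 1" by simp
  finally show ?thesis using smooth_sgn_pos_bounds(1)[OF assms, of K] by linarith
qed

lemma smooth_sgn_abs_le_one:
  assumes "\<delta> > 0"
  shows "\<bar>smooth_sgn \<delta> K x\<bar> \<le> 1"
proof -
  consider "x > 0" | "x = 0" | "x < 0" by linarith
  then show ?thesis
  proof cases
    case 1
    then show ?thesis using smooth_sgn_le_one_pos[OF 1 assms] smooth_sgn_nonneg[of x \<delta> K] assms by simp
  next
    case 2
    then show ?thesis by (simp add: smooth_sgn_def)
  next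
    case 3
    then show ?thesis using smooth_sgn_le_one_pos[of "- x" \<delta> K] smooth_sgn_nonneg[of "- x" \<delta> K] assms
      by (simp add: smooth_sgn_uminus)
  qed
qed

text \<open>Close to 0 the sign is poorly approximated, with a defect of order \<delta>/x, but
  multiplication by x reduces this to \<delta>. Hence no gap between 0 and the other eigenvalues
  enters.\<close>

lemma smooth_sgn_approx_pos:
  assumes "0 < x" "x \<le> 1" "\<delta> > 0" "1 \<le> real K * \<delta>\<^sup>2"
  shows "\<bar>x - x * smooth_sgn \<delta> K x\<bar> \<le> 2 * \<delta>"
proof -
  let ?L = "real (Suc K) * \<delta>"
  \<comment> \<open>The condition on \<open>K\<close> pushes the cutoff beyond 1/\<delta>, so the
    discarded tail, of size x divided by the cutoff, is at most x \<delta>.\<close>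
  have "real K * \<delta>\<^sup>2 \<le> ?L * \<delta>" using assms by (simp add: power2_eq_square algebra_simps)
  then have L1: "1 \<le> ?L * \<delta>" using assms by linarith
  have L: "1 / \<delta> \<le> ?L" "0 < ?L" using L1 assms
    by (simp add: pos_divide_le_eq, intro mult_pos_pos) auto
  have a1: "arctan (\<delta> / x) \<le> \<delta> / x" using assms by (intro arctan_le_self) simp
  have "arctan (1 / (?L / x)) = pi / 2 - arctan (?L / x)"
    using L assms arctan_inverse[of "?L / x"] by simp
  moreover have "arctan (1 / (?L / x)) \<le> 1 / (?L / x)" using L assms by (intro arctan_le_self) simp
  ultimately have a2: "pi / 2 - x / ?L \<le> arctan (?L / x)" using L by simp
  have "x / ?L \<le> x * \<delta>"
  proof -
    have "1 / ?L \<le> \<delta>" using L assms(3) by (simp add: field_simps)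
    then have "x * (1 / ?L) \<le> x * \<delta>" using assms by (intro mult_left_mono) auto
    then show ?thesis by simp
  qed
  then have "pi / 2 - x * \<delta> - \<delta> / x \<le> arctan (?L / x) - arctan (\<delta> / x)" using a1 a2 by linarith
  then have "2 / pi * (pi / 2 - x * \<delta> - \<delta> / x) \<le> smooth_sgn \<delta> K x"
    using smooth_sgn_pos_bounds(2)[OF assms(1,3), of K]
    by (meson divide_nonneg_pos mult_left_mono order_trans pi_gt_zero zero_le_numeral)
  then have "x * (2 / pi * (pi / 2 - x * \<delta> - \<delta> / x)) \<le> x * smooth_sgn \<delta> K x"
    using assms by (intro mult_left_mono) auto
  also have "x * (2 / pi * (pi / 2 - x * \<delta> - \<delta> / x)) = x - 2 / pi * (x * x * \<delta> + \<delta>)"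
    using assms by (simp add: field_simps)
  finally have "x - x * smooth_sgn \<delta> K x \<le> 2 / pi * (x * x * \<delta> + \<delta>)" by simp
  also have "\<dots> \<le> 1 * (\<delta> + \<delta>)"
  proof (intro mult_mono)
    show "x * x * \<delta> + \<delta> \<le> \<delta> + \<delta>" using assms mult_le_one[of x x] by simp
  qed (use assms pi_ge_two in auto)
  finally have "x - x * smooth_sgn \<delta> K x \<le> 2 * \<delta>" by simp
  moreover have "x * smooth_sgn \<delta> K x \<le> x * 1"
    using assms smooth_sgn_le_one_pos[of x \<delta> K] by (intro mult_left_mono) auto
  ultimately show ?thesis using assms by linarith
qed

lemma smooth_sgn_approx:
  assumes "\<bar>x\<bar> \<le> 1" "\<delta> > 0" "1 \<le> real K * \<delta>\<^sup>2"
  shows "\<bar>\<bar>x\<bar> - x * smooth_sgn \<delta> K x\<bar> \<le> 2 * \<delta>"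
proof -
  consider "x > 0" | "x = 0" | "x < 0" by linarith
  then show ?thesis
  proof cases
    case 1
    then show ?thesis using smooth_sgn_approx_pos[of x \<delta> K] assms by simp
  next
    case 2
    then show ?thesis using assms by simp
  next
    case 3
    then show ?thesis using smooth_sgn_approx_pos[of "- x" \<delta> K] assms by (simp add: smooth_sgn_uminus)
  qed
qed

text \<open>Telescoping through 1/(n+1)^2 \<le> 1/n - 1/(n+1); the induction carries the stronger
  bound 2 - 1/K.\<close>

lemma sum_inverse_squares_le_2: "(\<Sum>k=1..K. 1 / (real k)\<^sup>2) \<le> 2"
proof -
  have "(\<Sum>k=1..K. 1 / (real k)\<^sup>2) \<le> 2 - 1 / real K" if "K \<ge> 1"
    using that
  proof (induction K rule: dec_induct)
    case (step n)
    have "1 / (real (Suc n))\<^sup>2 \<le> 1 / real n - 1 / real (Suc n)"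
    proof -
      have "1 / (real (Suc n))\<^sup>2 \<le> 1 / (real n * real (Suc n))"
        unfolding power2_eq_square using step by (intro divide_left_mono mult_right_mono mult_pos_pos) auto
      also have "\<dots> = 1 / real n - 1 / real (Suc n)" using step by (simp add: field_simps)
      finally show ?thesis .
    qed
    then show ?case using step by simp
  qed simp
  then show ?thesis by (cases "K \<ge> 1") (auto intro: order_trans)
qed

text \<open>The smoothed sign is a sum of resolvents, which makes it operator Lipschitz with constant
  of order \<open>1/\<delta>\<close>: differences of resolvents factor through the difference of the operators.\<close>

definition resolvent_fun :: "real \<Rightarrow> real \<Rightarrow> complex" where
  "resolvent_fun s x = 1 / (of_real x - \<i> * of_real s)"

lemma resolvent_fun_denom: "s \<noteq> 0 \<Longrightarrow> complex_of_real x - \<i> * of_real s \<noteq> 0"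
  by (simp add: complex_eq_iff)

lemma resolvent_fun_norm:
  assumes "s \<noteq> 0" shows "cmod (resolvent_fun s x) \<le> 1 / \<bar>s\<bar>"
proof -
  have "\<bar>s\<bar> \<le> cmod (of_real x - \<i> * of_real s)"
    using abs_Im_le_cmod[of "of_real x - \<i> * of_real s"] by simp
  then show ?thesis using assms by (simp add: resolvent_fun_def norm_divide frac_le)
qed

text \<open>Partial fractions: the conjugate poles at plus and minus i s combine to 2 x/(x^2 + s^2).
  The pair is real, while each half is a resolvent.\<close>

lemma smooth_sgn_resolvent:
  assumes "\<delta> > 0"
  shows "complex_of_real (smooth_sgn \<delta> K x) =
    (\<Sum>k=1..K. of_real (\<delta> / pi) * (resolvent_fun (real k * \<delta>) x + resolvent_fun (- (real k * \<delta>)) x))"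
proof -
  have t: "of_real (2 / pi * (\<delta> * x / (x\<^sup>2 + s\<^sup>2))) = of_real (\<delta> / pi) * (resolvent_fun s x + resolvent_fun (- s) x)"
    if "s \<noteq> 0" for s
  proof -
    have "resolvent_fun s x + resolvent_fun (- s) x = 2 * of_real x / (of_real (x\<^sup>2 + s\<^sup>2))"
      using resolvent_fun_denom[OF that, of x] resolvent_fun_denom[of "- s" x] that
      by (simp add: resolvent_fun_def add_divide_eq_iff divide_add_eq_iff frac_eq_eq power2_eq_square algebra_simps
          add_frac_eq del: of_real_power)
    then show ?thesis by simp
  qed
  show ?thesis unfolding smooth_sgn_def sum_distrib_left of_real_sum
    by (intro sum.cong refl t) (use assms in auto)
qed

text \<open>The resolvent of \<open>A\<close> costs 1/|s| in operator norm, and the assumption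
  \<open>c\<close> supplies another 1/|s| on the vector \<open>R s * \<Psi>\<close>. The node s = k
  \<delta> thus contributes c/(k \<delta>)^2, which is summable. \<open>A - B\<close> is controlled
  on \<open>R s * \<Psi>\<close> alone, since this is what a state-dependent estimate can
  provide.\<close>

lemma smooth_sgn_perturbation:
  assumes U: "unitary_mat n U" and A: "A = diagonalized n U (\<lambda>j. of_real (a j))"
    and B: "B \<in> carrier_mat n n" and R: "\<And>s. R s \<in> carrier_mat n n"
    and BR: "\<And>s. s \<noteq> 0 \<Longrightarrow> (B - (\<i> * of_real s) \<cdot>\<^sub>m 1\<^sub>m n) * R s = 1\<^sub>m n"
    and \<Psi>: "\<Psi> \<in> carrier_mat n n" and \<delta>: "\<delta> > 0"
    and c: "\<And>s. s \<noteq> 0 \<Longrightarrow> frob ((A - B) * (R s * \<Psi>)) \<le> c / \<bar>s\<bar>"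
  shows "frob ((diagonalized n U (\<lambda>j. of_real (smooth_sgn \<delta> K (a j)))
    - mat_sum n {1..K} (\<lambda>k. of_real (\<delta> / pi) \<cdot>\<^sub>m (R (real k * \<delta>) + R (- (real k * \<delta>))))) * \<Psi>) \<le> 2 * c / \<delta>"
proof -
  note Uc = unitary_carrier[OF U]
  define S where "S s = diagonalized n U (\<lambda>j. resolvent_fun s (a j))" for s
  have S: "S s \<in> carrier_mat n n" for s using Uc by (simp add: S_def)
  have Ac: "A \<in> carrier_mat n n" using Uc by (simp add: A)
  have SA: "S s * (A - (\<i> * of_real s) \<cdot>\<^sub>m 1\<^sub>m n) = 1\<^sub>m n" if "s \<noteq> 0" for s
  proof -
    have "A - (\<i> * of_real s) \<cdot>\<^sub>m 1\<^sub>m n = diagonalized n U (\<lambda>j. of_real (a j) - \<i> * of_real s * 1)"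
      unfolding A using Uc by (simp only: diagonalized_minus diagonalized_smult diagonalized_one[OF U])
    then have "S s * (A - (\<i> * of_real s) \<cdot>\<^sub>m 1\<^sub>m n) = diagonalized n U (\<lambda>j. 1)"
      unfolding S_def using resolvent_fun_denom[OF that]
      by (simp add: diagonalized_mult[OF U] resolvent_fun_def)
    then show ?thesis using diagonalized_one[OF U] by simp
  qed
  \<comment> \<open>Resolvent identity: \<open>S s\<close> is a left inverse on the side of
    \<open>A\<close>, \<open>R s\<close> a right inverse on the side of \<open>B\<close>. This order
    leaves \<open>R s\<close> adjacent to \<open>\<Psi>\<close>.\<close>
  have diff: "S s - R s = - (S s * ((A - B) * R s))" if "s \<noteq> 0" for s
  proof -
    let ?z = "(\<i> * of_real s) \<cdot>\<^sub>m 1\<^sub>m n :: complex mat"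
    have z: "?z \<in> carrier_mat n n" by simp
    have Az: "A - ?z \<in> carrier_mat n n" "(A - ?z) * R s \<in> carrier_mat n n"
      using z R[of s] by (auto intro!: minus_carrier_mat mult_carrier_mat[of _ n n])
    have "S s * ((A - B) * R s) = S s * (((A - ?z) - (B - ?z)) * R s)"
      using Ac B by (intro arg_cong[of _ _ "\<lambda>M. S s * (M * R s)"] eq_matI) auto
    also have "((A - ?z) - (B - ?z)) * R s = (A - ?z) * R s - (B - ?z) * R s"
      using Ac B R z by (intro minus_mult_distrib_mat[of _ n n _ _ n]) auto
    also have "\<dots> = (A - ?z) * R s - 1\<^sub>m n" using BR[OF that] by simp
    also have "S s * \<dots> = S s * ((A - ?z) * R s) - S s * 1\<^sub>m n"
      using S Az by (intro mult_minus_distrib_mat[of _ n n _ n]) auto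
    also have "S s * ((A - ?z) * R s) = S s * (A - ?z) * R s"
      using S R Az by (intro sq_assoc[of _ n, symmetric]) auto
    also have "\<dots> = R s" using SA[OF that] R[of s] by simp
    also have "S s * 1\<^sub>m n = S s" using S by (intro right_mult_one_mat)
    finally show ?thesis using S[of s] R[of s] by (intro eq_matI) auto
  qed
  have bound: "frob ((S s - R s) * \<Psi>) \<le> c / s\<^sup>2" if "s \<noteq> 0" for s
  proof -
    have AB: "A - B \<in> carrier_mat n n" using B by (rule minus_carrier_mat)
    have "(S s - R s) * \<Psi> = (-1) \<cdot>\<^sub>m (S s * ((A - B) * R s)) * \<Psi>"
      unfolding diff[OF that] using S AB R by (intro arg_cong[of _ _ "\<lambda>M. M * \<Psi>"] eq_matI) auto
    also have "\<dots> = (-1) \<cdot>\<^sub>m (S s * ((A - B) * (R s * \<Psi>)))"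
      using S[of s] R[of s] AB \<Psi> by (simp add: mult_smult_assoc_mat[of _ n n _ n] sq_assoc[of _ n])
    finally have "frob ((S s - R s) * \<Psi>) = frob (S s * ((A - B) * (R s * \<Psi>)))"
      by (simp add: frob_smult)
    also have "\<dots> \<le> 1 / \<bar>s\<bar> * frob ((A - B) * (R s * \<Psi>))"
      unfolding S_def using R[of s] AB \<Psi> resolvent_fun_norm[OF that]
      by (intro frob_diagonalized[OF U, of _ n]) auto
    also have "\<dots> \<le> 1 / \<bar>s\<bar> * (c / \<bar>s\<bar>)" by (intro mult_left_mono c that) simp
    also have "\<dots> = c / s\<^sup>2" by (simp add: power2_eq_square)
    finally show ?thesis .
  qed
  have c0: "0 \<le> c" using c[of 1] order_trans[OF frob_nonneg] by fastforce
  define F where "F k = of_real (\<delta> / pi) \<cdot>\<^sub>m (S (real k * \<delta>) + S (- (real k * \<delta>)))" for k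
  define G where "G k = of_real (\<delta> / pi) \<cdot>\<^sub>m (R (real k * \<delta>) + R (- (real k * \<delta>)))" for k
  have FG: "F k \<in> carrier_mat n n" "G k \<in> carrier_mat n n" for k
    unfolding F_def G_def using S R by auto
  have F: "diagonalized n U (\<lambda>j. of_real (smooth_sgn \<delta> K (a j))) = mat_sum n {1..K} F"
  proof -
    have "F k = diagonalized n U (\<lambda>j. of_real (\<delta> / pi) *
        (resolvent_fun (real k * \<delta>) (a j) - (- 1) * resolvent_fun (- (real k * \<delta>)) (a j)))" for k
      unfolding diagonalized_smult[OF Uc] diagonalized_minus[OF Uc] F_def S_def using Uc
      by (intro arg_cong[of _ _ "(\<cdot>\<^sub>m) _"] eq_matI) auto
    then show ?thesis
      unfolding smooth_sgn_resolvent[OF \<delta>] diagonalized_sum[OF Uc] by (simp cong: mat_sum_cong)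
  qed
  have Fk: "frob ((F k - G k) * \<Psi>) \<le> 2 * c / (pi * \<delta>) * (1 / (real k)\<^sup>2)" if "k \<ge> 1" for k
  proof -
    let ?s = "real k * \<delta>"
    have s: "?s \<noteq> 0" "- ?s \<noteq> 0" using that \<delta> by auto
    have SR: "(S t - R t) * \<Psi> \<in> carrier_mat n n" for t using S R \<Psi> by simp
    have "(F k - G k) * \<Psi> = of_real (\<delta> / pi) \<cdot>\<^sub>m ((S ?s - R ?s) + (S (- ?s) - R (- ?s))) * \<Psi>"
      unfolding F_def G_def using S[of ?s] S[of "- ?s"] R[of ?s] R[of "- ?s"]
      by (intro arg_cong[of _ _ "\<lambda>M. M * \<Psi>"] eq_matI) (auto simp: algebra_simps)
    also have "\<dots> = of_real (\<delta> / pi) \<cdot>\<^sub>m (((S ?s - R ?s) + (S (- ?s) - R (- ?s))) * \<Psi>)"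
      using S R \<Psi> by (intro mult_smult_assoc_mat[of _ n n _ n]) auto
    also have "((S ?s - R ?s) + (S (- ?s) - R (- ?s))) * \<Psi> = (S ?s - R ?s) * \<Psi> + (S (- ?s) - R (- ?s)) * \<Psi>"
      using S R \<Psi> by (intro add_mult_distrib_mat[of _ n n _ _ n]) auto
    finally have "frob ((F k - G k) * \<Psi>) =
      \<delta> / pi * frob ((S ?s - R ?s) * \<Psi> + (S (- ?s) - R (- ?s)) * \<Psi>)"
      using \<delta> by (simp add: frob_smult norm_divide)
    also have "\<dots> \<le> \<delta> / pi * (c / ?s\<^sup>2 + c / (- ?s)\<^sup>2)"
      using \<delta> by (intro mult_left_mono order_trans[OF frob_triangle[OF SR SR]] add_mono bound s) auto
    also have "\<dots> = 2 * c / (pi * \<delta>) * (1 / (real k)\<^sup>2)"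
      using \<delta> that by (simp add: field_simps power2_eq_square)
    finally show ?thesis .
  qed
  have "(diagonalized n U (\<lambda>j. of_real (smooth_sgn \<delta> K (a j))) - mat_sum n {1..K} G) * \<Psi>
    = mat_sum n {1..K} (\<lambda>k. (F k - G k) * \<Psi>)"
    unfolding F using FG \<Psi> by (subst mat_sum_minus) (auto intro!: mat_sum_mult minus_carrier_mat)
  then have "frob ((diagonalized n U (\<lambda>j. of_real (smooth_sgn \<delta> K (a j))) - mat_sum n {1..K} G) * \<Psi>)
    \<le> (\<Sum>k\<in>{1..K}. frob ((F k - G k) * \<Psi>))"
    using FG \<Psi> by (simp add: frob_mat_sum minus_carrier_mat)
  also have "\<dots> \<le> (\<Sum>k\<in>{1..K}. 2 * c / (pi * \<delta>) * (1 / (real k)\<^sup>2))"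
    by (intro sum_mono Fk) simp
  also have "\<dots> = 2 * c / (pi * \<delta>) * (\<Sum>k=1..K. 1 / (real k)\<^sup>2)" by (simp only: sum_distrib_left)
  also have "\<dots> \<le> 2 * c / (pi * \<delta>) * 2"
    using c0 \<delta> by (intro mult_left_mono sum_inverse_squares_le_2) simp
  \<comment> \<open>The factor 2 from the inverse squares is absorbed by pi \<ge> 2.\<close>
  also have "\<dots> \<le> 2 * c / \<delta>"
    using c0 \<delta> pi_ge_two mult_mono[of 2 pi c c] by (simp add: field_simps)
  finally show ?thesis unfolding G_def .
qed

section \<open>Tensor products over sites\<close>

text \<open>Site \<open>j\<close> is the \<open>j\<close>-th least significant base-\<open>d\<close> digit of an index, so in \<open>tensor_mat A B\<close> the
  factor \<open>B\<close> occupies the low sites.\<close>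

locale tensor_sites =
  fixes d N :: nat
begin

definition digit :: "nat \<Rightarrow> nat \<Rightarrow> nat" where
  "digit j x = x div d ^ j mod d"

definition encode :: "(nat \<Rightarrow> nat) \<Rightarrow> nat" where
  "encode \<phi> = (\<Sum>j<N. \<phi> j * d ^ j)"

lemma encode_less:
  assumes "\<And>j. j < N \<Longrightarrow> \<phi> j < d"
  shows "encode \<phi> < d ^ N"
  using assms unfolding encode_def
proof (induction N)
  case (Suc N)
  have "(\<Sum>j<Suc N. \<phi> j * d ^ j) < d ^ N + \<phi> N * d ^ N" using Suc by simp
  also have "\<dots> = Suc (\<phi> N) * d ^ N" by simp
  also have "\<dots> \<le> d * d ^ N" using Suc.prems[of N] by (intro mult_right_mono) auto
  finally show ?case by simp
qed simp

lemma digit_encode: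
  assumes "\<And>j. j < N \<Longrightarrow> \<phi> j < d" "i < N"
  shows "digit i (encode \<phi>) = \<phi> i"
  using assms unfolding encode_def digit_def
proof (induction N arbitrary: i \<phi>)
  case (Suc N)
  have e: "(\<Sum>j<Suc N. \<phi> j * d ^ j) = \<phi> 0 + d * (\<Sum>j<N. \<phi> (Suc j) * d ^ j)"
    unfolding sum.lessThan_Suc_shift by (simp add: sum_distrib_left mult_ac)
  have 0: "\<phi> 0 < d" using Suc.prems by simp
  then have "(\<phi> 0 + d * q) div d = q" for q by simp
  with 0 show ?case
    unfolding e using Suc.IH[of "\<lambda>j. \<phi> (Suc j)"] Suc.prems
    by (cases i) (auto simp: div_mult2_eq)
qed simp

lemma encode_digit:
  assumes "x < d ^ N"
  shows "encode (\<lambda>j. digit j x) = x"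
  using assms unfolding encode_def digit_def
proof (induction N arbitrary: x)
  case (Suc N)
  have "x div d < d ^ N" using Suc.prems by (simp add: less_mult_imp_div_less mult.commute)
  from Suc.IH[OF this] have IH: "(\<Sum>j<N. x div d div d ^ j mod d * d ^ j) = x div d" .
  have "(\<Sum>j<Suc N. x div d ^ j mod d * d ^ j) = x mod d + d * (\<Sum>j<N. x div d div d ^ j mod d * d ^ j)"
    unfolding sum.lessThan_Suc_shift by (simp add: sum_distrib_left mult_ac div_mult2_eq)
  then show ?case unfolding IH by simp
qed simp

lemma digit_less: "x < d ^ N \<Longrightarrow> i < N \<Longrightarrow> digit i x < d"
  unfolding digit_def by (cases "d = 0") (auto simp: power_0_left split: if_splits)

lemma digit_eqI:
  assumes "x < d ^ N" "y < d ^ N" "\<And>j. j < N \<Longrightarrow> digit j x = digit j y"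
  shows "x = y"
proof -
  have "encode (\<lambda>j. digit j x) = encode (\<lambda>j. digit j y)" unfolding encode_def using assms(3) by simp
  then show ?thesis using encode_digit assms by simp
qed

section \<open>Replacing one digit and exchanging two\<close>

definition update :: "nat \<Rightarrow> nat \<Rightarrow> nat \<Rightarrow> nat" where
  "update i c x = encode ((\<lambda>j. digit j x)(i := c))"

definition swap :: "nat \<Rightarrow> nat \<Rightarrow> nat \<Rightarrow> nat" where
  "swap p i x = encode (\<lambda>j. digit (transpose p i j) x)"

lemma update_less: "x < d ^ N \<Longrightarrow> c < d \<Longrightarrow> update i c x < d ^ N"
  unfolding update_def by (rule encode_less) (auto simp: digit_less)

lemma digit_update:
  "x < d ^ N \<Longrightarrow> c < d \<Longrightarrow> j < N \<Longrightarrow> digit j (update i c x) = (if j = i then c else digit j x)"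
  unfolding update_def by (subst digit_encode) (auto simp: digit_less)

lemma transpose_less: "p < N \<Longrightarrow> i < N \<Longrightarrow> j < N \<Longrightarrow> transpose p i j < N"
  by (auto simp: transpose_def)

lemma swap_less: "x < d ^ N \<Longrightarrow> p < N \<Longrightarrow> i < N \<Longrightarrow> swap p i x < d ^ N"
  unfolding swap_def by (rule encode_less) (auto simp: digit_less transpose_less)

lemma digit_swap:
  "x < d ^ N \<Longrightarrow> p < N \<Longrightarrow> i < N \<Longrightarrow> j < N \<Longrightarrow> digit j (swap p i x) = digit (transpose p i j) x"
  unfolding swap_def by (subst digit_encode) (auto simp: digit_less transpose_less)

lemma swap_swap: "x < d ^ N \<Longrightarrow> p < N \<Longrightarrow> i < N \<Longrightarrow> swap p i (swap p i x) = x"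
  by (rule digit_eqI) (auto simp: swap_less digit_swap transpose_less)

lemma update_restore:
  assumes "x < d ^ N" "c < d" "i < N"
  shows "update i (digit i x) (update i c x) = x" "digit i (update i c x) = c"
proof -
  show "update i (digit i x) (update i c x) = x"
    using assms by - (rule digit_eqI, simp_all add: update_less digit_update digit_less)
qed (use assms in \<open>simp add: digit_update\<close>)

text \<open>The map from (x, c) to \<open>(update i c x, digit i x)\<close> trades the old digit for
  the new one and is an involution on pairs, so each index is reached \<open>d\<close> times. One
  digit can then be summed separately without encoding the remaining ones.\<close>

lemma sum_update:
  fixes h :: "nat \<Rightarrow> complex"
  assumes "i < N"
  shows "(\<Sum>x<d ^ N. \<Sum>c<d. h (update i c x)) = of_nat d * (\<Sum>x<d ^ N. h x)"
proof -
  let ?S = "{..<d ^ N} \<times> {..<d}" and ?f = "\<lambda>q. (update i (snd q) (fst q), digit i (fst q))"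
  have f: "?f q \<in> ?S \<and> ?f (?f q) = q" if "q \<in> ?S" for q
  proof -
    have q: "fst q < d ^ N" "snd q < d" using that by (simp_all only: mem_Times_iff lessThan_iff)
    show ?thesis
      using update_less[OF q, of i] digit_less[OF q(1) assms] update_restore[OF q assms]
      by (simp only: mem_Times_iff lessThan_iff prod_eq_iff fst_conv snd_conv)
  qed
  have bij: "bij_betw ?f ?S ?S"
    by (rule bij_betw_byWitness[where f' = ?f]) (use f in blast)+
  have "(\<Sum>x<d ^ N. \<Sum>c<d. h (update i c x)) = (\<Sum>q\<in>?S. h (update i (snd q) (fst q)))"
    by (simp add: sum.cartesian_product case_prod_unfold)
  also have "\<dots> = (\<Sum>q\<in>?S. h (fst q))"
    using sum.reindex_bij_betw[OF bij, of "\<lambda>q. h (fst q)"] by (simp only: fst_conv)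
  also have "\<dots> = (\<Sum>x<d ^ N. \<Sum>c<d. h x)"
    by (simp add: sum.cartesian_product case_prod_unfold del: sum_constant)
  finally show ?thesis by (simp add: sum_distrib_left)
qed

text \<open>The distributive law, with indices read as digit strings. Multiplicativity of matrix
  products, traces and norms under tensor products all goes back to it.\<close>

lemma sum_prod_digits:
  fixes g :: "nat \<Rightarrow> nat \<Rightarrow> complex"
  shows "(\<Sum>x<d ^ N. \<Prod>j<N. g j (digit j x)) = (\<Prod>j<N. \<Sum>c<d. g j c)"
proof -
  have "(\<Prod>j<N. \<Sum>c<d. g j c) = (\<Sum>\<phi>\<in>PiE {..<N} (\<lambda>_. {..<d}). \<Prod>j<N. g j (\<phi> j))"
    by (rule prod_sum_PiE) auto
  also have "\<dots> = (\<Sum>x<d ^ N. \<Prod>j<N. g j (digit j x))"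
  proof (rule sum.reindex_bij_witness[where i = "\<lambda>x. restrict (\<lambda>j. digit j x) {..<N}" and j = encode])
    fix \<phi> assume \<phi>: "\<phi> \<in> PiE {..<N} (\<lambda>_. {..<d})"
    then have l: "\<And>j. j < N \<Longrightarrow> \<phi> j < d" by (auto simp: PiE_iff)
    show "restrict (\<lambda>j. digit j (encode \<phi>)) {..<N} = \<phi>"
      using \<phi> by (intro extensionalityI[of _ "{..<N}"]) (auto simp: digit_encode l PiE_iff)
    show "encode \<phi> \<in> {..<d ^ N}" using encode_less[of \<phi>] l by simp
    show "(\<Prod>j<N. g j (digit j (encode \<phi>))) = (\<Prod>j<N. g j (\<phi> j))"
      by (intro prod.cong) (auto simp: digit_encode l)
  next
    fix x assume x: "x \<in> {..<d ^ N}"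
    have "encode (restrict (\<lambda>j. digit j x) {..<N}) = encode (\<lambda>j. digit j x)"
      unfolding encode_def by (intro sum.cong) auto
    then show "encode (restrict (\<lambda>j. digit j x) {..<N}) = x" using x encode_digit by simp
    show "restrict (\<lambda>j. digit j x) {..<N} \<in> PiE {..<N} (\<lambda>_. {..<d})" using x by (auto simp: digit_less)
  qed
  finally show ?thesis by simp
qed

section \<open>Tensor products of site matrices and operators on a single site\<close>

definition tensor :: "(nat \<Rightarrow> complex mat) \<Rightarrow> complex mat" where
  "tensor w = mat (d ^ N) (d ^ N) (\<lambda>(x, y). \<Prod>j<N. w j $$ (digit j x, digit j y))"

lemma tensor_carrier [simp]: "tensor w \<in> carrier_mat (d ^ N) (d ^ N)"
  by (simp add: tensor_def)

lemma tensor_dim [simp]: "dim_row (tensor w) = d ^ N" "dim_col (tensor w) = d ^ N"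
  by (simp_all add: tensor_def)

lemma tensor_index:
  "x < d ^ N \<Longrightarrow> y < d ^ N \<Longrightarrow> tensor w $$ (x, y) = (\<Prod>j<N. w j $$ (digit j x, digit j y))"
  by (simp add: tensor_def)

lemma tensor_cong: "(\<And>j. j < N \<Longrightarrow> w j = v j) \<Longrightarrow> tensor w = tensor v"
  unfolding tensor_def by (intro cong_mat) auto

lemma tensor_mult:
  assumes "\<And>j. j < N \<Longrightarrow> w j \<in> carrier_mat d d" "\<And>j. j < N \<Longrightarrow> v j \<in> carrier_mat d d"
  shows "tensor w * tensor v = tensor (\<lambda>j. w j * v j)"
proof (rule mat_eqI)
  fix x y assume xy: "x < d ^ N" "y < d ^ N"
  have "(tensor w * tensor v) $$ (x, y) =
      (\<Sum>z<d ^ N. \<Prod>j<N. w j $$ (digit j x, digit j z) * v j $$ (digit j z, digit j y))"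
    using xy by (subst mult_index[OF tensor_carrier tensor_carrier])
      (auto simp: tensor_index prod.distrib)
  also have "\<dots> = (\<Prod>j<N. \<Sum>c<d. w j $$ (digit j x, c) * v j $$ (c, digit j y))"
    by (rule sum_prod_digits)
  also have "\<dots> = tensor (\<lambda>j. w j * v j) $$ (x, y)"
    unfolding tensor_index[OF xy] using assms xy
    by (intro prod.cong) (auto simp: mult_index[of _ d d _ d] digit_less simp del: index_mult_mat(1))
  finally show "(tensor w * tensor v) $$ (x, y) = tensor (\<lambda>j. w j * v j) $$ (x, y)" .
qed (auto intro: mult_carrier_mat)

lemma tensor_one: "tensor (\<lambda>_. 1\<^sub>m d) = 1\<^sub>m (d ^ N)"
proof (rule mat_eqI)
  fix x y assume xy: "x < d ^ N" "y < d ^ N"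
  show "tensor (\<lambda>_. 1\<^sub>m d) $$ (x, y) = 1\<^sub>m (d ^ N) $$ (x, y)"
  proof (cases "x = y")
    case False
    then obtain j where "j < N" "digit j x \<noteq> digit j y" using digit_eqI xy by blast
    then show ?thesis using xy False by (auto simp: tensor_index digit_less)
  qed (use xy in \<open>auto simp: tensor_index digit_less\<close>)
qed auto

lemma tensor_adj:
  assumes "\<And>j. j < N \<Longrightarrow> w j \<in> carrier_mat d d"
  shows "mat_adjoint (tensor w) = tensor (\<lambda>j. mat_adjoint (w j))"
  using assms by (intro mat_eqI[of _ "d ^ N" "d ^ N"])
    (auto simp: tensor_index adj_index'[of _ d d] digit_less simp del: adj_index, simp add: tensor_index adj_index'[OF tensor_carrier])

lemma tensor_trace:
  assumes "\<And>j. j < N \<Longrightarrow> w j \<in> carrier_mat d d"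
  shows "mat_trace (tensor w) = (\<Prod>j<N. mat_trace (w j))"
proof -
  have "mat_trace (tensor w) = (\<Sum>x<d ^ N. \<Prod>j<N. w j $$ (digit j x, digit j x))"
    unfolding mat_trace_def by (simp add: tensor_index)
  also have "\<dots> = (\<Prod>j<N. \<Sum>c<d. w j $$ (c, c))" by (rule sum_prod_digits)
  also have "\<dots> = (\<Prod>j<N. mat_trace (w j))"
    unfolding mat_trace_def using carrier_matD[OF assms] by (intro prod.cong) auto
  finally show ?thesis .
qed

lemma frob_tensor:
  assumes "\<And>j. j < N \<Longrightarrow> w j \<in> carrier_mat d d"
  shows "frob (tensor w) = (\<Prod>j<N. frob (w j))"
proof -
  have "complex_of_real ((frob (tensor w))\<^sup>2) = mat_trace (tensor (\<lambda>j. mat_adjoint (w j) * w j))"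
    unfolding frob_inner_self[symmetric] using assms
    by (simp add: frob_inner_trace[of _ "d ^ N" "d ^ N"] tensor_adj tensor_mult)
  also have "\<dots> = (\<Prod>j<N. frob_inner (w j) (w j))"
    using assms by (simp add: tensor_trace frob_inner_trace[of _ d d])
  also have "\<dots> = of_real ((\<Prod>j<N. frob (w j))\<^sup>2)"
    unfolding frob_inner_self by (simp add: prod_power_distrib)
  finally have "(frob (tensor w))\<^sup>2 = (\<Prod>j<N. frob (w j))\<^sup>2" by (simp only: of_real_eq_iff)
  then show ?thesis by (simp add: prod_nonneg)
qed

definition site_op :: "nat \<Rightarrow> complex mat \<Rightarrow> complex mat" where
  "site_op p K = tensor ((\<lambda>_. 1\<^sub>m d)(p := K))"

lemma site_op_carrier [simp]: "site_op p K \<in> carrier_mat (d ^ N) (d ^ N)"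
  by (simp add: site_op_def)

lemma site_op_tensor:
  assumes "\<And>j. j < N \<Longrightarrow> w j \<in> carrier_mat d d" "K \<in> carrier_mat d d"
  shows "site_op p K * tensor w = tensor (w(p := K * w p))"
  unfolding site_op_def using assms
  by (subst tensor_mult) (auto simp: left_mult_one_mat[of _ d d] intro!: tensor_cong)

lemma site_op_mult:
  assumes "K \<in> carrier_mat d d" "L \<in> carrier_mat d d"
  shows "site_op p K * site_op p L = site_op p (K * L)"
  unfolding site_op_def[of p L] site_op_def[of p "K * L"] using assms
  by (subst site_op_tensor) (auto intro!: tensor_cong)

lemma site_op_one: "site_op p (1\<^sub>m d) = 1\<^sub>m (d ^ N)"
  unfolding site_op_def tensor_one[symmetric] by (rule tensor_cong) auto

lemma tensor_update_index:
  assumes "x < d ^ N" "y < d ^ N" "p < N"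
  shows "tensor (w(p := K)) $$ (x, y) =
    K $$ (digit p x, digit p y) * (\<Prod>j\<in>{..<N} - {p}. w j $$ (digit j x, digit j y))"
  unfolding tensor_index[OF assms(1,2)] using assms(3)
  by (subst prod.remove[of _ p]) (auto intro!: prod.cong)

lemma site_op_sum:
  assumes "p < N"
  shows "site_op p (mat_sum d I F) = mat_sum (d ^ N) I (\<lambda>i. site_op p (F i))"
  using assms by (intro mat_eqI[of _ "d ^ N" "d ^ N"])
    (auto simp: site_op_def tensor_update_index mat_sum_index digit_less sum_distrib_right)

lemma site_op_smult:
  assumes "p < N" "K \<in> carrier_mat d d"
  shows "site_op p (c \<cdot>\<^sub>m K) = c \<cdot>\<^sub>m site_op p K"
  using assms by (intro mat_eqI[of _ "d ^ N" "d ^ N"])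
    (auto simp: site_op_def tensor_update_index digit_less)

lemma site_op_add:
  assumes "p < N" "K \<in> carrier_mat d d" "L \<in> carrier_mat d d"
  shows "site_op p (K + L) = site_op p K + site_op p L"
  using assms by (intro mat_eqI[of _ "d ^ N" "d ^ N"])
    (auto simp: site_op_def tensor_update_index digit_less algebra_simps)

lemma site_op_minus:
  assumes "p < N" "K \<in> carrier_mat d d" "L \<in> carrier_mat d d"
  shows "site_op p (K - L) = site_op p K - site_op p L"
  using assms by (intro mat_eqI[of _ "d ^ N" "d ^ N"])
    (auto simp: site_op_def tensor_update_index digit_less algebra_simps)

section \<open>Operators exchanging two sites\<close>

definition swap_mat :: "nat \<Rightarrow> nat \<Rightarrow> complex mat" where
  "swap_mat p i = mat (d ^ N) (d ^ N) (\<lambda>(x, y). if y = swap p i x then 1 else 0)"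

lemma swap_mat_carrier [simp]: "swap_mat p i \<in> carrier_mat (d ^ N) (d ^ N)"
  by (simp add: swap_mat_def)

lemma swap_mat_mult_index:
  assumes "M \<in> carrier_mat (d ^ N) m" "x < d ^ N" "y < m" "p < N" "i < N"
  shows "(swap_mat p i * M) $$ (x, y) = M $$ (swap p i x, y)"
proof -
  have "(swap_mat p i * M) $$ (x, y) = (\<Sum>z<d ^ N. swap_mat p i $$ (x, z) * M $$ (z, y))"
    by (rule mult_index[OF swap_mat_carrier assms(1-3)])
  also have "\<dots> = (\<Sum>z<d ^ N. if z = swap p i x then M $$ (z, y) else 0)"
    using assms(2) by (intro sum.cong) (auto simp: swap_mat_def)
  finally show ?thesis using swap_less[OF assms(2,4,5)] by simp
qed

lemma swap_eq_iff:
  "x < d ^ N \<Longrightarrow> y < d ^ N \<Longrightarrow> p < N \<Longrightarrow> i < N \<Longrightarrow> x = swap p i y \<longleftrightarrow> y = swap p i x"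
  using swap_swap[of x p i] swap_swap[of y p i] by metis

lemma swap_mat_adj:
  assumes "p < N" "i < N"
  shows "mat_adjoint (swap_mat p i) = swap_mat p i"
proof (rule mat_eqI)
  fix x y assume "x < d ^ N" "y < d ^ N"
  then show "mat_adjoint (swap_mat p i) $$ (x, y) = swap_mat p i $$ (x, y)"
    using swap_eq_iff[of x y p i] assms by (simp add: swap_mat_def)
qed auto

lemma swap_mat_unitary:
  assumes "p < N" "i < N"
  shows "unitary_mat (d ^ N) (swap_mat p i)"
proof -
  have "swap_mat p i * swap_mat p i = 1\<^sub>m (d ^ N)"
  proof (rule mat_eqI)
    fix x y assume xy: "x < d ^ N" "y < d ^ N"
    show "(swap_mat p i * swap_mat p i) $$ (x, y) = 1\<^sub>m (d ^ N) $$ (x, y)"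
      unfolding swap_mat_mult_index[OF swap_mat_carrier xy assms]
      using xy assms swap_swap[of x p i] by (simp add: swap_mat_def swap_less)
  qed (auto intro: mult_carrier_mat)
  then show ?thesis using assms by (simp add: unitary_mat_def swap_mat_adj)
qed

text \<open>\<open>U\<close> is \<open>z\<close> at site \<open>i\<close> tensored with an
  arbitrary, possibly entangled matrix \<open>F\<close> on the other sites. Overwriting digits
  avoids a separate index set for those sites.\<close>

definition has_factor :: "nat \<Rightarrow> complex mat \<Rightarrow> complex mat \<Rightarrow> bool" where
  "has_factor i z U \<longleftrightarrow> (\<exists>F. \<forall>x<d ^ N. \<forall>y<d ^ N. \<forall>c<d. \<forall>e<d.
     U $$ (update i c x, update i e y) = F x y * z $$ (c, e))"

text \<open>The partial inner product with \<open>z\<close> at site \<open>i\<close>, a matrix on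
  the other sites; the digits of \<open>x\<close> and \<open>y\<close> at \<open>i\<close> are
  overwritten and do not affect it.\<close>

definition site_contraction :: "nat \<Rightarrow> complex mat \<Rightarrow> complex mat \<Rightarrow> nat \<Rightarrow> nat \<Rightarrow> complex" where
  "site_contraction i z V x y = (\<Sum>c<d. \<Sum>e<d. cnj (z $$ (c, e)) * V $$ (update i c x, update i e y))"

text \<open>Summing over site \<open>i\<close> first pulls out \<open>F\<close> and leaves the
  contraction of \<open>V\<close> with \<open>z\<close>, which vanishes. \<open>sum_update\<close>
  counts rows and columns \<open>d\<close> times each, a factor that cancels when \<open>d\<close>
  is positive.\<close>

lemma frob_inner_zero:
  assumes i: "i < N" and U: "U \<in> carrier_mat (d ^ N) (d ^ N)" "has_factor i z U"
    and V: "V \<in> carrier_mat (d ^ N) (d ^ N)"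
    and 0: "\<And>x y. x < d ^ N \<Longrightarrow> y < d ^ N \<Longrightarrow> site_contraction i z V x y = 0"
  shows "frob_inner U V = 0"
proof (cases "d = 0")
  case True
  then have "d ^ N = 0" using i by (simp add: power_0_left)
  then have "dim_row U = 0" using U(1) by (metis carrier_matD(1))
  then show ?thesis by (simp add: frob_inner_def)
next
  case False
  define h where "h x y = cnj (U $$ (x, y)) * V $$ (x, y)" for x y
  obtain F where F: "\<And>x y c e. x < d ^ N \<Longrightarrow> y < d ^ N \<Longrightarrow> c < d \<Longrightarrow> e < d \<Longrightarrow>
     U $$ (update i c x, update i e y) = F x y * z $$ (c, e)"
    using U(2) unfolding has_factor_def by blast
  have z: "(\<Sum>c<d. \<Sum>e<d. h (update i c x) (update i e y)) = 0" if "x < d ^ N" "y < d ^ N" for x y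
  proof -
    have "(\<Sum>c<d. \<Sum>e<d. h (update i c x) (update i e y)) = cnj (F x y) * site_contraction i z V x y"
      unfolding h_def site_contraction_def sum_distrib_left
      by (intro sum.cong refl) (simp add: F that)
    then show ?thesis using 0 that by simp
  qed
  have "of_nat d * (of_nat d * (\<Sum>x<d ^ N. \<Sum>y<d ^ N. h x y))
      = of_nat d * (\<Sum>x<d ^ N. \<Sum>y<d ^ N. \<Sum>e<d. h x (update i e y))"
    by (simp add: sum_update[OF i] sum_distrib_left)
  also have "\<dots> = (\<Sum>x<d ^ N. \<Sum>c<d. \<Sum>y<d ^ N. \<Sum>e<d. h (update i c x) (update i e y))"
    by (rule sum_update[OF i, of "\<lambda>x. \<Sum>y<d ^ N. \<Sum>e<d. h x (update i e y)", symmetric])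
  also have "\<dots> = (\<Sum>x<d ^ N. \<Sum>y<d ^ N. \<Sum>c<d. \<Sum>e<d. h (update i c x) (update i e y))"
    by (intro sum.cong refl sum.swap)
  also have "\<dots> = 0" using z by simp
  finally have "(\<Sum>x<d ^ N. \<Sum>y<d ^ N. h x y) = 0" using False by simp
  then show ?thesis using U by (simp add: frob_inner_def h_def)
qed

lemma has_factor_minus:
  assumes "has_factor i z U" "has_factor i z V"
    and "U \<in> carrier_mat (d ^ N) (d ^ N)" "V \<in> carrier_mat (d ^ N) (d ^ N)"
  shows "has_factor i z (U - V)"
proof -
  obtain F G where "\<forall>x<d ^ N. \<forall>y<d ^ N. \<forall>c<d. \<forall>e<d. U $$ (update i c x, update i e y) = F x y * z $$ (c, e)"
    "\<forall>x<d ^ N. \<forall>y<d ^ N. \<forall>c<d. \<forall>e<d. V $$ (update i c x, update i e y) = G x y * z $$ (c, e)"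
    using assms(1,2) unfolding has_factor_def by blast
  then show ?thesis using assms(3,4) unfolding has_factor_def
    by (intro exI[of _ "\<lambda>x y. F x y - G x y"]) (simp add: update_less algebra_simps)
qed

lemma site_contraction_minus:
  assumes "U \<in> carrier_mat (d ^ N) (d ^ N)" "V \<in> carrier_mat (d ^ N) (d ^ N)" "x < d ^ N" "y < d ^ N"
  shows "site_contraction i z (U - V) x y = site_contraction i z U x y - site_contraction i z V x y"
  using assms unfolding site_contraction_def sum_subtractf[symmetric]
  by (intro sum.cong refl) (simp add: update_less algebra_simps)

lemma tensor_at_update:
  assumes "x < d ^ N" "y < d ^ N" "c < d" "e < d" "i < N"
  shows "tensor w $$ (update i c x, update i e y) =
    (\<Prod>j\<in>{..<N} - {i}. w j $$ (digit j x, digit j y)) * w i $$ (c, e)"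
proof -
  have "tensor w $$ (update i c x, update i e y) =
    (\<Prod>j<N. w j $$ (digit j (update i c x), digit j (update i e y)))"
    using assms by (simp add: tensor_index update_less)
  also have "\<dots> = w i $$ (digit i (update i c x), digit i (update i e y)) *
     (\<Prod>j\<in>{..<N} - {i}. w j $$ (digit j (update i c x), digit j (update i e y)))"
    using assms by (intro prod.remove) auto
  also have "(\<Prod>j\<in>{..<N} - {i}. w j $$ (digit j (update i c x), digit j (update i e y))) =
     (\<Prod>j\<in>{..<N} - {i}. w j $$ (digit j x, digit j y))"
    using assms by (intro prod.cong) (auto simp: digit_update)
  finally show ?thesis using assms by (simp add: digit_update)
qed

lemma has_factor_tensor: "i < N \<Longrightarrow> has_factor i (w i) (tensor w)"
  unfolding has_factor_def
  by (intro exI[of _ "\<lambda>x y. \<Prod>j\<in>{..<N} - {i}. w j $$ (digit j x, digit j y)"]) (simp add: tensor_at_update)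

lemma site_contraction_tensor:
  assumes "x < d ^ N" "y < d ^ N" "i < N" "z \<in> carrier_mat d d"
  shows "site_contraction i z (tensor w) x y =
    (\<Prod>j\<in>{..<N} - {i}. w j $$ (digit j x, digit j y)) * frob_inner z (w i)"
  using assms by (simp add: site_contraction_def tensor_at_update frob_inner_def sum_distrib_left)
    (simp add: mult_ac)

text \<open>Left multiplication permutes row digits only: the factors at \<open>p\<close> and
  \<open>i\<close> exchange their row indices and keep their column indices. At all other sites the
  product form survives.\<close>

lemma swap_tensor_index:
  assumes "x < d ^ N" "y < d ^ N" "p < N" "i < N" "p \<noteq> i"
  shows "(swap_mat p i * tensor w) $$ (x, y) = (\<Prod>j\<in>{..<N} - {i, p}. w j $$ (digit j x, digit j y)) *
     (w i $$ (digit p x, digit i y) * w p $$ (digit i x, digit p y))"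
proof -
  have "(swap_mat p i * tensor w) $$ (x, y) = (\<Prod>j<N. w j $$ (digit (transpose p i j) x, digit j y))"
    using assms by (simp add: swap_mat_mult_index[OF tensor_carrier] tensor_index swap_less digit_swap)
  also have "\<dots> = w i $$ (digit p x, digit i y) *
      (w p $$ (digit i x, digit p y) * (\<Prod>j\<in>{..<N} - {i} - {p}. w j $$ (digit (transpose p i j) x, digit j y)))"
    using assms prod.remove[of "{..<N}" i "\<lambda>j. w j $$ (digit (transpose p i j) x, digit j y)"]
      prod.remove[of "{..<N} - {i}" p "\<lambda>j. w j $$ (digit (transpose p i j) x, digit j y)"]
    by (simp add: transpose_def)
  also have "{..<N} - {i} - {p} = {..<N} - {i, p}" by auto
  also have "(\<Prod>j\<in>{..<N} - {i, p}. w j $$ (digit (transpose p i j) x, digit j y)) =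
      (\<Prod>j\<in>{..<N} - {i, p}. w j $$ (digit j x, digit j y))"
    by (intro prod.cong) (auto simp: transpose_def)
  finally show ?thesis by (simp only: mult_ac)
qed

lemma has_factor_swap:
  assumes "p < N" "i < N" "p \<noteq> i" "k < N" "k \<noteq> p" "k \<noteq> i"
  shows "has_factor k (w k) (swap_mat p i * tensor w)"
proof -
  let ?P = "\<lambda>x y. \<Prod>j\<in>{..<N} - {i, p} - {k}. w j $$ (digit j x, digit j y)"
  have "(swap_mat p i * tensor w) $$ (update k c x, update k e y) =
    (?P x y * (w i $$ (digit p x, digit i y) * w p $$ (digit i x, digit p y))) * w k $$ (c, e)"
    if xy: "x < d ^ N" "y < d ^ N" "c < d" "e < d" for x y c e
  proof -
    have "(\<Prod>j\<in>{..<N} - {i, p}. w j $$ (digit j (update k c x), digit j (update k e y))) =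
      w k $$ (c, e) * (\<Prod>j\<in>{..<N} - {i, p} - {k}. w j $$ (digit j (update k c x), digit j (update k e y)))"
      using assms xy by (subst prod.remove[of _ k]) (auto simp: digit_update)
    also have "(\<Prod>j\<in>{..<N} - {i, p} - {k}. w j $$ (digit j (update k c x), digit j (update k e y))) = ?P x y"
      using xy by (intro prod.cong) (auto simp: digit_update)
    finally show ?thesis
      using assms xy by (simp add: swap_tensor_index update_less digit_update)
  qed
  then show ?thesis unfolding has_factor_def
    by (intro exI[of _ "\<lambda>x y. ?P x y * (w i $$ (digit p x, digit i y) * w p $$ (digit i x, digit p y))"]) blast
qed

text \<open>Contracting the fresh sample at site \<open>i\<close> turns the swap into left multiplication of site
  \<open>p\<close> by the density matrix \<open>w i * mat_adjoint (w i)\<close>.\<close>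

lemma site_contraction_swap:
  assumes w: "\<And>j. j < N \<Longrightarrow> w j \<in> carrier_mat d d" and xy: "x < d ^ N" "y < d ^ N"
    and pi: "p < N" "i < N" "p \<noteq> i" and 1: "frob (w i) = 1"
  shows "site_contraction i (w i) (swap_mat p i * tensor w) x y =
    site_contraction i (w i) (site_op p (w i * mat_adjoint (w i)) * tensor w) x y"
proof -
  let ?a = "digit p x" and ?b = "digit p y"
  let ?P = "\<Prod>j\<in>{..<N} - {i, p}. w j $$ (digit j x, digit j y)"
  have ab: "?a < d" "?b < d" using xy pi by (auto simp: digit_less)
  have Pu: "(\<Prod>j\<in>{..<N} - {i, p}. w j $$ (digit j (update i c x), digit j (update i e y))) = ?P"
    if "c < d" "e < d" for c e
    using that xy by (intro prod.cong) (auto simp: digit_update)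
  have "site_contraction i (w i) (swap_mat p i * tensor w) x y =
    (\<Sum>c<d. \<Sum>e<d. cnj (w i $$ (c, e)) * (?P * (w i $$ (?a, e) * w p $$ (c, ?b))))"
    unfolding site_contraction_def using xy pi
    by (intro sum.cong refl) (simp add: swap_tensor_index update_less digit_update Pu)
  also have "\<dots> = ?P * (\<Sum>c<d. (\<Sum>e<d. w i $$ (?a, e) * cnj (w i $$ (c, e))) * w p $$ (c, ?b))"
    unfolding sum_distrib_left sum_distrib_right by (intro sum.cong refl) (simp add: mult_ac)
  also have "(\<Sum>c<d. (\<Sum>e<d. w i $$ (?a, e) * cnj (w i $$ (c, e))) * w p $$ (c, ?b)) =
      (w i * mat_adjoint (w i) * w p) $$ (?a, ?b)"
    using w pi ab by (subst mult_index[of _ d d _ d], simp, simp, simp, simp, intro sum.cong refl)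
      (simp add: mult_index[of _ d d _ d] adj_index'[of _ d d] del: index_mult_mat(1) adj_index)
  finally have L: "site_contraction i (w i) (swap_mat p i * tensor w) x y =
    ?P * (w i * mat_adjoint (w i) * w p) $$ (?a, ?b)" .
  let ?v = "w(p := w i * mat_adjoint (w i) * w p)"
  have "site_op p (w i * mat_adjoint (w i)) * tensor w = tensor ?v"
    using w pi by (intro site_op_tensor) auto
  moreover have "site_contraction i (w i) (tensor ?v) x y =
    (\<Prod>j\<in>{..<N} - {i}. ?v j $$ (digit j x, digit j y)) * frob_inner (w i) (w i)"
    using site_contraction_tensor[OF xy pi(2) w[OF pi(2)], of ?v] pi by simp
  moreover have "(\<Prod>j\<in>{..<N} - {i}. ?v j $$ (digit j x, digit j y)) =
     (w i * mat_adjoint (w i) * w p) $$ (?a, ?b) * (\<Prod>j\<in>{..<N} - {i} - {p}. ?v j $$ (digit j x, digit j y))"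
    using pi by (subst prod.remove[of _ p]) auto
  moreover have "(\<Prod>j\<in>{..<N} - {i} - {p}. ?v j $$ (digit j x, digit j y)) = ?P"
    by (intro prod.cong) auto
  moreover have "frob_inner (w i) (w i) = 1" using 1 by (simp add: frob_inner_self)
  ultimately show ?thesis unfolding L by (simp only: mult.commute mult_1_right mult_1_left)
qed

end

section \<open>Concentration of the collective observable\<close>

lemma frob_inner_smult:
  assumes "M \<in> carrier_mat n m" "N \<in> carrier_mat n m"
  shows "frob_inner (a \<cdot>\<^sub>m M) (b \<cdot>\<^sub>m N) = cnj a * b * frob_inner M N"
  using assms by (simp add: frob_inner_def sum_distrib_left mult_ac)

text \<open>Pythagoras for X = Y + (X - Y). With \<open>Y\<close> in the role of a mean, centring
  does not enlarge the norm.\<close>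

lemma frob_diff_le:
  assumes X: "X \<in> carrier_mat n m" and Y: "Y \<in> carrier_mat n m" and orth: "frob_inner Y (X - Y) = 0"
  shows "frob (X - Y) \<le> frob X"
proof -
  let ?x = "\<lambda>i j. X $$ (i, j)" and ?y = "\<lambda>i j. Y $$ (i, j)"
  have e: "(cmod a)\<^sup>2 = (cmod (a - b))\<^sup>2 + (cmod b)\<^sup>2 + 2 * Re (cnj b * (a - b))" for a b
    unfolding cmod_power2 by (simp add: power2_eq_square algebra_simps)
  have "(frob X)\<^sup>2 = (\<Sum>i<n. \<Sum>j<m. (cmod (?x i j - ?y i j))\<^sup>2 + (cmod (?y i j))\<^sup>2
      + 2 * Re (cnj (?y i j) * (?x i j - ?y i j)))"
    unfolding frob_sq e[symmetric] using X by simp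
  also have "\<dots> = (\<Sum>i<n. \<Sum>j<m. (cmod (?x i j - ?y i j))\<^sup>2) + (\<Sum>i<n. \<Sum>j<m. (cmod (?y i j))\<^sup>2)
      + 2 * Re (\<Sum>i<n. \<Sum>j<m. cnj (?y i j) * (?x i j - ?y i j))"
    by (simp only: sum.distrib sum_distrib_left Re_sum)
  also have "\<dots> = (frob (X - Y))\<^sup>2 + (frob Y)\<^sup>2 + 2 * Re (frob_inner Y (X - Y))"
    unfolding frob_sq frob_inner_def using X Y by simp
  finally have "(frob X)\<^sup>2 = (frob (X - Y))\<^sup>2 + (frob Y)\<^sup>2 + 2 * Re (frob_inner Y (X - Y))" .
  then have "(frob (X - Y))\<^sup>2 \<le> (frob X)\<^sup>2" by (simp add: orth)
  then show ?thesis by (rule power2_le_imp_le) simp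
qed

lemma smult_mult_left:
  fixes A :: "complex mat"
  shows "A \<in> carrier_mat n n \<Longrightarrow> B \<in> carrier_mat n n \<Longrightarrow> (c \<cdot>\<^sub>m A) * B = c \<cdot>\<^sub>m (A * B)"
  by (rule mult_smult_assoc_mat)

lemma minus_mult_sq:
  fixes A :: "complex mat"
  shows "A \<in> carrier_mat n n \<Longrightarrow> B \<in> carrier_mat n n \<Longrightarrow> C \<in> carrier_mat n n \<Longrightarrow> (A - B) * C = A * C - B * C"
  by (rule minus_mult_distrib_mat)

lemma smult_minus_sq:
  fixes A :: "complex mat"
  shows "A \<in> carrier_mat n n \<Longrightarrow> B \<in> carrier_mat n n \<Longrightarrow> c \<cdot>\<^sub>m (A - B) = c \<cdot>\<^sub>m A - c \<cdot>\<^sub>m B"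
  by (intro eq_matI) (auto simp: algebra_simps)

lemma minus_split_mult:
  fixes A :: "complex mat"
  assumes "A \<in> carrier_mat n n" "B \<in> carrier_mat n n" "C \<in> carrier_mat n n" "M \<in> carrier_mat n n"
  shows "(A - C) * M = (A - B) * M + (B - C) * M"
proof -
  have "A - C = (A - B) + (B - C)" using assms by (intro eq_matI) auto
  then show ?thesis using assms by (simp add: add_mult_distrib_mat[of _ n n _ _ n])
qed

context tensor_sites
begin

lemma has_factor_smult:
  assumes "has_factor i z U" "U \<in> carrier_mat (d ^ N) (d ^ N)"
  shows "has_factor i z (a \<cdot>\<^sub>m U)"
proof -
  obtain F where "\<forall>x<d ^ N. \<forall>y<d ^ N. \<forall>c<d. \<forall>e<d. U $$ (update i c x, update i e y) = F x y * z $$ (c, e)"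
    using assms(1) unfolding has_factor_def by blast
  then show ?thesis using assms(2) unfolding has_factor_def
    by (intro exI[of _ "\<lambda>x y. a * F x y"]) (simp add: update_less)
qed

lemma site_contraction_smult:
  assumes "U \<in> carrier_mat (d ^ N) (d ^ N)" "x < d ^ N" "y < d ^ N"
  shows "site_contraction i z (a \<cdot>\<^sub>m U) x y = a * site_contraction i z U x y"
  using assms unfolding site_contraction_def sum_distrib_left
  by (intro sum.cong refl) (simp add: update_less)

text \<open>\<open>Y i\<close> is the analogue of the conditional expectation of \<open>X i\<close>
  given the sites other than \<open>i\<close>. The contraction of \<open>X i - Y i\<close> with
  \<open>z i\<close> vanishes, while each other fluctuation still carries the factor
  \<open>z i\<close>, so distinct fluctuations are orthogonal. The case k = i of \<open>fY\<close>
  makes \<open>Y i\<close> orthogonal to its own fluctuation, which bounds that by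
  \<open>X i\<close>.\<close>

lemma frob_fluctuations:
  fixes c :: "nat \<Rightarrow> real"
  assumes I: "I \<subseteq> {..<N}"
    and X: "\<And>i. i \<in> I \<Longrightarrow> X i \<in> carrier_mat (d ^ N) (d ^ N)"
    and Y: "\<And>i. i \<in> I \<Longrightarrow> Y i \<in> carrier_mat (d ^ N) (d ^ N)"
    and XY: "\<And>i x y. i \<in> I \<Longrightarrow> x < d ^ N \<Longrightarrow> y < d ^ N \<Longrightarrow>
      site_contraction i (z i) (X i) x y = site_contraction i (z i) (Y i) x y"
    and fX: "\<And>i k. i \<in> I \<Longrightarrow> k \<in> I \<Longrightarrow> k \<noteq> i \<Longrightarrow> has_factor k (z k) (X i)"
    and fY: "\<And>i k. i \<in> I \<Longrightarrow> k \<in> I \<Longrightarrow> has_factor k (z k) (Y i)"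
  shows "(frob (mat_sum (d ^ N) I (\<lambda>i. of_real (c i) \<cdot>\<^sub>m (X i - Y i))))\<^sup>2 \<le> (\<Sum>i\<in>I. (c i)\<^sup>2 * (frob (X i))\<^sup>2)"
proof -
  have fin: "finite I" using I finite_subset by blast
  have zero: "frob_inner U (X i - Y i) = 0"
    if "i \<in> I" "U \<in> carrier_mat (d ^ N) (d ^ N)" "has_factor i (z i) U" for i U
    using that I X Y XY by (intro frob_inner_zero[of i U "z i"]) (auto simp: site_contraction_minus)
  have "(frob (mat_sum (d ^ N) I (\<lambda>i. of_real (c i) \<cdot>\<^sub>m (X i - Y i))))\<^sup>2 =
    (\<Sum>i\<in>I. (frob (of_real (c i) \<cdot>\<^sub>m (X i - Y i)))\<^sup>2)"
  proof (rule frob_pythagoras[OF fin])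
    fix i j assume ij: "i \<in> I" "j \<in> I" "i \<noteq> j"
    have "has_factor j (z j) (X i - Y i)"
      using ij fX fY X Y by (intro has_factor_minus) auto
    then have "frob_inner (X i - Y i) (X j - Y j) = 0"
      using ij X Y by (intro zero) auto
    then show "frob_inner (of_real (c i) \<cdot>\<^sub>m (X i - Y i)) (of_real (c j) \<cdot>\<^sub>m (X j - Y j)) = 0"
      using ij X Y by (subst frob_inner_smult[of _ "d ^ N" "d ^ N"]) auto
  qed (use X Y in auto)
  also have "\<dots> \<le> (\<Sum>i\<in>I. (c i)\<^sup>2 * (frob (X i))\<^sup>2)"
  proof (rule sum_mono)
    fix i assume i: "i \<in> I"
    have "frob (X i - Y i) \<le> frob (X i)"
      using i X Y fY by (intro frob_diff_le[of _ "d ^ N" "d ^ N"] zero) auto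
    then show "(frob (of_real (c i) \<cdot>\<^sub>m (X i - Y i)))\<^sup>2 \<le> (c i)\<^sup>2 * (frob (X i))\<^sup>2"
      by (simp add: frob_smult power_mult_distrib mult_left_mono power_mono)
  qed
  finally show ?thesis .
qed

text \<open>Only the programs have to be normalized. Site \<open>p\<close> may carry any matrix, and
  this freedom is what later allows a resolvent to be multiplied into \<open>z p\<close> before the
  estimate is applied.\<close>

lemma swap_average_bound:
  fixes c :: "nat \<Rightarrow> real"
  assumes z: "\<And>j. j < N \<Longrightarrow> z j \<in> carrier_mat d d" and I: "I \<subseteq> {..<N}" and p: "p < N" "p \<notin> I"
    and 1: "\<And>i. i \<in> I \<Longrightarrow> frob (z i) = 1"
  shows "(frob ((mat_sum (d ^ N) I (\<lambda>i. of_real (c i) \<cdot>\<^sub>m swap_mat p i)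
      - site_op p (mat_sum d I (\<lambda>i. of_real (c i) \<cdot>\<^sub>m (z i * mat_adjoint (z i))))) * tensor z))\<^sup>2
    \<le> (\<Sum>i\<in>I. (c i)\<^sup>2) * (frob (tensor z))\<^sup>2"
proof -
  let ?D = "d ^ N"
  let ?w = "\<lambda>i. z i * mat_adjoint (z i)"
  let ?X = "\<lambda>i. swap_mat p i * tensor z" and ?Y = "\<lambda>i. site_op p (?w i) * tensor z"
  have Ic: "i < N" "i \<noteq> p" "z i \<in> carrier_mat d d" "?w i \<in> carrier_mat d d" if "i \<in> I" for i
    using that I p z by auto
  have X: "?X i \<in> carrier_mat ?D ?D" and Y: "?Y i \<in> carrier_mat ?D ?D" for i by simp_all
  have Yt: "?Y i = tensor (z(p := ?w i * z p))" if "i \<in> I" for i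
    using z Ic[OF that] by (intro site_op_tensor) auto
  have "site_op p (mat_sum d I (\<lambda>i. of_real (c i) \<cdot>\<^sub>m ?w i)) = mat_sum ?D I (\<lambda>i. of_real (c i) \<cdot>\<^sub>m site_op p (?w i))"
    unfolding site_op_sum[OF p(1)] using Ic p by (intro mat_sum_cong site_op_smult) auto
  then have "(mat_sum ?D I (\<lambda>i. of_real (c i) \<cdot>\<^sub>m swap_mat p i)
      - site_op p (mat_sum d I (\<lambda>i. of_real (c i) \<cdot>\<^sub>m ?w i))) * tensor z
    = mat_sum ?D I (\<lambda>i. of_real (c i) \<cdot>\<^sub>m (?X i - ?Y i))"
    by (simp add: mat_sum_minus mat_sum_mult minus_mult_sq[of _ ?D] smult_mult_left[of _ ?D] smult_minus_sq[of _ ?D])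
  then have "(frob ((mat_sum ?D I (\<lambda>i. of_real (c i) \<cdot>\<^sub>m swap_mat p i)
      - site_op p (mat_sum d I (\<lambda>i. of_real (c i) \<cdot>\<^sub>m ?w i))) * tensor z))\<^sup>2
    = (frob (mat_sum ?D I (\<lambda>i. of_real (c i) \<cdot>\<^sub>m (?X i - ?Y i))))\<^sup>2" by simp
  also have "\<dots> \<le> (\<Sum>i\<in>I. (c i)\<^sup>2 * (frob (?X i))\<^sup>2)"
  proof (rule frob_fluctuations[OF I X Y, where z = z])
    fix i x y assume "i \<in> I" "x < ?D" "y < ?D"
    then show "site_contraction i (z i) (?X i) x y = site_contraction i (z i) (?Y i) x y"
      using z p Ic 1 by (intro site_contraction_swap) auto
  next
    fix i k assume "i \<in> I" "k \<in> I" "k \<noteq> i"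
    then show "has_factor k (z k) (?X i)" using p Ic by (intro has_factor_swap) auto
  next
    fix i k assume ik: "i \<in> I" "k \<in> I"
    then show "has_factor k (z k) (?Y i)"
      unfolding Yt[OF ik(1)] using has_factor_tensor[of k "z(p := ?w i * z p)"] Ic by simp
  qed
  also have "\<dots> = (\<Sum>i\<in>I. (c i)\<^sup>2 * (frob (tensor z))\<^sup>2)"
    using Ic p by (intro sum.cong refl) (simp add: frob_unitary[OF swap_mat_unitary tensor_carrier])
  finally show ?thesis by (simp add: sum_distrib_right)
qed

text \<open>A law of large numbers for the probes: on a normalized site,
  \<open>frob_inner (z p) (K * z p)\<close> is the expectation of \<open>K\<close> in the state
  \<open>z p * mat_adjoint (z p)\<close>, and deviations at different sites are orthogonal.\<close>

lemma site_average_bound: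
  fixes s :: "nat \<Rightarrow> real"
  assumes z: "\<And>j. j < N \<Longrightarrow> z j \<in> carrier_mat d d" and P: "P \<subseteq> {..<N}"
    and 1: "\<And>p. p \<in> P \<Longrightarrow> frob (z p) = 1" and K: "K \<in> carrier_mat d d"
  shows "(frob ((mat_sum (d ^ N) P (\<lambda>p. of_real (s p) \<cdot>\<^sub>m site_op p K)
      - (\<Sum>p\<in>P. of_real (s p) * frob_inner (z p) (K * z p)) \<cdot>\<^sub>m 1\<^sub>m (d ^ N)) * tensor z))\<^sup>2
    \<le> (\<Sum>p\<in>P. (s p)\<^sup>2 * (frob (site_op p K * tensor z))\<^sup>2)"
proof -
  let ?D = "d ^ N"
  let ?m = "\<lambda>p. frob_inner (z p) (K * z p)"
  let ?X = "\<lambda>p. site_op p K * tensor z" and ?Y = "\<lambda>p. ?m p \<cdot>\<^sub>m tensor z"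
  have Pc: "i < N" "z i \<in> carrier_mat d d" if "i \<in> P" for i using that P z by auto
  have X: "?X i \<in> carrier_mat ?D ?D" and Y: "?Y i \<in> carrier_mat ?D ?D" for i by simp_all
  have Xt: "?X i = tensor (z(i := K * z i))" for i
    using z K by (intro site_op_tensor) auto
  have "(\<Sum>p\<in>P. of_real (s p) * ?m p) \<cdot>\<^sub>m 1\<^sub>m ?D = mat_sum ?D P (\<lambda>p. of_real (s p) \<cdot>\<^sub>m (?m p \<cdot>\<^sub>m 1\<^sub>m ?D))"
    by (intro mat_eqI[of _ ?D ?D]) (auto simp: mat_sum_index sum_distrib_right)
  then have "(mat_sum ?D P (\<lambda>p. of_real (s p) \<cdot>\<^sub>m site_op p K) - (\<Sum>p\<in>P. of_real (s p) * ?m p) \<cdot>\<^sub>m 1\<^sub>m ?D) * tensor z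
    = mat_sum ?D P (\<lambda>p. of_real (s p) \<cdot>\<^sub>m (?X p - ?Y p))"
    by (simp add: mat_sum_minus mat_sum_mult minus_mult_sq[of _ ?D] smult_mult_left[of _ ?D]
        smult_minus_sq[of _ ?D] left_mult_one_mat[of _ ?D ?D])
  then have "(frob ((mat_sum ?D P (\<lambda>p. of_real (s p) \<cdot>\<^sub>m site_op p K)
      - (\<Sum>p\<in>P. of_real (s p) * ?m p) \<cdot>\<^sub>m 1\<^sub>m ?D) * tensor z))\<^sup>2
    = (frob (mat_sum ?D P (\<lambda>p. of_real (s p) \<cdot>\<^sub>m (?X p - ?Y p))))\<^sup>2" by simp
  also have "\<dots> \<le> (\<Sum>p\<in>P. (s p)\<^sup>2 * (frob (?X p))\<^sup>2)"
  proof (rule frob_fluctuations[OF P X Y, where z = z])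
    fix i x y assume ixy: "i \<in> P" "x < ?D" "y < ?D"
    note sc = site_contraction_tensor[OF ixy(2,3) Pc[OF ixy(1)]]
    have "site_contraction i (z i) (?X i) x y = (\<Prod>j\<in>{..<N} - {i}. z j $$ (digit j x, digit j y)) * ?m i"
      unfolding Xt sc by (intro arg_cong2[where f = "(*)"] prod.cong) auto
    moreover have "site_contraction i (z i) (?Y i) x y = ?m i * site_contraction i (z i) (tensor z) x y"
      using ixy by (intro site_contraction_smult) auto
    ultimately show "site_contraction i (z i) (?X i) x y = site_contraction i (z i) (?Y i) x y"
      using 1[OF ixy(1)] by (simp add: sc frob_inner_self)
  next
    fix i k assume "i \<in> P" "k \<in> P" "k \<noteq> i"
    then show "has_factor k (z k) (?X i)"
      unfolding Xt using has_factor_tensor[of k "z(i := K * z i)"] Pc by simp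
  next
    fix i k assume "i \<in> P" "k \<in> P"
    then show "has_factor k (z k) (?Y i)" using Pc by (intro has_factor_smult has_factor_tensor) auto
  qed
  finally show ?thesis .
qed

lemma frob_tensor_update:
  assumes z: "\<And>j. j < N \<Longrightarrow> z j \<in> carrier_mat d d" and 1: "\<And>j. j < N \<Longrightarrow> frob (z j) = 1"
    and p: "p < N" and K: "K \<in> carrier_mat d d"
  shows "frob (tensor (z(p := K))) = frob K"
proof -
  have "frob (tensor (z(p := K))) = (\<Prod>j<N. frob ((z(p := K)) j))"
    using z K by (intro frob_tensor) auto
  also have "\<dots> = frob K * (\<Prod>j\<in>{..<N} - {p}. frob ((z(p := K)) j))"
    using p by (subst prod.remove[of _ p]) auto
  also have "(\<Prod>j\<in>{..<N} - {p}. frob ((z(p := K)) j)) = 1" using 1 by (intro prod.neutral) auto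
  finally show ?thesis by (simp add: fun_upd_def)
qed

text \<open>The bound required by \<open>smooth_sgn_perturbation\<close> comes from the product
  structure: \<open>site_op p (R s)\<close> replaces \<open>z p\<close> by \<open>R s * z p\<close>,
  giving a product of norm at most 1/|s|, to which \<open>swap_average_bound\<close>
  applies.\<close>

lemma probe_bound:
  fixes c :: "nat \<Rightarrow> real"
  assumes z: "\<And>j. j < N \<Longrightarrow> z j \<in> carrier_mat d d" and 1: "\<And>j. j < N \<Longrightarrow> frob (z j) = 1"
    and I: "I \<subseteq> {..<N}" and p: "p < N" "p \<notin> I"
    and U: "unitary_mat (d ^ N) U"
    and A: "mat_sum (d ^ N) I (\<lambda>i. of_real (c i) \<cdot>\<^sub>m swap_mat p i) = diagonalized (d ^ N) U (\<lambda>j. of_real (a j))"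
    and V: "unitary_mat d V"
    and B: "mat_sum d I (\<lambda>i. of_real (c i) \<cdot>\<^sub>m (z i * mat_adjoint (z i))) = diagonalized d V (\<lambda>j. of_real (b j))"
    and \<delta>: "\<delta> > 0"
  shows "frob ((diagonalized (d ^ N) U (\<lambda>j. of_real (smooth_sgn \<delta> K (a j)))
    - site_op p (diagonalized d V (\<lambda>j. of_real (smooth_sgn \<delta> K (b j))))) * tensor z)
    \<le> 2 * sqrt (\<Sum>i\<in>I. (c i)\<^sup>2) / \<delta>"
proof -
  let ?D = "d ^ N"
  let ?A = "mat_sum ?D I (\<lambda>i. of_real (c i) \<cdot>\<^sub>m swap_mat p i)"
  let ?B = "mat_sum d I (\<lambda>i. of_real (c i) \<cdot>\<^sub>m (z i * mat_adjoint (z i)))"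
  define R where "R s = diagonalized d V (\<lambda>j. resolvent_fun s (b j))" for s
  have Vc: "V \<in> carrier_mat d d" using V by (rule unitary_carrier)
  have R: "R s \<in> carrier_mat d d" for s using Vc by (simp add: R_def)
  have BR: "(site_op p ?B - (\<i> * of_real s) \<cdot>\<^sub>m 1\<^sub>m ?D) * site_op p (R s) = 1\<^sub>m ?D" if "s \<noteq> 0" for s
  proof -
    have "?B - (\<i> * of_real s) \<cdot>\<^sub>m 1\<^sub>m d = diagonalized d V (\<lambda>j. of_real (b j) - \<i> * of_real s * 1)"
      unfolding B using Vc by (simp only: diagonalized_minus diagonalized_smult diagonalized_one[OF V])
    then have "(?B - (\<i> * of_real s) \<cdot>\<^sub>m 1\<^sub>m d) * R s = diagonalized d V (\<lambda>_. 1)"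
      unfolding R_def using resolvent_fun_denom[OF that]
      by (simp add: diagonalized_mult[OF V] resolvent_fun_def)
    then have "(?B - (\<i> * of_real s) \<cdot>\<^sub>m 1\<^sub>m d) * R s = 1\<^sub>m d" using diagonalized_one[OF V] by simp
    moreover have "site_op p ?B - (\<i> * of_real s) \<cdot>\<^sub>m 1\<^sub>m ?D = site_op p (?B - (\<i> * of_real s) \<cdot>\<^sub>m 1\<^sub>m d)"
      using p by (simp add: site_op_minus site_op_smult site_op_one)
    ultimately show ?thesis using R[of s] site_op_one by (simp add: site_op_mult)
  qed
  have bound: "frob ((?A - site_op p ?B) * (site_op p (R s) * tensor z)) \<le> sqrt (\<Sum>i\<in>I. (c i)\<^sup>2) / \<bar>s\<bar>"
    if "s \<noteq> 0" for s
  proof -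
    let ?z = "z(p := R s * z p)"
    have zp: "z p \<in> carrier_mat d d" using z p by simp
    have t: "site_op p (R s) * tensor z = tensor ?z" using z R by (intro site_op_tensor) auto
    have "frob (tensor ?z) = frob (R s * z p)"
      using z 1 p R zp by (intro frob_tensor_update) auto
    also have "\<dots> \<le> 1 / \<bar>s\<bar> * frob (z p)"
      unfolding R_def by (rule frob_diagonalized[OF V zp resolvent_fun_norm[OF that]])
    finally have f: "frob (tensor ?z) \<le> 1 / \<bar>s\<bar>" using 1 p by simp
    \<comment> \<open>The modified product has the same programs because
      \<open>p \<notin> I\<close>, hence the same mean operator.\<close>
    have B': "?B = mat_sum d I (\<lambda>i. of_real (c i) \<cdot>\<^sub>m (?z i * mat_adjoint (?z i)))"
      using p by (intro mat_sum_cong) auto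
    have "(frob ((?A - site_op p ?B) * tensor ?z))\<^sup>2 \<le> (\<Sum>i\<in>I. (c i)\<^sup>2) * (frob (tensor ?z))\<^sup>2"
      unfolding B' using z 1 p I R zp by (intro swap_average_bound) auto
    also have "\<dots> \<le> (\<Sum>i\<in>I. (c i)\<^sup>2) * (1 / \<bar>s\<bar>)\<^sup>2"
      by (intro mult_left_mono power_mono f sum_nonneg) auto
    also have "\<dots> = (sqrt (\<Sum>i\<in>I. (c i)\<^sup>2) / \<bar>s\<bar>)\<^sup>2"
      by (simp add: power_divide sum_nonneg)
    finally show ?thesis unfolding t by (rule power2_le_imp_le) (simp add: sum_nonneg)
  qed
  have fB: "site_op p (diagonalized d V (\<lambda>j. of_real (smooth_sgn \<delta> K (b j)))) =
    mat_sum ?D {1..K} (\<lambda>k. of_real (\<delta> / pi) \<cdot>\<^sub>m (site_op p (R (real k * \<delta>)) + site_op p (R (- (real k * \<delta>)))))"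
  proof -
    have "diagonalized d V (\<lambda>j. of_real (\<delta> / pi) * (resolvent_fun s (b j) + resolvent_fun t (b j))) =
      of_real (\<delta> / pi) \<cdot>\<^sub>m (R s + R t)" for s t
    proof -
      have "diagonalized d V (\<lambda>j. resolvent_fun s (b j) - (- 1) * resolvent_fun t (b j)) = R s + R t"
        unfolding diagonalized_minus[OF Vc] diagonalized_smult[OF Vc] R_def using Vc
        by (intro eq_matI) auto
      then show ?thesis unfolding diagonalized_smult[OF Vc] by simp
    qed
    then show ?thesis
      unfolding smooth_sgn_resolvent[OF \<delta>] diagonalized_sum[OF Vc] site_op_sum[OF p(1)]
      using p R by (intro mat_sum_cong) (simp add: site_op_smult site_op_add)
  qed
  show ?thesis unfolding fB
    using smooth_sgn_perturbation[OF U A site_op_carrier site_op_carrier BR tensor_carrier \<delta> bound] by simp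
qed

text \<open>The local operators \<open>site_op p fB\<close> separate two errors. All probes consult
  the same programs, so their systematic errors are added by the triangle inequality, at the price
  of the total weight of \<open>s\<close>. Sampling errors are orthogonal and cost only the root of
  the sum of squares.\<close>

theorem observable_bound:
  fixes c s :: "nat \<Rightarrow> real" and K :: nat and \<delta> :: real
  assumes z: "\<And>j. j < N \<Longrightarrow> z j \<in> carrier_mat d d" and 1: "\<And>j. j < N \<Longrightarrow> frob (z j) = 1"
    and I: "I \<subseteq> {..<N}" and P: "P \<subseteq> {..<N}" "P \<inter> I = {}"
    and U: "\<And>p. p \<in> P \<Longrightarrow> unitary_mat (d ^ N) (U p)"
    and A: "\<And>p. p \<in> P \<Longrightarrow> mat_sum (d ^ N) I (\<lambda>i. of_real (c i) \<cdot>\<^sub>m swap_mat p i)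
        = diagonalized (d ^ N) (U p) (\<lambda>j. of_real (a p j))"
    and V: "unitary_mat d V"
    and B: "mat_sum d I (\<lambda>i. of_real (c i) \<cdot>\<^sub>m (z i * mat_adjoint (z i))) = diagonalized d V (\<lambda>j. of_real (b j))"
    and \<delta>: "\<delta> > 0"
  defines "fB \<equiv> diagonalized d V (\<lambda>j. of_real (smooth_sgn \<delta> K (b j)))"
  shows "frob ((mat_sum (d ^ N) P (\<lambda>p. of_real (s p) \<cdot>\<^sub>m diagonalized (d ^ N) (U p) (\<lambda>j. of_real (smooth_sgn \<delta> K (a p j))))
      - (\<Sum>p\<in>P. of_real (s p) * frob_inner (z p) (fB * z p)) \<cdot>\<^sub>m 1\<^sub>m (d ^ N)) * tensor z)
    \<le> (\<Sum>p\<in>P. \<bar>s p\<bar>) * (2 * sqrt (\<Sum>i\<in>I. (c i)\<^sup>2) / \<delta>) + sqrt (\<Sum>p\<in>P. (s p)\<^sup>2)"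
proof -
  let ?D = "d ^ N"
  let ?fA = "\<lambda>p. diagonalized ?D (U p) (\<lambda>j. of_real (smooth_sgn \<delta> K (a p j)))"
  let ?G = "mat_sum ?D P (\<lambda>p. of_real (s p) \<cdot>\<^sub>m ?fA p)"
  let ?H = "mat_sum ?D P (\<lambda>p. of_real (s p) \<cdot>\<^sub>m site_op p fB)"
  let ?M = "(\<Sum>p\<in>P. of_real (s p) * frob_inner (z p) (fB * z p)) \<cdot>\<^sub>m 1\<^sub>m ?D"
  have fin: "finite P" using P finite_subset by blast
  have Vc: "V \<in> carrier_mat d d" using V by (rule unitary_carrier)
  have fB: "fB \<in> carrier_mat d d" unfolding fB_def using Vc by simp
  have fA: "?fA p \<in> carrier_mat ?D ?D" if "p \<in> P" for p using U[OF that] unitary_carrier by simp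
  have Pc: "p < N" "p \<notin> I" "z p \<in> carrier_mat d d" if "p \<in> P" for p using that P z by auto
  have M: "?M \<in> carrier_mat ?D ?D" by simp
  have "(?G - ?H) * tensor z = mat_sum ?D P (\<lambda>p. of_real (s p) \<cdot>\<^sub>m ((?fA p - site_op p fB) * tensor z))"
  proof -
    have "?G - ?H = mat_sum ?D P (\<lambda>p. of_real (s p) \<cdot>\<^sub>m ?fA p - of_real (s p) \<cdot>\<^sub>m site_op p fB)"
      using fA by (intro mat_sum_minus) auto
    also have "\<dots> = mat_sum ?D P (\<lambda>p. of_real (s p) \<cdot>\<^sub>m (?fA p - site_op p fB))"
      using fA by (intro mat_sum_cong) (simp add: smult_minus_sq[of _ ?D])
    finally have "?G - ?H = mat_sum ?D P (\<lambda>p. of_real (s p) \<cdot>\<^sub>m (?fA p - site_op p fB))" .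
    then have "(?G - ?H) * tensor z = mat_sum ?D P (\<lambda>p. of_real (s p) \<cdot>\<^sub>m (?fA p - site_op p fB)) * tensor z"
      by simp
    also have "\<dots> = mat_sum ?D P (\<lambda>p. (of_real (s p) \<cdot>\<^sub>m (?fA p - site_op p fB)) * tensor z)"
      using fA by (intro mat_sum_mult) auto
    also have "\<dots> = mat_sum ?D P (\<lambda>p. of_real (s p) \<cdot>\<^sub>m ((?fA p - site_op p fB) * tensor z))"
      using fA by (intro mat_sum_cong smult_mult_left[of _ ?D]) auto
    finally show ?thesis .
  qed
  then have "frob ((?G - ?H) * tensor z) \<le> (\<Sum>p\<in>P. frob (of_real (s p) \<cdot>\<^sub>m ((?fA p - site_op p fB) * tensor z)))"
    using fA by (simp add: frob_mat_sum[OF fin])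
  also have "\<dots> \<le> (\<Sum>p\<in>P. \<bar>s p\<bar> * (2 * sqrt (\<Sum>i\<in>I. (c i)\<^sup>2) / \<delta>))"
  proof (rule sum_mono)
    fix p assume p: "p \<in> P"
    have "frob ((?fA p - site_op p fB) * tensor z) \<le> 2 * sqrt (\<Sum>i\<in>I. (c i)\<^sup>2) / \<delta>"
      unfolding fB_def by (rule probe_bound[OF z 1 I Pc(1,2)[OF p] U[OF p] A[OF p] V B \<delta>])
    then show "frob (of_real (s p) \<cdot>\<^sub>m ((?fA p - site_op p fB) * tensor z)) \<le> \<bar>s p\<bar> * (2 * sqrt (\<Sum>i\<in>I. (c i)\<^sup>2) / \<delta>)"
      unfolding frob_smult norm_of_real by (intro mult_left_mono) auto
  qed
  also have "\<dots> = (\<Sum>p\<in>P. \<bar>s p\<bar>) * (2 * sqrt (\<Sum>i\<in>I. (c i)\<^sup>2) / \<delta>)" by (rule sum_distrib_right[symmetric])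
  finally have 2: "frob ((?G - ?H) * tensor z) \<le> (\<Sum>p\<in>P. \<bar>s p\<bar>) * (2 * sqrt (\<Sum>i\<in>I. (c i)\<^sup>2) / \<delta>)" .
  have "(frob ((?H - ?M) * tensor z))\<^sup>2 \<le> (\<Sum>p\<in>P. (s p)\<^sup>2 * (frob (site_op p fB * tensor z))\<^sup>2)"
    by (rule site_average_bound[OF z P(1) 1[OF Pc(1)] fB])
  \<comment> \<open>The smoothed sign is bounded by 1 in absolute value, so \<open>fB\<close> is a
    contraction.\<close>
  also have "\<dots> \<le> (\<Sum>p\<in>P. (s p)\<^sup>2 * 1\<^sup>2)"
  proof (intro sum_mono mult_left_mono power_mono)
    fix p assume p: "p \<in> P"
    have "site_op p fB * tensor z = tensor (z(p := fB * z p))" using z fB by (intro site_op_tensor) auto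
    also have "frob \<dots> = frob (fB * z p)" using z 1 Pc[OF p] fB by (intro frob_tensor_update) auto
    also have "\<dots> \<le> 1 * frob (z p)"
      unfolding fB_def using Pc[OF p] smooth_sgn_abs_le_one[OF \<delta>]
      by (intro frob_diagonalized[OF V]) auto
    finally show "frob (site_op p fB * tensor z) \<le> 1" using 1 Pc[OF p] by simp
  qed auto
  finally have "frob ((?H - ?M) * tensor z) \<le> sqrt (\<Sum>p\<in>P. (s p)\<^sup>2)"
    by (simp add: real_le_rsqrt)
  moreover have "(?G - ?M) * tensor z = (?G - ?H) * tensor z + (?H - ?M) * tensor z"
    by (intro minus_split_mult[of _ ?D]) simp_all
  moreover have "frob ((?G - ?H) * tensor z + (?H - ?M) * tensor z)
      \<le> frob ((?G - ?H) * tensor z) + frob ((?H - ?M) * tensor z)"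
    by (rule frob_triangle[of _ ?D ?D]) auto
  ultimately show ?thesis using 2 by simp
qed

end

section \<open>Trace distance\<close>

text \<open>Columns of \<open>A * X\<close> are combinations of columns of \<open>A\<close>, so the
  column spaces are nested.\<close>

lemma (in vec_space) rank_mult_le:
  assumes A: "A \<in> carrier_mat n n" and X: "X \<in> carrier_mat n n"
  shows "rank (A * X) \<le> rank A"
proof -
  let ?C = "span (set (cols (A * X)))" and ?W = "span (set (cols A))"
  have AX: "A * X \<in> carrier_mat n n" using A X by (rule mult_carrier_mat)
  have sub: "set (cols (A * X)) \<subseteq> ?W"
  proof
    fix y assume "y \<in> set (cols (A * X))"
    then obtain j where j: "j < n" "y = col (A * X) j" using AX by (auto simp: cols_def)
    then have "y = A *\<^sub>v col X j" using col_mult2[OF A X j(1)] by simp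
    moreover have "col X j \<in> carrier_vec n" using X j by simp
    ultimately have "y \<in> col_space A" unfolding col_space_eq[OF A] using A by auto
    then show "y \<in> ?W" by (simp add: col_space_def)
  qed
  have cA: "set (cols A) \<subseteq> carrier_vec n" and cAX: "set (cols (A * X)) \<subseteq> carrier_vec n"
    using A AX cols_dim by (metis carrier_matD(1))+
  have W: "VectorSpace.subspace class_ring ?W V" and C: "VectorSpace.subspace class_ring ?C V"
    using cA cAX by (simp_all add: span_is_subspace)
  have CW: "?C \<subseteq> ?W" using sub span_is_subset[OF sub] W by (simp add: VectorSpace.subspace_def)
  show ?thesis unfolding rank_def
    using vectorspace.subspace_dim[OF subspace_is_vs[OF W] nested_subspaces[OF W C CW]]
      fin_dim_span_cols[OF A] fin_dim_span_cols[OF AX] by simp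
qed

lemma unitary_mat_col_indpt:
  assumes V: "unitary_mat n V"
  shows "distinct (cols V)" "\<not> module.lin_dep class_ring (module_vec TYPE(complex) n) (set (cols V))"
proof -
  interpret vec_space "TYPE(complex)" n .
  have Vc: "V \<in> carrier_mat n n" using V by (rule unitary_carrier)
  have "det (mat_adjoint V) * det V = 1"
    using V Vc det_mult[of "mat_adjoint V" n V] by (simp add: unitary_mat_def)
  then have r: "rank V = n" using low_rank_det_zero[OF Vc] by fastforce
  then show dist: "distinct (cols V)" using non_distinct_low_rank[OF Vc] by fastforce
  show "\<not> module.lin_dep class_ring (module_vec TYPE(complex) n) (set (cols V))"
    by (rule full_rank_lin_indpt[OF Vc r dist])
qed

text \<open>\<open>X\<close> inverts \<open>f\<close> on its support, so the columns of
  \<open>diagonalized n V f * X\<close> include the eigenvectors of all nonzero eigenvalues. These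
  are independent, and right multiplication does not raise the rank.\<close>

lemma card_nonzero_le_rank:
  assumes V: "unitary_mat n V"
  shows "card {j. j < n \<and> f j \<noteq> 0} \<le> vec_space.rank n (diagonalized n V f)"
proof -
  interpret vec_space "TYPE(complex)" n .
  let ?J = "{j. j < n \<and> f j \<noteq> 0}"
  have Vc: "V \<in> carrier_mat n n" using V by (rule unitary_carrier)
  define X where "X = V * mat_diag n (\<lambda>j. if f j = 0 then 0 else 1 / f j)"
  have X: "X \<in> carrier_mat n n" unfolding X_def using Vc by simp
  have e: "diagonalized n V f * X = V * mat_diag n (\<lambda>j. if f j = 0 then 0 else 1)"
  proof -
    have "mat_adjoint V * X = mat_diag n (\<lambda>j. if f j = 0 then 0 else 1 / f j)"
      unfolding X_def using V Vc
      by (simp add: sq_assoc[of _ n, symmetric] unitary_mat_def left_mult_one_mat[OF mat_diag_dim])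
    then show ?thesis unfolding diagonalized_mult_assoc[OF Vc X]
      by (simp add: if_distrib[of "\<lambda>u. f _ * u"] cong: if_cong)
  qed
  have P: "V * mat_diag n (\<lambda>j. if f j = 0 then 0 else 1) \<in> carrier_mat n n" using Vc by simp
  have colV: "col (V * mat_diag n (\<lambda>j. if f j = 0 then 0 else 1)) j = col V j" if "j \<in> ?J" for j
    using that Vc by (auto simp: mat_diag_mult_right[OF Vc] intro!: eq_vecI)
  have sub: "col V ` ?J \<subseteq> set (cols (V * mat_diag n (\<lambda>j. if f j = 0 then 0 else 1)))"
  proof
    fix y assume "y \<in> col V ` ?J"
    then obtain j where j: "j \<in> ?J" "y = col (V * mat_diag n (\<lambda>j. if f j = 0 then 0 else 1)) j"
      using colV by auto
    then show "y \<in> set (cols (V * mat_diag n (\<lambda>j. if f j = 0 then 0 else 1)))"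
      using carrier_matD[OF P] by (auto simp: cols_def)
  qed
  have "inj_on (col V) ?J"
    using unitary_mat_col_indpt(1)[OF V] Vc by (auto simp: inj_on_def distinct_conv_nth)
  then have "card ?J = card (col V ` ?J)" by (simp add: card_image)
  also have "\<dots> \<le> rank (V * mat_diag n (\<lambda>j. if f j = 0 then 0 else 1))"
  proof (rule rank_ge_card_indpt[OF P sub])
    have "col V ` ?J \<subseteq> set (cols V)" using Vc by (auto simp: cols_def)
    then show "lin_indpt (col V ` ?J)" using unitary_mat_col_indpt(2)[OF V] subset_li_is_li by blast
  qed
  also have "\<dots> \<le> rank (diagonalized n V f)"
    unfolding e[symmetric] by (rule rank_mult_le[OF diagonalized_carrier[OF Vc] X])
  finally show ?thesis .
qed

lemma rank_diff_le:
  fixes A B :: "complex mat"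
  assumes "A \<in> carrier_mat n n" "B \<in> carrier_mat n n"
  shows "vec_space.rank n (A - B) \<le> vec_space.rank n A + vec_space.rank n B"
proof -
  interpret vec_space "TYPE(complex)" n .
  have m: "B * ((-1) \<cdot>\<^sub>m 1\<^sub>m n) \<in> carrier_mat n n" using assms by simp
  \<comment> \<open>The sign becomes a right factor, which \<open>rank_mult_le\<close> disposes
    of.\<close>
  have "A - B = A + B * ((-1) \<cdot>\<^sub>m 1\<^sub>m n)"
    using assms by (intro eq_matI) (auto simp: mult_smult_distrib[of _ n n] right_mult_one_mat[of _ n n])
  then show ?thesis
    using rank_subadditive[OF assms(1) m] rank_mult_le[OF assms(2), of "(-1) \<cdot>\<^sub>m 1\<^sub>m n"] by simp
qed

section \<open>Quadratic forms, positivity and the absolute value\<close>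

lemma quadratic_form:
  fixes A :: "complex mat"
  assumes "A \<in> carrier_mat n n" "v \<in> carrier_vec n"
  shows "conjugate v \<bullet> (A *\<^sub>v v) = (\<Sum>x<n. \<Sum>y<n. cnj (v $ x) * A $$ (x, y) * v $ y)"
  using assms
  by (auto simp: scalar_prod_def atLeast0LessThan sum_distrib_left mult_ac conjugate_complex_def intro!: sum.cong)

lemma quadratic_form_col:
  fixes A :: "complex mat"
  assumes A: "A \<in> carrier_mat n n" and V: "V \<in> carrier_mat n n" and j: "j < n"
  shows "conjugate (col V j) \<bullet> (A *\<^sub>v col V j) = (mat_adjoint V * A * V) $$ (j, j)"
proof -
  have "mat_adjoint V * A * V = mat_adjoint V * (A * V)"
    using A V by (intro sq_assoc[of _ n]) simp_all
  also have "\<dots> $$ (j, j) = (\<Sum>x<n. mat_adjoint V $$ (j, x) * (A * V) $$ (x, j))"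
    using A V j by (intro mult_index[of _ n n _ n]) simp_all
  also have "\<dots> = (\<Sum>x<n. cnj (V $$ (x, j)) * (\<Sum>y<n. A $$ (x, y) * V $$ (y, j)))"
    using A V j by (intro sum.cong refl)
      (simp add: mult_index[of _ n n _ n] adj_index'[of _ n n] del: index_mult_mat(1) adj_index)
  finally show ?thesis
    using V j by (subst quadratic_form[OF A]) (simp_all add: sum_distrib_left mult_ac)
qed

lemma diagonalized_conj:
  assumes V: "unitary_mat n V"
  shows "mat_adjoint V * diagonalized n V f * V = mat_diag n f"
proof -
  have Vc: "V \<in> carrier_mat n n" "mat_adjoint V * V = 1\<^sub>m n" using V by (auto simp: unitary_mat_def)
  have "diagonalized n V f * V = V * mat_diag n f"
    unfolding diagonalized_mult_assoc[OF Vc(1) Vc(1)] Vc(2) by (simp add: right_mult_one_mat[OF mat_diag_dim])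
  then have "mat_adjoint V * diagonalized n V f * V = mat_adjoint V * (V * mat_diag n f)"
    using Vc by (simp add: sq_assoc[of _ n])
  also have "\<dots> = mat_diag n f"
    using Vc by (simp add: sq_assoc[of _ n, symmetric] left_mult_one_mat[OF mat_diag_dim])
  finally show ?thesis .
qed

text \<open>In the coordinates \<open>q j\<close> of \<open>v\<close> along the columns of
  \<open>V\<close>, the form is the sum of f j |q j|^2.\<close>

lemma psd_diagonalized:
  assumes V: "V \<in> carrier_mat n n" and f: "\<And>j. j < n \<Longrightarrow> 0 \<le> f j"
  shows "psd_mat (diagonalized n V (\<lambda>j. of_real (f j)))"
proof -
  let ?A = "diagonalized n V (\<lambda>j. of_real (f j))"
  have "0 \<le> Re (conjugate v \<bullet> (?A *\<^sub>v v))" if v: "v \<in> carrier_vec n" for v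
  proof -
    define q where "q j = (\<Sum>y<n. cnj (V $$ (y, j)) * v $ y)" for j
    have "conjugate v \<bullet> (?A *\<^sub>v v) = (\<Sum>x<n. \<Sum>y<n. \<Sum>j<n. of_real (f j) *
        ((cnj (v $ x) * V $$ (x, j)) * (cnj (V $$ (y, j)) * v $ y)))"
      unfolding quadratic_form[OF diagonalized_carrier[OF V] v]
      by (intro sum.cong refl) (simp add: diagonalized_index[OF V] sum_distrib_left sum_distrib_right mult_ac)
    also have "\<dots> = (\<Sum>x<n. \<Sum>j<n. \<Sum>y<n. of_real (f j) *
        ((cnj (v $ x) * V $$ (x, j)) * (cnj (V $$ (y, j)) * v $ y)))"
      by (intro sum.cong refl sum.swap)
    also have "\<dots> = (\<Sum>j<n. \<Sum>x<n. \<Sum>y<n. of_real (f j) *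
        ((cnj (v $ x) * V $$ (x, j)) * (cnj (V $$ (y, j)) * v $ y)))"
      by (rule sum.swap)
    also have "\<dots> = (\<Sum>j<n. of_real (f j) * (cnj (q j) * q j))"
    proof (intro sum.cong refl)
      fix j
      have "cnj (q j) * q j = (\<Sum>x<n. \<Sum>y<n. (cnj (v $ x) * V $$ (x, j)) * (cnj (V $$ (y, j)) * v $ y))"
        unfolding q_def cnj_sum sum_product by (simp add: mult_ac)
      then show "(\<Sum>x<n. \<Sum>y<n. of_real (f j) * ((cnj (v $ x) * V $$ (x, j)) * (cnj (V $$ (y, j)) * v $ y)))
        = of_real (f j) * (cnj (q j) * q j)"
        by (simp only: sum_distrib_left)
    qed
    also have "\<dots> = (\<Sum>j<n. of_real (f j * (cmod (q j))\<^sup>2))"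
      by (intro sum.cong refl) (simp only: of_real_mult complex_norm_square mult.commute)
    also have "\<dots> = of_real (\<Sum>j<n. f j * (cmod (q j))\<^sup>2)" by (rule of_real_sum[symmetric])
    finally have e: "conjugate v \<bullet> (?A *\<^sub>v v) = of_real (\<Sum>j<n. f j * (cmod (q j))\<^sup>2)" .
    show ?thesis unfolding e Re_complex_of_real using f by (intro sum_nonneg mult_nonneg_nonneg) auto
  qed
  then show ?thesis
    unfolding psd_mat_def using V by (auto simp: diagonalized_adj[OF V] carrier_matD[OF V])
qed

lemma psd_quadratic_form:
  "psd_mat A \<Longrightarrow> A \<in> carrier_mat n n \<Longrightarrow> v \<in> carrier_vec n \<Longrightarrow> 0 \<le> Re (conjugate v \<bullet> (A *\<^sub>v v))"
  unfolding psd_mat_def by (metis carrier_matD(1))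

lemma psd_diagonalization:
  assumes A: "A \<in> carrier_mat n n" and psd: "psd_mat A"
  obtains V l where "unitary_mat n V" "A = diagonalized n V (\<lambda>j. of_real (l j))" "\<And>j. j < n \<Longrightarrow> 0 \<le> l j"
proof -
  have "mat_adjoint A = A" using psd unfolding psd_mat_def by simp
  from hermitian_diagonalization[OF A this] obtain V and l :: "nat \<Rightarrow> real" where
    V: "unitary_mat n V" and AV: "A = diagonalized n V (\<lambda>j. of_real (l j))" by blast
  have "0 \<le> l j" if j: "j < n" for j
  proof -
    have Vc: "V \<in> carrier_mat n n" using V by (rule unitary_carrier)
    have "0 \<le> Re (conjugate (col V j) \<bullet> (A *\<^sub>v col V j))"
      using Vc by (intro psd_quadratic_form[OF psd A]) auto
    then show ?thesis
      unfolding quadratic_form_col[OF A Vc j] unfolding AV diagonalized_conj[OF V]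
      using j by (simp add: mat_diag_def)
  qed
  then show ?thesis using that V AV by blast
qed

text \<open>Functional calculus does not depend on the chosen eigenbasis; this gives uniqueness of positive
  square roots.\<close>

lemma diagonalized_function_cong:
  assumes V: "unitary_mat n V" and W: "unitary_mat n W" and e: "diagonalized n V f = diagonalized n W g"
  shows "diagonalized n V (\<lambda>j. h (f j)) = diagonalized n W (\<lambda>j. h (g j))"
proof -
  have Vc: "V \<in> carrier_mat n n" and Wc: "W \<in> carrier_mat n n" using V W by (auto simp: unitary_mat_def)
  define X where "X = mat_adjoint V * W"
  have X: "X \<in> carrier_mat n n" unfolding X_def using Vc Wc by simp
  have eq: "mat_adjoint V * diagonalized n V F * W = mat_diag n F * X" for F
  proof -
    have FX: "mat_diag n F * X \<in> carrier_mat n n" using X by simp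
    have "mat_adjoint V * diagonalized n V F * W = mat_adjoint V * (diagonalized n V F * W)"
      using Vc Wc by (intro sq_assoc[of _ n]) simp_all
    also have "\<dots> = mat_adjoint V * (V * (mat_diag n F * X))"
      unfolding diagonalized_mult_assoc[OF Vc Wc] X_def ..
    also have "\<dots> = mat_adjoint V * V * (mat_diag n F * X)"
      using Vc FX by (intro sq_assoc[of _ n, symmetric]) simp_all
    also have "\<dots> = mat_diag n F * X" using V left_mult_one_mat[OF FX] by (simp add: unitary_mat_def)
    finally show ?thesis .
  qed
  have eq': "mat_adjoint V * diagonalized n W F * W = X * mat_diag n F" for F
  proof -
    have "diagonalized n W F * W = W * mat_diag n F"
      unfolding diagonalized_mult_assoc[OF Wc Wc] using W
      by (simp add: unitary_mat_def right_mult_one_mat[OF mat_diag_dim])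
    then show ?thesis unfolding X_def using Vc Wc by (simp add: sq_assoc[of _ n])
  qed
  \<comment> \<open>\<open>X\<close> intertwines the two spectra: its entry at (i, j) vanishes
    unless f i = g j. The same relation then holds after applying \<open>h\<close> to both
    sides.\<close>
  have comm: "mat_diag n f * X = X * mat_diag n g" using eq[of f] eq'[of g] e by simp
  have *: "f i * X $$ (i, j) = X $$ (i, j) * g j" if ij: "i < n" "j < n" for i j
  proof -
    have "(mat_diag n f * X) $$ (i, j) = (X * mat_diag n g) $$ (i, j)" by (simp only: comm)
    then show ?thesis unfolding mat_diag_mult_left[OF X] mat_diag_mult_right[OF X] using ij by simp
  qed
  have "mat_diag n (\<lambda>j. h (f j)) * X = X * mat_diag n (\<lambda>j. h (g j))"
    unfolding mat_diag_mult_left[OF X] mat_diag_mult_right[OF X]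
  proof (intro cong_mat refl, clarify)
    fix i j assume ij: "i < n" "j < n"
    show "h (f i) * X $$ (i, j) = X $$ (i, j) * h (g j)"
      using *[OF ij] by (cases "X $$ (i, j) = 0") auto
  qed
  then have "mat_adjoint V * diagonalized n V (\<lambda>j. h (f j)) * W = mat_adjoint V * diagonalized n W (\<lambda>j. h (g j)) * W"
    unfolding eq eq' .
  then have "V * (mat_adjoint V * diagonalized n V (\<lambda>j. h (f j)) * W) * mat_adjoint W
    = V * (mat_adjoint V * diagonalized n W (\<lambda>j. h (g j)) * W) * mat_adjoint W" by simp
  moreover have "V * (mat_adjoint V * M * W) * mat_adjoint W = M" if M: "M \<in> carrier_mat n n" for M
  proof -
    have "V * (mat_adjoint V * M * W) * mat_adjoint W = (V * mat_adjoint V) * M * (W * mat_adjoint W)"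
      using Vc Wc M by (simp add: sq_assoc[of _ n])
    then show ?thesis using M by (simp add: unitary_right[OF V] unitary_right[OF W])
  qed
  ultimately show ?thesis using Vc Wc by simp
qed

lemma diagonalized_cong: "(\<And>j. j < n \<Longrightarrow> f j = g j) \<Longrightarrow> diagonalized n U f = diagonalized n U g"
  unfolding diagonalized_def mat_diag_def
  by (rule arg_cong[of _ _ "\<lambda>M. U * M * mat_adjoint U"], rule cong_mat) auto

text \<open>\<open>abs_mat\<close> is a definite description, so uniqueness is needed besides a
  candidate. A competing positive root is diagonalized too, its square has the same spectral data,
  and taking real square roots on both sides identifies it.\<close>

lemma abs_mat_diagonalized:
  fixes b :: "nat \<Rightarrow> real"
  assumes V: "unitary_mat n V"
  shows "abs_mat (diagonalized n V (\<lambda>j. of_real (b j))) = diagonalized n V (\<lambda>j. of_real \<bar>b j\<bar>)"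
proof -
  have Vc: "V \<in> carrier_mat n n" using V by (rule unitary_carrier)
  let ?B = "diagonalized n V (\<lambda>j. of_real (b j))" and ?A = "diagonalized n V (\<lambda>j. of_real \<bar>b j\<bar>)"
  have sq: "mat_adjoint ?B * ?B = diagonalized n V (\<lambda>j. of_real ((b j)\<^sup>2))"
    by (simp add: diagonalized_adj[OF Vc] diagonalized_mult[OF V] power2_eq_square)
  show ?thesis unfolding abs_mat_def sq
  proof (rule the_equality)
    show "psd_mat ?A \<and> ?A * ?A = diagonalized n V (\<lambda>j. of_real ((b j)\<^sup>2))"
      using psd_diagonalized[OF Vc, of "\<lambda>j. \<bar>b j\<bar>"]
      by (simp only: diagonalized_mult[OF V] of_real_mult[symmetric] abs_mult_self_eq power2_eq_square simp_thms)
  next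
    fix C assume C: "psd_mat C \<and> C * C = diagonalized n V (\<lambda>j. of_real ((b j)\<^sup>2))"
    \<comment> \<open>The description leaves the size of the root open; it is recovered from
      \<open>C * C\<close>.\<close>
    then have "dim_row C = n" using Vc by (metis carrier_matD(1) diagonalized_carrier index_mult_mat(2))
    then have Cc: "C \<in> carrier_mat n n" using C unfolding psd_mat_def by simp
    obtain W c where W: "unitary_mat n W" and CW: "C = diagonalized n W (\<lambda>j. of_real (c j))"
      and c: "\<And>j. j < n \<Longrightarrow> 0 \<le> c j" using psd_diagonalization[OF Cc] C by blast
    have "diagonalized n W (\<lambda>j. of_real ((c j)\<^sup>2)) = diagonalized n V (\<lambda>j. of_real ((b j)\<^sup>2))"
      using C unfolding CW by (simp add: diagonalized_mult[OF W] power2_eq_square)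
    \<comment> \<open>The functional calculus takes complex arguments, so the root is applied to the
      real part.\<close>
    from diagonalized_function_cong[OF W V this, of "\<lambda>x. of_real (sqrt (Re x))"]
    have "diagonalized n W (\<lambda>j. of_real \<bar>c j\<bar>) = ?A" by simp
    moreover have "diagonalized n W (\<lambda>j. of_real \<bar>c j\<bar>) = C"
      unfolding CW using c by (intro diagonalized_cong) simp
    ultimately show "C = ?A" by simp
  qed
qed

lemma trace_dist_diagonalized:
  fixes b :: "nat \<Rightarrow> real"
  assumes "unitary_mat n V" "\<rho> - \<sigma> = diagonalized n V (\<lambda>j. of_real (b j))"
  shows "trace_dist \<rho> \<sigma> = (\<Sum>j<n. \<bar>b j\<bar>) / 2"
  unfolding trace_dist_def assms(2) abs_mat_diagonalized[OF assms(1)] diagonalized_trace[OF assms(1)]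
  by simp

text \<open>Positivity makes the diagonal nonnegative in every orthonormal basis and cyclicity of
  the trace gives it sum 1, so it is a probability vector.\<close>

lemma density_expectation_bounds:
  assumes \<rho>: "density_mat n \<rho>" and V: "unitary_mat n V" and j: "j < n"
  shows "0 \<le> Re ((mat_adjoint V * \<rho> * V) $$ (j, j))" "Re ((mat_adjoint V * \<rho> * V) $$ (j, j)) \<le> 1"
proof -
  have Vc: "V \<in> carrier_mat n n" using V by (rule unitary_carrier)
  have \<rho>c: "\<rho> \<in> carrier_mat n n" and psd: "psd_mat \<rho>" and tr: "mat_trace \<rho> = 1"
    using \<rho> by (auto simp: density_mat_def)
  have 0: "0 \<le> Re ((mat_adjoint V * \<rho> * V) $$ (i, i))" if "i < n" for i
    using psd_quadratic_form[OF psd \<rho>c col_carrier_vec[OF that Vc]] quadratic_form_col[OF \<rho>c Vc that] by simp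
  have "mat_trace (mat_adjoint V * \<rho> * V) = mat_trace (V * (mat_adjoint V * \<rho>))"
    using Vc \<rho>c by (intro mat_trace_comm[of _ n n]) simp_all
  also have "V * (mat_adjoint V * \<rho>) = \<rho>"
    using Vc \<rho>c unitary_right[OF V] by (simp add: sq_assoc[of _ n, symmetric])
  finally have "(\<Sum>i<n. Re ((mat_adjoint V * \<rho> * V) $$ (i, i))) = 1"
    using Vc \<rho>c tr unfolding mat_trace_def by (simp flip: Re_sum)
  then show "Re ((mat_adjoint V * \<rho> * V) $$ (j, j)) \<le> 1"
    using member_le_sum[of j "{..<n}" "\<lambda>i. Re ((mat_adjoint V * \<rho> * V) $$ (i, i))"] 0 j by simp
  show "0 \<le> Re ((mat_adjoint V * \<rho> * V) $$ (j, j))" using 0 j by simp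
qed

text \<open>An eigenvalue of the difference is a difference of two probabilities. This puts the
  spectrum in the interval on which \<open>smooth_sgn_approx\<close> is available.\<close>

lemma density_diff_eigenvalue_bound:
  fixes b :: "nat \<Rightarrow> real"
  assumes "density_mat n \<rho>" "density_mat n \<sigma>" and V: "unitary_mat n V"
    and b: "\<rho> - \<sigma> = diagonalized n V (\<lambda>j. of_real (b j))" and j: "j < n"
  shows "\<bar>b j\<bar> \<le> 1"
proof -
  have Vc: "V \<in> carrier_mat n n" using V by (rule unitary_carrier)
  have c: "\<rho> \<in> carrier_mat n n" "\<sigma> \<in> carrier_mat n n" using assms by (auto simp: density_mat_def)
  have "mat_adjoint V * (\<rho> - \<sigma>) * V = mat_adjoint V * \<rho> * V - mat_adjoint V * \<sigma> * V"
    using c Vc by (simp add: mult_minus_distrib_mat[of _ n n _ n] minus_mult_sq[of _ n])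
  then have "mat_diag n (\<lambda>j. complex_of_real (b j)) = mat_adjoint V * \<rho> * V - mat_adjoint V * \<sigma> * V"
    unfolding b diagonalized_conj[OF V] .
  then have "mat_diag n (\<lambda>j. complex_of_real (b j)) $$ (j, j) =
      (mat_adjoint V * \<rho> * V) $$ (j, j) - (mat_adjoint V * \<sigma> * V) $$ (j, j)"
    using c Vc j by (simp del: index_mult_mat(1))
  then have "complex_of_real (b j) = (mat_adjoint V * \<rho> * V) $$ (j, j) - (mat_adjoint V * \<sigma> * V) $$ (j, j)"
    using j by (simp add: mat_diag_def)
  then have "b j = Re ((mat_adjoint V * \<rho> * V) $$ (j, j)) - Re ((mat_adjoint V * \<sigma> * V) $$ (j, j))"
    by (metis Re_complex_of_real minus_complex.sel(1))
  then show ?thesis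
    using density_expectation_bounds[OF assms(1) V j] density_expectation_bounds[OF assms(2) V j] by linarith
qed

text \<open>The positive square root serves as a purification, and its squared norm is the trace of
  the state.\<close>

lemma density_sqrt:
  assumes \<rho>: "density_mat n \<rho>"
  obtains Y where "Y \<in> carrier_mat n n" "Y * mat_adjoint Y = \<rho>" "frob Y = 1"
proof -
  have \<rho>c: "\<rho> \<in> carrier_mat n n" and psd: "psd_mat \<rho>" and tr: "mat_trace \<rho> = 1"
    using \<rho> by (auto simp: density_mat_def)
  obtain W l where W: "unitary_mat n W" and l: "\<rho> = diagonalized n W (\<lambda>j. of_real (l j))" "\<And>j. j < n \<Longrightarrow> 0 \<le> l j"
    using psd_diagonalization[OF \<rho>c psd] by metis
  have Wc: "W \<in> carrier_mat n n" using W by (rule unitary_carrier)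
  define Y where "Y = diagonalized n W (\<lambda>j. of_real (sqrt (l j)))"
  have Y: "Y \<in> carrier_mat n n" unfolding Y_def using Wc by simp
  have "Y * mat_adjoint Y = \<rho>"
  proof -
    have "Y * mat_adjoint Y = diagonalized n W (\<lambda>j. of_real (sqrt (l j) * sqrt (l j)))"
      unfolding Y_def diagonalized_adj[OF Wc] diagonalized_mult[OF W]
      by (simp only: complex_cnj_complex_of_real of_real_mult)
    also have "\<dots> = \<rho>" unfolding l(1) by (intro diagonalized_cong) (simp only: real_sqrt_mult_self abs_of_nonneg[OF l(2)])
    finally show ?thesis .
  qed
  moreover have "frob Y = 1"
  proof -
    have "complex_of_real ((frob Y)\<^sup>2) = mat_trace (Y * mat_adjoint Y)"
      unfolding frob_inner_self[symmetric] frob_inner_trace[OF Y Y]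
      using Y by (intro mat_trace_comm[of _ n n]) simp_all
    also have "\<dots> = 1" using \<open>Y * mat_adjoint Y = \<rho>\<close> tr by simp
    finally have "(frob Y)\<^sup>2 = 1" by (metis of_real_eq_1_iff)
    then show ?thesis using frob_nonneg[of Y] by (simp add: power2_eq_1_iff)
  qed
  ultimately show ?thesis using that Y by blast
qed

section \<open>Measurement\<close>

text \<open>Kronecker indices split as quotient and remainder modulo d^b. The quotient holds the
  high digits, so the first factor occupies the sites from \<open>b\<close> upwards.\<close>

lemma tensor_mat_tensor:
  assumes d: "d > 0"
  shows "tensor_mat (tensor_sites.tensor d a w) (tensor_sites.tensor d b v) =
    tensor_sites.tensor d (a + b) (\<lambda>j. if j < b then v j else w (j - b))"
proof (rule mat_eqI)
  note idx = tensor_sites.tensor_index and dg = tensor_sites.digit_def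
  fix x y assume xy: "x < d ^ (a + b)" "y < d ^ (a + b)"
  have lo: "tensor_sites.digit d j (u mod d ^ b) = tensor_sites.digit d j u" if "j < b" for j u
  proof -
    \<comment> \<open>For j < b the second power is divisible by \<open>d\<close>, so reduction
      modulo d^b does not change digit \<open>j\<close>.\<close>
    have e: "d ^ b = d ^ j * d ^ (b - j)" using that by (simp flip: power_add)
    have "d dvd d ^ (b - j)" using that by (simp add: dvd_power)
    then show ?thesis
      unfolding dg e mod_mult2_eq using d by (simp add: mod_mod_cancel)
  qed
  have hi: "tensor_sites.digit d j (u div d ^ b) = tensor_sites.digit d (b + j) u" for j u
    unfolding dg by (simp add: div_mult2_eq power_add)
  have dv: "u div d ^ b < d ^ a" "u mod d ^ b < d ^ b" if "u < d ^ (a + b)" for u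
    using that d by (simp_all add: less_mult_imp_div_less power_add)
  have "tensor_mat (tensor_sites.tensor d a w) (tensor_sites.tensor d b v) $$ (x, y) =
    tensor_sites.tensor d a w $$ (x div d ^ b, y div d ^ b) * tensor_sites.tensor d b v $$ (x mod d ^ b, y mod d ^ b)"
    using xy by (simp add: tensor_mat_def tensor_sites.tensor_dim power_add)
  also have "\<dots> = (\<Prod>j<a. w j $$ (tensor_sites.digit d (b + j) x, tensor_sites.digit d (b + j) y)) *
      (\<Prod>j<b. v j $$ (tensor_sites.digit d j x, tensor_sites.digit d j y))"
    using xy dv by (simp add: idx hi lo)
  also have "\<dots> = (\<Prod>j<b + a. (if j < b then v j else w (j - b)) $$ (tensor_sites.digit d j x, tensor_sites.digit d j y))"
    unfolding lessThan_atLeast0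
    by (subst prod.atLeastLessThan_concat[of 0 b "b + a", symmetric])
       (simp_all add: mult.commute prod.atLeastLessThan_shift_0[of _ b "b + a"])
  finally show "tensor_mat (tensor_sites.tensor d a w) (tensor_sites.tensor d b v) $$ (x, y) =
    tensor_sites.tensor d (a + b) (\<lambda>j. if j < b then v j else w (j - b)) $$ (x, y)"
    using xy by (simp add: idx add.commute)
qed (auto simp: tensor_mat_def tensor_sites.tensor_dim power_add intro: tensor_sites.tensor_carrier)

lemma tensor_pow_tensor:
  assumes d: "d > 0" and A: "A \<in> carrier_mat d d"
  shows "tensor_pow A n = tensor_sites.tensor d n (\<lambda>_. A)"
proof (induction n)
  case 0
  show ?case by (rule mat_eqI[of _ 1 1]) (auto simp: tensor_sites.tensor_def)
next
  case (Suc n)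
  have "A = tensor_sites.tensor d 1 (\<lambda>_. A)"
    using A d by (intro mat_eqI[of _ d d]) (auto simp: tensor_sites.tensor_def tensor_sites.digit_def)
  then have "tensor_pow A (Suc n) = tensor_mat (tensor_sites.tensor d 1 (\<lambda>_. A)) (tensor_sites.tensor d n (\<lambda>_. A))"
    using Suc by simp
  then show ?case unfolding tensor_mat_tensor[OF d] by simp
qed

section \<open>Measuring an observable in its eigenbasis\<close>

definition eigenprojection :: "nat \<Rightarrow> complex mat \<Rightarrow> nat \<Rightarrow> complex mat" where
  "eigenprojection n U i = diagonalized n U (\<lambda>j. of_real (if j = i then 1 else 0))"

lemma povm_eigenprojection:
  assumes U: "unitary_mat n U"
  shows "povm n n (eigenprojection n U)"
proof -
  have Uc: "U \<in> carrier_mat n n" using U by (rule unitary_carrier)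
  have "(\<Sum>i<n. eigenprojection n U i $$ (x, y)) = 1\<^sub>m n $$ (x, y)" if "x < n" "y < n" for x y
  proof -
    have "(\<Sum>i<n. eigenprojection n U i $$ (x, y)) =
      (\<Sum>i<n. \<Sum>j<n. if j = i then U $$ (x, j) * cnj (U $$ (y, j)) else 0)"
      unfolding eigenprojection_def diagonalized_index[OF Uc that] by (intro sum.cong refl) simp
    also have "\<dots> = diagonalized n U (\<lambda>_. 1) $$ (x, y)"
      using Uc that by (simp add: diagonalized_index)
    finally show ?thesis using diagonalized_one[OF U] by simp
  qed
  then show ?thesis
    unfolding povm_def eigenprojection_def using Uc psd_diagonalized[OF Uc, of "\<lambda>j. if j = _ then 1 else 0"] by simp
qed

text \<open>For normalized \<open>\<Psi>\<close> the squared row norms of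
  \<open>mat_adjoint U * \<Psi>\<close> are the outcome probabilities, and the formula is the second
  moment of |f| under them.\<close>

lemma frob_diagonalized_sq:
  assumes U: "unitary_mat n U" and \<Psi>: "\<Psi> \<in> carrier_mat n n"
  shows "(frob (diagonalized n U f * \<Psi>))\<^sup>2 = (\<Sum>i<n. (cmod (f i))\<^sup>2 * (\<Sum>y<n. (cmod ((mat_adjoint U * \<Psi>) $$ (i, y)))\<^sup>2))"
proof -
  have Uc: "U \<in> carrier_mat n n" using U by (rule unitary_carrier)
  have UP: "mat_adjoint U * \<Psi> \<in> carrier_mat n n" using Uc \<Psi> by simp
  have "frob (diagonalized n U f * \<Psi>) = frob (mat_diag n f * (mat_adjoint U * \<Psi>))"
    unfolding diagonalized_mult_assoc[OF Uc \<Psi>]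
    by (rule frob_unitary[OF U mult_carrier_mat[OF mat_diag_dim UP]])
  then show ?thesis
    unfolding mat_diag_mult_left[OF UP] by (simp add: frob_sq norm_mult power_mult_distrib sum_distrib_left)
qed

text \<open>Cyclicity of the trace and idempotence of the projection turn the Born probability into
  a squared norm, to which only row \<open>i\<close> contributes.\<close>

lemma trace_projection_pure:
  assumes U: "unitary_mat n U" and \<Psi>: "\<Psi> \<in> carrier_mat n n" and i: "i < n"
  shows "mat_trace (eigenprojection n U i * (\<Psi> * mat_adjoint \<Psi>)) =
    of_real (\<Sum>y<n. (cmod ((mat_adjoint U * \<Psi>) $$ (i, y)))\<^sup>2)"
proof -
  have Uc: "U \<in> carrier_mat n n" using U by (rule unitary_carrier)
  let ?M = "eigenprojection n U i"
  have M: "?M \<in> carrier_mat n n" unfolding eigenprojection_def using Uc by simp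
  have Ma: "mat_adjoint ?M = ?M" unfolding eigenprojection_def diagonalized_adj[OF Uc] by simp
  have "of_real (if j = i then 1 else 0) * of_real (if j = i then 1 else 0) = complex_of_real (if j = i then 1 else 0)"
    for j by simp
  then have MM: "?M * ?M = ?M" unfolding eigenprojection_def diagonalized_mult[OF U] by (simp only:)
  have MP: "?M * \<Psi> \<in> carrier_mat n n" using M \<Psi> by simp
  have "?M * (\<Psi> * mat_adjoint \<Psi>) = ?M * \<Psi> * mat_adjoint \<Psi>"
    using M \<Psi> by (intro sq_assoc[of _ n, symmetric]) simp_all
  then have "mat_trace (?M * (\<Psi> * mat_adjoint \<Psi>)) = mat_trace (mat_adjoint \<Psi> * (?M * \<Psi>))"
    using MP \<Psi> by (simp add: mat_trace_comm[of _ n n])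
  also have "mat_adjoint \<Psi> * (?M * \<Psi>) = mat_adjoint (?M * \<Psi>) * (?M * \<Psi>)"
  proof -
    have "mat_adjoint (?M * \<Psi>) * (?M * \<Psi>) = mat_adjoint \<Psi> * ?M * (?M * \<Psi>)"
      using M \<Psi> by (simp add: adj_mult[of _ n n] Ma)
    also have "\<dots> = mat_adjoint \<Psi> * (?M * (?M * \<Psi>))"
      using M \<Psi> MP by (intro sq_assoc[of _ n]) simp_all
    also have "?M * (?M * \<Psi>) = ?M * ?M * \<Psi>"
      using M \<Psi> by (intro sq_assoc[of _ n, symmetric]) simp_all
    finally show ?thesis unfolding MM by simp
  qed
  also have "mat_trace \<dots> = of_real ((frob (?M * \<Psi>))\<^sup>2)"
    unfolding frob_inner_trace[OF MP MP, symmetric] frob_inner_self ..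
  also have "(frob (?M * \<Psi>))\<^sup>2 = (\<Sum>j<n. if j = i then (\<Sum>y<n. (cmod ((mat_adjoint U * \<Psi>) $$ (i, y)))\<^sup>2) else 0)"
    unfolding eigenprojection_def frob_diagonalized_sq[OF U \<Psi>] by (intro sum.cong) auto
  finally show ?thesis using i by simp
qed

text \<open>Chebyshev: \<open>dev\<close> bounds the second moment of g - \<mu> by (\<epsilon>/2)^2,
  so a deviation beyond \<epsilon> has probability at most 1/4. \<open>S\<close> may be larger than
  the interval around \<mu>, since success is judged against the trace distance.\<close>

lemma measurement_concentration:
  fixes g :: "nat \<Rightarrow> real"
  assumes U: "unitary_mat n U" and \<Psi>: "\<Psi> \<in> carrier_mat n n" "frob \<Psi> = 1" and \<epsilon>: "\<epsilon> > 0"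
    and dev: "frob ((diagonalized n U (\<lambda>j. of_real (g j)) - of_real \<mu> \<cdot>\<^sub>m 1\<^sub>m n) * \<Psi>) \<le> \<epsilon> / 2"
    and S: "S \<subseteq> {..<n}" "\<And>i. i < n \<Longrightarrow> \<bar>g i - \<mu>\<bar> \<le> \<epsilon> \<Longrightarrow> i \<in> S"
  shows "3 / 4 \<le> meas_prob (eigenprojection n U) S (\<Psi> * mat_adjoint \<Psi>)"
proof -
  have Uc: "U \<in> carrier_mat n n" using U by (rule unitary_carrier)
  define q where "q i = (\<Sum>y<n. (cmod ((mat_adjoint U * \<Psi>) $$ (i, y)))\<^sup>2)" for i
  have q0: "0 \<le> q i" for i unfolding q_def by (intro sum_nonneg) simp
  have mp: "meas_prob (eigenprojection n U) S (\<Psi> * mat_adjoint \<Psi>) = sum q S"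
    unfolding meas_prob_def using S(1)
    by (intro sum.cong refl) (auto simp: trace_projection_pure[OF U \<Psi>(1)] q_def)
  have "(frob (diagonalized n U (\<lambda>_. 1) * \<Psi>))\<^sup>2 = sum q {..<n}"
    unfolding frob_diagonalized_sq[OF U \<Psi>(1)] q_def by simp
  then have total: "sum q {..<n} = 1"
    using \<Psi> by (simp add: diagonalized_one[OF U] left_mult_one_mat[of _ n n])
  have "diagonalized n U (\<lambda>j. of_real (g j)) - of_real \<mu> \<cdot>\<^sub>m 1\<^sub>m n = diagonalized n U (\<lambda>j. of_real (g j) - of_real \<mu> * 1)"
    unfolding diagonalized_minus[OF Uc] diagonalized_smult[OF Uc] diagonalized_one[OF U] ..
  then have "(frob ((diagonalized n U (\<lambda>j. of_real (g j)) - of_real \<mu> \<cdot>\<^sub>m 1\<^sub>m n) * \<Psi>))\<^sup>2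
    = (\<Sum>i<n. (cmod (of_real (g i) - of_real \<mu>))\<^sup>2 * q i)"
    by (simp add: frob_diagonalized_sq[OF U \<Psi>(1)] q_def)
  also have "\<dots> = (\<Sum>i<n. (g i - \<mu>)\<^sup>2 * q i)" by (simp flip: of_real_diff)
  finally have var: "(\<Sum>i<n. (g i - \<mu>)\<^sup>2 * q i) \<le> (\<epsilon> / 2)\<^sup>2"
    using power_mono[OF dev frob_nonneg, of 2] by simp
  have "\<epsilon>\<^sup>2 * sum q ({..<n} - S) = (\<Sum>i\<in>{..<n} - S. \<epsilon>\<^sup>2 * q i)" by (rule sum_distrib_left)
  also have "\<dots> \<le> (\<Sum>i\<in>{..<n} - S. (g i - \<mu>)\<^sup>2 * q i)"
  proof (intro sum_mono mult_right_mono q0)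
    fix i assume "i \<in> {..<n} - S"
    then have "\<epsilon> \<le> \<bar>g i - \<mu>\<bar>" using S(2)[of i] by force
    then show "\<epsilon>\<^sup>2 \<le> (g i - \<mu>)\<^sup>2" using \<epsilon> power_mono[of \<epsilon> "\<bar>g i - \<mu>\<bar>" 2] by simp
  qed
  also have "\<dots> \<le> (\<Sum>i<n. (g i - \<mu>)\<^sup>2 * q i)" using q0 by (intro sum_mono2) auto
  also have "\<dots> \<le> \<epsilon>\<^sup>2 * (1 / 4)" using var by (simp add: power_divide)
  finally have "sum q ({..<n} - S) \<le> 1 / 4" using \<epsilon> by simp
  then show ?thesis
    unfolding mp using total sum.subset_diff[OF S(1), of q] by simp
qed

section \<open>The estimator and its number of copies\<close>

lemma sum_two_blocks:
  fixes h :: "nat \<Rightarrow> 'a::comm_semiring_1"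
  assumes "p + n \<le> q" "\<And>i. p \<le> i \<Longrightarrow> i < p + n \<Longrightarrow> h i = u" "\<And>i. q \<le> i \<Longrightarrow> i < q + n \<Longrightarrow> h i = v"
  shows "(\<Sum>i\<in>{p..<p + n} \<union> {q..<q + n}. h i) = of_nat n * u + of_nat n * v"
proof -
  have "(\<Sum>i\<in>{p..<p + n} \<union> {q..<q + n}. h i) = (\<Sum>i\<in>{p..<p + n}. h i) + (\<Sum>i\<in>{q..<q + n}. h i)"
    using assms(1) by (intro sum.union_disjoint) auto
  also have "(\<Sum>i\<in>{p..<p + n}. h i) = (\<Sum>i\<in>{p..<p + n}. u)" using assms(2) by (intro sum.cong) auto
  also have "(\<Sum>i\<in>{q..<q + n}. h i) = (\<Sum>i\<in>{q..<q + n}. v)" using assms(3) by (intro sum.cong) auto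
  finally show ?thesis by simp
qed

text \<open>Vanishing eigenvalues cause no error, and the rank bound leaves at most 2 r others, each
  off by at most 2 \<delta>. The factor 1/2 in the trace distance reduces the total to 2 r
  \<delta>.\<close>

lemma smooth_trace_dist_approx:
  fixes b :: "nat \<Rightarrow> real"
  assumes \<rho>: "density_mat d \<rho>" "mat_rank d \<rho> = r" and \<sigma>: "density_mat d \<sigma>" "mat_rank d \<sigma> = r"
    and V: "unitary_mat d V" and b: "\<rho> - \<sigma> = diagonalized d V (\<lambda>j. of_real (b j))"
    and \<delta>: "\<delta> > 0" "1 \<le> real K * \<delta>\<^sup>2"
  shows "\<bar>(\<Sum>j<d. b j * smooth_sgn \<delta> K (b j)) / 2 - trace_dist \<rho> \<sigma>\<bar> \<le> 2 * real r * \<delta>"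
proof -
  let ?J = "{j. j < d \<and> complex_of_real (b j) \<noteq> 0}"
  have c: "\<rho> \<in> carrier_mat d d" "\<sigma> \<in> carrier_mat d d" using \<rho> \<sigma> by (auto simp: density_mat_def)
  have "card ?J \<le> vec_space.rank d (\<rho> - \<sigma>)" unfolding b by (rule card_nonzero_le_rank[OF V])
  also have "\<dots> \<le> 2 * r" using rank_diff_le[OF c] \<rho>(2) \<sigma>(2) by (simp add: mat_rank_def)
  finally have J: "card ?J \<le> 2 * r" .
  have "\<bar>(\<Sum>j<d. \<bar>b j\<bar>) - (\<Sum>j<d. b j * smooth_sgn \<delta> K (b j))\<bar> \<le> (\<Sum>j<d. \<bar>\<bar>b j\<bar> - b j * smooth_sgn \<delta> K (b j)\<bar>)"
    unfolding sum_subtractf[symmetric] by (rule sum_abs)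
  also have "\<dots> = (\<Sum>j\<in>?J. \<bar>\<bar>b j\<bar> - b j * smooth_sgn \<delta> K (b j)\<bar>)"
    by (intro sum.mono_neutral_right) auto
  also have "\<dots> \<le> (\<Sum>j\<in>?J. 2 * \<delta>)"
    using density_diff_eigenvalue_bound[OF \<rho>(1) \<sigma>(1) V b] \<delta> by (intro sum_mono smooth_sgn_approx) auto
  also have "\<dots> = real (card ?J) * (2 * \<delta>)" by simp
  also have "\<dots> \<le> real (2 * r) * (2 * \<delta>)" using J \<delta> by (intro mult_right_mono) auto
  finally show ?thesis unfolding trace_dist_diagonalized[OF V b] by simp
qed

text \<open>The error budget for twice the trace distance is \<epsilon>/4 from imperfect programs
  plus \<epsilon>/4 from sampling, which Chebyshev turns into a deviation \<epsilon> with
  probability 3/4. Each state supplies n probes and n programs, hence 4 n sites.\<close>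

theorem trace_dist_estimator:
  fixes \<epsilon> :: real
  assumes d: "0 < d" and r: "1 \<le> r" and \<epsilon>: "0 < \<epsilon>" "\<epsilon> \<le> 1 / 2"
    and n: "8192 * (real r)\<^sup>2 / \<epsilon> ^ 4 \<le> real n"
  shows "\<exists>M est. povm (d ^ (4 * n)) (d ^ (4 * n)) M \<and>
    (\<forall>\<rho> \<sigma>. density_mat d \<rho> \<and> density_mat d \<sigma> \<and> mat_rank d \<rho> = r \<and> mat_rank d \<sigma> = r \<longrightarrow>
      3 / 4 \<le> meas_prob M {i. i < d ^ (4 * n) \<and> \<bar>est i - trace_dist \<rho> \<sigma>\<bar> \<le> \<epsilon>}
        (tensor_mat (tensor_pow \<rho> (2 * n)) (tensor_pow \<sigma> (2 * n))))"
proof -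
  define D where "D = d ^ (4 * n)"
  interpret tensor_sites d "4 * n" .
  have n0: "0 < n"
  proof (rule ccontr)
    assume "\<not> 0 < n"
    then have "8192 * (real r)\<^sup>2 / \<epsilon> ^ 4 \<le> 0" using n by simp
    moreover have "8192 * (real r)\<^sup>2 / \<epsilon> ^ 4 > 0" using r \<epsilon> by simp
    ultimately show False by linarith
  qed
  \<comment> \<open>Makes the bias 2 r \<delta> of the smoothed trace distance equal to
    \<epsilon>/2.\<close>
  define \<delta> where "\<delta> = \<epsilon> / (4 * real r)"
  have \<delta>: "\<delta> > 0" using r \<epsilon> by (simp add: \<delta>_def)
  define K where "K = nat \<lceil>1 / \<delta>\<^sup>2\<rceil>"
  have "1 / \<delta>\<^sup>2 \<le> real K" unfolding K_def by (rule real_nat_ceiling_ge)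
  then have K: "1 \<le> real K * \<delta>\<^sup>2" using \<delta> by (simp add: pos_divide_le_eq)
  \<comment> \<open>Sites below \<open>2 * n\<close> carry \<open>\<sigma>\<close>, the others \<open>\<rho>\<close>; in each half, probes come before programs.\<close>
  let ?P = "{0..<0 + n} \<union> {2 * n..<2 * n + n}" and ?I = "{n..<n + n} \<union> {3 * n..<3 * n + n}"
  \<comment> \<open>The same signed weights serve twice: over the programs they average the states
    to \<rho> - \<sigma>, and over the probes they produce the trace against \<rho> -
    \<sigma>.\<close>
  define s where "s j = (if j < 2 * n then - 1 else 1) / real n" for j
  define A where "A p = mat_sum D ?I (\<lambda>i. of_real (s i) \<cdot>\<^sub>m swap_mat p i)" for p
  have swapc: "swap_mat p i \<in> carrier_mat D D" for p i unfolding D_def by (rule swap_mat_carrier)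
  have "\<exists>U a. unitary_mat D U \<and> A p = diagonalized D U (\<lambda>j. of_real (a j :: real))" if "p \<in> ?P" for p
  proof (rule hermitian_diagonalization)
    show "A p \<in> carrier_mat D D" by (simp add: A_def)
    have "mat_adjoint (A p) = mat_sum D ?I (\<lambda>i. mat_adjoint (of_real (s i) \<cdot>\<^sub>m swap_mat p i))"
      unfolding A_def using swapc by (intro mat_sum_adj) simp
    also have "\<dots> = A p" unfolding A_def
    proof (intro mat_sum_cong)
      fix i assume "i \<in> ?I"
      then have "mat_adjoint (swap_mat p i) = swap_mat p i" using that by (intro swap_mat_adj) auto
      then show "mat_adjoint (of_real (s i) \<cdot>\<^sub>m swap_mat p i) = of_real (s i) \<cdot>\<^sub>m swap_mat p i"
        by (simp add: adj_smult)
    qed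
    finally show "mat_adjoint (A p) = A p" .
  qed
  then obtain U a where U: "\<And>p. p \<in> ?P \<Longrightarrow> unitary_mat D (U p)"
    and A: "\<And>p. p \<in> ?P \<Longrightarrow> A p = diagonalized D (U p) (\<lambda>j. of_real (a p j :: real))" by metis
  define F where "F p = diagonalized D (U p) (\<lambda>j. of_real (smooth_sgn \<delta> K (a p j)))" for p
  have F: "F p \<in> carrier_mat D D" "mat_adjoint (F p) = F p" if "p \<in> ?P" for p
    using unitary_carrier[OF U[OF that]] by (simp_all add: F_def diagonalized_adj)
  define G where "G = mat_sum D ?P (\<lambda>p. of_real (s p) \<cdot>\<^sub>m F p)"
  have "mat_adjoint G = G"
  proof -
    have "mat_adjoint G = mat_sum D ?P (\<lambda>p. mat_adjoint (of_real (s p) \<cdot>\<^sub>m F p))"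
      unfolding G_def by (intro mat_sum_adj smult_carrier_mat F)
    also have "\<dots> = G" unfolding G_def
      by (intro mat_sum_cong) (simp only: adj_smult F complex_cnj_complex_of_real)
    finally show ?thesis .
  qed
  moreover have "G \<in> carrier_mat D D" by (simp add: G_def)
  ultimately obtain W g where W: "unitary_mat D W" and G: "G = diagonalized D W (\<lambda>j. of_real (g j :: real))"
    using hermitian_diagonalization by blast
  \<comment> \<open>The eigenbasis \<open>W\<close> and the values \<open>g\<close> are fixed at
    this point; the states enter only in the analysis, so one measurement serves them all.
    \<open>g\<close> is halved because it estimates the trace norm.\<close>
  have "3 / 4 \<le> meas_prob (eigenprojection D W) {i. i < D \<and> \<bar>g i / 2 - trace_dist \<rho> \<sigma>\<bar> \<le> \<epsilon>}
        (tensor_mat (tensor_pow \<rho> (2 * n)) (tensor_pow \<sigma> (2 * n)))"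
    if \<rho>: "density_mat d \<rho>" "mat_rank d \<rho> = r" and \<sigma>: "density_mat d \<sigma>" "mat_rank d \<sigma> = r" for \<rho> \<sigma>
  proof -
    have \<rho>c: "\<rho> \<in> carrier_mat d d" and \<sigma>c: "\<sigma> \<in> carrier_mat d d" using \<rho> \<sigma> by (auto simp: density_mat_def)
    obtain Y where Y: "Y \<in> carrier_mat d d" "Y * mat_adjoint Y = \<rho>" "frob Y = 1" using density_sqrt[OF \<rho>(1)] .
    obtain Z where Z: "Z \<in> carrier_mat d d" "Z * mat_adjoint Z = \<sigma>" "frob Z = 1" using density_sqrt[OF \<sigma>(1)] .
    define z where "z j = (if j < 2 * n then Z else Y)" for j
    have z: "z j \<in> carrier_mat d d" "frob (z j) = 1" "z j * mat_adjoint (z j) = (if j < 2 * n then \<sigma> else \<rho>)" for j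
      using Y Z by (simp_all add: z_def)
    have herm: "mat_adjoint (\<rho> - \<sigma>) = \<rho> - \<sigma>"
    proof -
      have "mat_adjoint \<rho> = \<rho>" "mat_adjoint \<sigma> = \<sigma>"
        using \<rho>(1) \<sigma>(1) unfolding density_mat_def psd_mat_def by simp_all
      then show ?thesis using adj_minus[OF \<rho>c \<sigma>c] by simp
    qed
    obtain V b where V: "unitary_mat d V" and b: "\<rho> - \<sigma> = diagonalized d V (\<lambda>j. of_real (b j :: real))"
      using hermitian_diagonalization[OF minus_carrier_mat[OF \<sigma>c] herm] by blast
    have Vc: "V \<in> carrier_mat d d" using V by (rule unitary_carrier)
    have B: "mat_sum d ?I (\<lambda>i. of_real (s i) \<cdot>\<^sub>m (z i * mat_adjoint (z i))) = diagonalized d V (\<lambda>j. of_real (b j))"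
      unfolding b[symmetric]
    proof (rule mat_eqI)
      fix x y assume xy: "x < d" "y < d"
      have "(\<Sum>i\<in>?I. (of_real (s i) \<cdot>\<^sub>m (z i * mat_adjoint (z i))) $$ (x, y)) =
        of_nat n * (- 1 / of_nat n * \<sigma> $$ (x, y)) + of_nat n * (1 / of_nat n * \<rho> $$ (x, y))"
        unfolding z(3) using xy \<rho>c \<sigma>c by (intro sum_two_blocks) (auto simp: s_def)
      then show "mat_sum d ?I (\<lambda>i. of_real (s i) \<cdot>\<^sub>m (z i * mat_adjoint (z i))) $$ (x, y) = (\<rho> - \<sigma>) $$ (x, y)"
        using xy \<rho>c \<sigma>c n0 by (simp add: mat_sum_index)
    qed (use \<rho>c \<sigma>c in auto)
    define fB where "fB = diagonalized d V (\<lambda>j. of_real (smooth_sgn \<delta> K (b j)))"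
    have fB: "fB \<in> carrier_mat d d" unfolding fB_def using Vc by simp
    define \<mu> where "\<mu> = (\<Sum>j<d. b j * smooth_sgn \<delta> K (b j))"
    have \<mu>: "(\<Sum>p\<in>?P. of_real (s p) * frob_inner (z p) (fB * z p)) = of_real \<mu>"
    proof -
      have tr: "frob_inner X (fB * X) = mat_trace (fB * (X * mat_adjoint X))" if X: "X \<in> carrier_mat d d" for X
      proof -
        have fX: "fB * X \<in> carrier_mat d d" using fB X by simp
        have "frob_inner X (fB * X) = mat_trace (mat_adjoint X * (fB * X))"
          by (rule frob_inner_trace[OF X fX])
        also have "\<dots> = mat_trace (fB * X * mat_adjoint X)" using X fX by (intro mat_trace_comm[of _ d d]) simp_all
        also have "fB * X * mat_adjoint X = fB * (X * mat_adjoint X)" using X fB by (intro sq_assoc[of _ d]) simp_all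
        finally show ?thesis .
      qed
      have "(\<Sum>p\<in>?P. of_real (s p) * frob_inner (z p) (fB * z p)) =
        of_nat n * (- 1 / of_nat n * mat_trace (fB * \<sigma>)) + of_nat n * (1 / of_nat n * mat_trace (fB * \<rho>))"
        unfolding tr[OF z(1)] z(3) by (intro sum_two_blocks) (auto simp: s_def)
      also have "\<dots> = mat_trace (fB * \<rho>) - mat_trace (fB * \<sigma>)" using n0 by simp
      also have "\<dots> = mat_trace (fB * (\<rho> - \<sigma>))"
        using fB \<rho>c \<sigma>c by (simp add: mult_minus_distrib_mat[of _ d d _ d] mat_trace_def sum_subtractf[symmetric])
      also have "\<dots> = of_real \<mu>"
        unfolding b fB_def diagonalized_mult[OF V] diagonalized_trace[OF V] \<mu>_def by (simp add: mult.commute)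
      finally show ?thesis .
    qed
    have S1: "(\<Sum>p\<in>?P. \<bar>s p\<bar>) = 2"
    proof -
      have "(\<Sum>p\<in>?P. \<bar>s p\<bar>) = of_nat n * (1 / real n) + of_nat n * (1 / real n)"
        by (intro sum_two_blocks) (auto simp: s_def)
      then show ?thesis using n0 by simp
    qed
    have S2: "(\<Sum>p\<in>?P. (s p)\<^sup>2) = 2 / real n" "(\<Sum>p\<in>?I. (s p)\<^sup>2) = 2 / real n"
    proof -
      have sq: "(s p)\<^sup>2 = 1 / (real n)\<^sup>2" for p by (simp add: s_def power_divide)
      have "of_nat n * (1 / (real n)\<^sup>2) + of_nat n * (1 / (real n)\<^sup>2) = 2 / real n"
        using n0 by (simp add: power2_eq_square field_simps)
      moreover have "(\<Sum>p\<in>?P. (s p)\<^sup>2) = of_nat n * (1 / (real n)\<^sup>2) + of_nat n * (1 / (real n)\<^sup>2)"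
        "(\<Sum>p\<in>?I. (s p)\<^sup>2) = of_nat n * (1 / (real n)\<^sup>2) + of_nat n * (1 / (real n)\<^sup>2)"
        by (rule sum_two_blocks; simp add: sq)+
      ultimately show "(\<Sum>p\<in>?P. (s p)\<^sup>2) = 2 / real n" "(\<Sum>p\<in>?I. (s p)\<^sup>2) = 2 / real n"
        by (simp_all only:)
    qed
    have "frob ((G - of_real \<mu> \<cdot>\<^sub>m 1\<^sub>m D) * tensor z) \<le>
      (\<Sum>p\<in>?P. \<bar>s p\<bar>) * (2 * sqrt (\<Sum>i\<in>?I. (s i)\<^sup>2) / \<delta>) + sqrt (\<Sum>p\<in>?P. (s p)\<^sup>2)"
      unfolding G_def F_def \<mu>[symmetric] fB_def D_def
      by (rule observable_bound[OF z(1) z(2) _ _ _ U[unfolded D_def] A[unfolded A_def D_def] V B \<delta>]) auto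
    also have "\<dots> = 2 * (2 * sqrt (2 / real n) / \<delta>) + sqrt (2 / real n)" unfolding S1 S2 ..
    also have "\<dots> \<le> \<epsilon> / 2"
    proof -
      \<comment> \<open>The systematic error is 4/\<delta> times the root of 2/n. Keeping it below
        \<epsilon>/4 with 4/\<delta> = 16 r/\<epsilon> asks for a root of at most \<epsilon>^2/(64
        r), and 8192 is 2 * 64^2.\<close>
      have "2 / real n \<le> (\<epsilon>\<^sup>2 / (64 * real r))\<^sup>2"
      proof -
        have "8192 * (real r)\<^sup>2 \<le> real n * \<epsilon> ^ 4" using n \<epsilon> by (simp add: pos_divide_le_eq)
        then show ?thesis using n0 r
          by (simp add: power_divide power_mult_distrib divide_simps mult.commute flip: power_mult)
      qed
      then have h: "sqrt (2 / real n) \<le> \<epsilon>\<^sup>2 / (64 * real r)"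
        by (intro real_le_lsqrt) simp_all
      have "2 * (2 * sqrt (2 / real n) / \<delta>) = 4 / \<delta> * sqrt (2 / real n)" by simp
      also have "\<dots> \<le> 4 / \<delta> * (\<epsilon>\<^sup>2 / (64 * real r))" using \<delta> by (intro mult_left_mono h) simp
      also have "\<dots> = \<epsilon> / 4" using \<epsilon> r by (simp add: \<delta>_def field_simps power2_eq_square)
      finally have 1: "2 * (2 * sqrt (2 / real n) / \<delta>) \<le> \<epsilon> / 4" .
      \<comment> \<open>The same bound on the root also covers the sampling error, the other
        \<epsilon>/4.\<close>
      have "\<epsilon>\<^sup>2 / (64 * real r) \<le> \<epsilon> / 4"
      proof -
        have "\<epsilon>\<^sup>2 / (64 * real r) \<le> \<epsilon>\<^sup>2 / 64" using r by (intro divide_left_mono) auto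
        also have "\<dots> \<le> \<epsilon> / 4" using \<epsilon> by (simp add: power2_eq_square)
        finally show ?thesis .
      qed
      with h 1 show ?thesis by linarith
    qed
    finally have dev: "frob ((diagonalized D W (\<lambda>j. of_real (g j)) - of_real \<mu> \<cdot>\<^sub>m 1\<^sub>m D) * tensor z) \<le> \<epsilon> / 2"
      unfolding G .
    have approx: "\<bar>\<mu> / 2 - trace_dist \<rho> \<sigma>\<bar> \<le> \<epsilon> / 2"
      using smooth_trace_dist_approx[OF \<rho> \<sigma> V b \<delta> K] r by (simp add: \<mu>_def \<delta>_def)
    have \<Psi>: "tensor z \<in> carrier_mat D D" "frob (tensor z) = 1"
      using z by (simp_all add: D_def frob_tensor)
    have "tensor z * mat_adjoint (tensor z) = tensor (\<lambda>j. if j < 2 * n then \<sigma> else \<rho>)"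
      using z by (simp add: tensor_adj tensor_mult)
    also have "\<dots> = tensor_mat (tensor_pow \<rho> (2 * n)) (tensor_pow \<sigma> (2 * n))"
      unfolding tensor_pow_tensor[OF d \<rho>c] tensor_pow_tensor[OF d \<sigma>c] tensor_mat_tensor[OF d] by simp
    finally have \<tau>: "tensor z * mat_adjoint (tensor z) = tensor_mat (tensor_pow \<rho> (2 * n)) (tensor_pow \<sigma> (2 * n))" .
    show ?thesis unfolding \<tau>[symmetric]
    proof (rule measurement_concentration[OF W \<Psi> \<epsilon>(1) dev])
      fix i assume "i < D" "\<bar>g i - \<mu>\<bar> \<le> \<epsilon>"
      \<comment> \<open>Halving turns the deviation \<epsilon> of \<open>g i\<close> into
        \<epsilon>/2; the bias accounts for the other \<epsilon>/2.\<close>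
      moreover from this have "\<bar>g i / 2 - trace_dist \<rho> \<sigma>\<bar> \<le> \<epsilon>" using approx by linarith
      ultimately show "i \<in> {i. i < D \<and> \<bar>g i / 2 - trace_dist \<rho> \<sigma>\<bar> \<le> \<epsilon>}" by simp
    qed auto
  qed
  then show ?thesis using povm_eigenprojection[OF W]
    by (intro exI[of _ "eigenprojection D W"] exI[of _ "\<lambda>i. g i / 2"]) (simp add: D_def)
qed

theorem theorem3p3:
  "\<exists>C > 0. \<forall>r::nat. \<forall>\<epsilon>::real. \<forall>d::nat. 1 \<le> r \<and> 0 < \<epsilon> \<and> \<epsilon> \<le> 1/2 \<longrightarrow>
     (\<exists>(a::nat) (b::nat) (k::nat) (M::nat \<Rightarrow> complex mat) (est::nat \<Rightarrow> real).
        real (a + b) \<le> C * (real r)^2 / \<epsilon>^4 * (ln (1/\<epsilon>))^2 \<and>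
        povm (d^(a+b)) k M \<and>
        (\<forall>\<rho> \<sigma>. density_mat d \<rho> \<and> density_mat d \<sigma> \<and> mat_rank d \<rho> = r \<and> mat_rank d \<sigma> = r \<longrightarrow>
           meas_prob M {i. i < k \<and> \<bar>est i - trace_dist \<rho> \<sigma>\<bar> \<le> \<epsilon>}
             (tensor_mat (tensor_pow \<rho> a) (tensor_pow \<sigma> b)) \<ge> 2/3))"
\<comment> \<open>131088 = 4 * 8193 * 4: four blocks of sites, 8192 plus 1 for rounding up, and the
  inverse of the lower bound 1/4 on the squared logarithm.\<close>
proof (rule exI[of _ "131088 :: real"], intro conjI allI impI)
  fix r :: nat and \<epsilon> :: real and d :: nat
  assume "1 \<le> r \<and> 0 < \<epsilon> \<and> \<epsilon> \<le> 1/2"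
  then have r: "1 \<le> r" and \<epsilon>: "0 < \<epsilon>" "\<epsilon> \<le> 1 / 2" by auto
  show "\<exists>(a::nat) (b::nat) (k::nat) (M::nat \<Rightarrow> complex mat) (est::nat \<Rightarrow> real).
        real (a + b) \<le> 131088 * (real r)^2 / \<epsilon>^4 * (ln (1/\<epsilon>))^2 \<and>
        povm (d^(a+b)) k M \<and>
        (\<forall>\<rho> \<sigma>. density_mat d \<rho> \<and> density_mat d \<sigma> \<and> mat_rank d \<rho> = r \<and> mat_rank d \<sigma> = r \<longrightarrow>
           meas_prob M {i. i < k \<and> \<bar>est i - trace_dist \<rho> \<sigma>\<bar> \<le> \<epsilon>}
             (tensor_mat (tensor_pow \<rho> a) (tensor_pow \<sigma> b)) \<ge> 2/3)"
  proof (cases "d = 0")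
    case True
    \<comment> \<open>In dimension 0 the trace is an empty sum and cannot be 1, so there are no
      states. With zero copies the measured space has dimension 0^0 = 1, and the trivial measurement
      is a witness.\<close>
    have "\<not> density_mat d \<rho>" for \<rho> using True by (auto simp: density_mat_def mat_trace_def)
    moreover have "povm (d ^ (0 + 0)) 1 (eigenprojection 1 (1\<^sub>m 1))"
      using povm_eigenprojection[of 1 "1\<^sub>m 1"] by (simp add: unitary_mat_def)
    moreover have "real (0 + 0) \<le> 131088 * (real r)^2 / \<epsilon>^4 * (ln (1/\<epsilon>))^2" by simp
    ultimately show ?thesis by blast
  next
    case False
    define n where "n = nat \<lceil>8192 * (real r)\<^sup>2 / \<epsilon> ^ 4\<rceil>"
    have n: "8192 * (real r)\<^sup>2 / \<epsilon> ^ 4 \<le> real n" unfolding n_def by (rule real_nat_ceiling_ge)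
    \<comment> \<open>The main term is at least 1, so it absorbs the 1 added by the ceiling.\<close>
    have q: "1 \<le> (real r)\<^sup>2 / \<epsilon> ^ 4"
    proof -
      have "\<epsilon> ^ 4 \<le> 1" using \<epsilon> by (intro power_le_one) auto
      also have "1 \<le> (real r)\<^sup>2" using r by simp
      finally show ?thesis using \<epsilon> by simp
    qed
    have "real n \<le> 8192 * (real r)\<^sup>2 / \<epsilon> ^ 4 + 1" 
      unfolding n_def using of_int_ceiling_le_add_one[of "8192 * (real r)\<^sup>2 / \<epsilon> ^ 4"] q by simp
    then have n': "real n \<le> 8193 * ((real r)\<^sup>2 / \<epsilon> ^ 4)" using q by simp
    \<comment> \<open>For \<epsilon> \<le> 1/2 the logarithm stays away from 0; at \<epsilon> = 1
      the claimed number of copies would be 0.\<close>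
    have "1 / 2 \<le> ln (1 / \<epsilon>)"
    proof -
      have "ln \<epsilon> \<le> \<epsilon> - 1" using \<epsilon> by (intro ln_le_minus_one) simp
      then show ?thesis using \<epsilon> by (simp add: ln_div)
    qed
    then have l: "1 / 4 \<le> (ln (1 / \<epsilon>))\<^sup>2" using power_mono[of "1 / 2" "ln (1 / \<epsilon>)" 2] by (simp add: power_divide)
    have "real (2 * n + 2 * n) \<le> 4 * (8193 * ((real r)\<^sup>2 / \<epsilon> ^ 4))" using n' by simp
    also have "\<dots> = 131088 * ((real r)\<^sup>2 / \<epsilon> ^ 4) * (1 / 4)" by simp
    also have "\<dots> \<le> 131088 * ((real r)\<^sup>2 / \<epsilon> ^ 4) * (ln (1 / \<epsilon>))\<^sup>2" using l q by (intro mult_left_mono) auto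
    finally have count: "real (2 * n + 2 * n) \<le> 131088 * (real r)\<^sup>2 / \<epsilon> ^ 4 * (ln (1 / \<epsilon>))\<^sup>2" by simp
    have four: "4 * n = 2 * n + 2 * n" by simp
    obtain M est where "povm (d ^ (2 * n + 2 * n)) (d ^ (2 * n + 2 * n)) M"
      "\<And>\<rho> \<sigma>. density_mat d \<rho> \<and> density_mat d \<sigma> \<and> mat_rank d \<rho> = r \<and> mat_rank d \<sigma> = r \<Longrightarrow>
        3 / 4 \<le> meas_prob M {i. i < d ^ (2 * n + 2 * n) \<and> \<bar>est i - trace_dist \<rho> \<sigma>\<bar> \<le> \<epsilon>}
        (tensor_mat (tensor_pow \<rho> (2 * n)) (tensor_pow \<sigma> (2 * n)))"
      using trace_dist_estimator[OF _ r \<epsilon> n, of d] False unfolding four by blast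
    note est = this
    show ?thesis
    proof (rule exI[of _ "2 * n"], rule exI[of _ "2 * n"], rule exI[of _ "d ^ (2 * n + 2 * n)"],
        rule exI[of _ M], rule exI[of _ est], intro conjI allI impI count est(1))
      fix \<rho> \<sigma>
      assume "density_mat d \<rho> \<and> density_mat d \<sigma> \<and> mat_rank d \<rho> = r \<and> mat_rank d \<sigma> = r"
      then show "2 / 3 \<le> meas_prob M {i. i < d ^ (2 * n + 2 * n) \<and> \<bar>est i - trace_dist \<rho> \<sigma>\<bar> \<le> \<epsilon>}
          (tensor_mat (tensor_pow \<rho> (2 * n)) (tensor_pow \<sigma> (2 * n)))"
        by (intro order_trans[OF _ est(2)]) auto
    qed
  qed
qed simp

end
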